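(* Assume the Smooth Manifold Assumption holds, that the feasible set $\mathcal{C}$ is compact, and let $R,K$ be finite constants satisfying $\operatorname{Tr}(X)\le R$ for all $X\in\mathcal{C}$ and $\|\mathcal{A}^*\circ G(Y)^{\dagger}\circ\mathcal{A}\|_{\mathrm{op}}\le K$ for all $Y\in\mathcal{M}_k$. Let $W$ be a Gaussian Wigner matrix with variance $\sigma_W^2>0$ and let $\delta\in(0,1)$. Define $$\kappa = RK\left(\|C\|_{\mathrm{op}}+3\sigma_W\sqrt{n}\right).$$ There exists a universal constant $c_0>0$ such that the following holds. If $$k \ge 3\left[\log(n)+\sqrt{\log(1/\delta)}+\sqrt{m\log\left(1+\frac{6\kappa\sqrt{c_0 n}}{\sigma_W}\right)}\right],$$ then with probability at least $1-\delta-e^{-n/2}$ over $W$, every $(\varepsilon_g,\varepsilon_H)$-SOSP $Y\in\mathbb{K}^{n\times k}$ of problem (P) with cost matrix $C+W$ (for any $\varepsilon_g,\varepsilon_H\ge 0$) satisfies $$0\le g(Y)-f^\star \le (\varepsilon_H+\varepsilon_g^2\eta)R+\frac{\varepsilon_g}{2}\sqrt{R},$$ where $g(Y)=\langle (C+W)Y,Y\rangle$, $f^\star$ is the optimal value of (SDP) with cost matrix $C+W$, and $$\eta=\frac{c_0\, n\, K(2+KR)^2\left(\|C\|_{\mathrm{op}}+3\sigma_W\sqrt{n}\right)}{9m\,\sigma_W^2\log\left(1+\frac{6\kappa\sqrt{c_0 n}}{\sigma_W}\right)}.$$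
   Context: $\mathbb{K}=\mathbb{R}$ or $\mathbb{C}$. For matrices $A,B$ of the same size, $\langle A,B\rangle=\operatorname{Re}\operatorname{Tr}(A^*B)$, with Frobenius norm $\|A\|=\sqrt{\langle A,A\rangle}$; $\|\cdot\|_{\mathrm{op}}$ denotes the spectral norm of a matrix, and for a linear map $f$ between matrix spaces $\|f\|_{\mathrm{op}}=\sup_{A\ne0}\|f(A)\|/\|A\|$ (Frobenius norms). $\mathbb{S}^{n\times n}$ is the set of self-adjoint $n\times n$ matrices over $\mathbb{K}$ (real symmetric or complex Hermitian). Given $C,A_1,\dots,A_m\in\mathbb{S}^{n\times n}$ and $b\in\mathbb{R}^m$, let $\mathcal{A}(Z)_i=\langle A_i,Z\rangle$ for $Z\in\mathbb{K}^{n\times n}$, with adjoint $\mathcal{A}^*(\mu)=\sum_i\mu_iA_i$. The problem (SDP) is $\min\{\langle C,X\rangle: X\in\mathbb{S}^{n\times n},\ \mathcal{A}(X)=b,\ X\succeq0\}$ with feasible set $\mathcal{C}$. The problem (P) is $\min\{g(Y)=\langle CY,Y\rangle : Y\in\mathcal{M}_k\}$ where $\mathcal{M}_k=\{Y\in\mathbb{K}^{n\times k}:\mathcal{A}(YY^* )=b\}$. Smooth Manifold Assumption: for every $k\le n$ with $\mathcal{M}_k\neq\emptyset$, either (1) $A_1Y,\dots,A_mY$ are linearly independent in $\mathbb{K}^{n\times k}$ for all $Y\in\mathcal{M}_k$, or (2) $A_1Y,\dots,A_mY$ span a subspace of constant dimension for all $Y$ in an open neighborhood of $\mathcal{M}_k$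 in $\mathbb{K}^{n\times k}$. For $Y\in\mathcal{M}_k$: $G(Y)\in\mathbb{R}^{m\times m}$ with $G_{ij}=\langle A_iY,A_jY\rangle$, $G^\dagger$ its Moore–Penrose pseudo-inverse; $T_Y\mathcal{M}=\{\dot Y\in\mathbb{K}^{n\times k}:\langle A_iY,\dot Y\rangle=0,\ i=1,\dots,m\}$; $\mu(Y)=G^\dagger\mathcal{A}(CYY^* )$ and $S(Y)=C-\mathcal{A}^*(\mu(Y))$ (with $C$ replaced by the cost matrix of the problem under consideration). $Y\in\mathcal{M}_k$ is an $\varepsilon_g$-FOSP of (P) if $\|2S(Y)Y\|\le\varepsilon_g$; it is an $(\varepsilon_g,\varepsilon_H)$-SOSP if additionally $\langle\dot Y,S(Y)\dot Y\rangle\ge-\varepsilon_H\|\dot Y\|^2$ for all $\dot Y\in T_Y\mathcal{M}$. A Gaussian Wigner matrix with variance $\sigma_W^2$ is a random $W=W^*\in\mathbb{S}^{n\times n}$ whose entries on and above the diagonal are independent zero-mean Gaussian variables (real or complex according to $\mathbb{K}$) with variance $\sigma_W^2$. *)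

theory Defs
  imports "HOL-Analysis.Analysis" "HOL-Probability.Probability"
begin

text \<open>Matrices are functions nat => nat => complex, supported on the index box.
  The flag rc selects the scalar field: rc = True means K = R (entries real),
  rc = False means K = C.\<close>

type_synonym cmat = "nat \<Rightarrow> nat \<Rightarrow> complex"

definition Kset :: "bool \<Rightarrow> complex set" where
  "Kset rc = (if rc then \<real> else UNIV)"

definition kmat :: "bool \<Rightarrow> nat \<Rightarrow> nat \<Rightarrow> cmat \<Rightarrow> bool" where
  "kmat rc p q A \<longleftrightarrow> (\<forall>i j. (i < p \<and> j < q \<longrightarrow> A i j \<in> Kset rc) \<and>
                              (\<not> (i < p \<and> j < q) \<longrightarrow> A i j = 0))"

definition Kmats :: "bool \<Rightarrow> nat \<Rightarrow> nat \<Rightarrow> cmat set" where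
  "Kmats rc p q = {A. kmat rc p q A}"

definition kvec :: "bool \<Rightarrow> nat \<Rightarrow> (nat \<Rightarrow> complex) \<Rightarrow> bool" where
  "kvec rc p x \<longleftrightarrow> (\<forall>i. (i < p \<longrightarrow> x i \<in> Kset rc) \<and> (\<not> i < p \<longrightarrow> x i = 0))"

definition minner :: "nat \<Rightarrow> nat \<Rightarrow> cmat \<Rightarrow> cmat \<Rightarrow> real" where
  "minner p q A B = (\<Sum>i<p. \<Sum>j<q. Re (cnj (A i j) * B i j))"

definition fnorm :: "nat \<Rightarrow> nat \<Rightarrow> cmat \<Rightarrow> real" where
  "fnorm p q A = sqrt (minner p q A A)"

definition mmult :: "nat \<Rightarrow> cmat \<Rightarrow> cmat \<Rightarrow> cmat" where
  "mmult l A B = (\<lambda>i j. \<Sum>r<l. A i r * B r j)"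

definition madj :: "cmat \<Rightarrow> cmat" where
  "madj A = (\<lambda>i j. cnj (A j i))"

definition madd :: "cmat \<Rightarrow> cmat \<Rightarrow> cmat" where
  "madd A B = (\<lambda>i j. A i j + B i j)"

definition mtrace :: "nat \<Rightarrow> cmat \<Rightarrow> complex" where
  "mtrace n X = (\<Sum>i<n. X i i)"

definition sadj :: "bool \<Rightarrow> nat \<Rightarrow> cmat \<Rightarrow> bool" where
  "sadj rc n A \<longleftrightarrow> kmat rc n n A \<and> (\<forall>i<n. \<forall>j<n. A j i = cnj (A i j))"

definition psd :: "bool \<Rightarrow> nat \<Rightarrow> cmat \<Rightarrow> bool" where
  "psd rc n A \<longleftrightarrow> (\<forall>x. kvec rc n x \<longrightarrow> 0 \<le> Re (\<Sum>i<n. \<Sum>j<n. cnj (x i) * A i j * x j))"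

definition mvec :: "nat \<Rightarrow> cmat \<Rightarrow> (nat \<Rightarrow> complex) \<Rightarrow> (nat \<Rightarrow> complex)" where
  "mvec n A x = (\<lambda>i. \<Sum>j<n. A i j * x j)"

definition vnorm :: "nat \<Rightarrow> (nat \<Rightarrow> complex) \<Rightarrow> real" where
  "vnorm n x = sqrt (\<Sum>i<n. (cmod (x i))\<^sup>2)"

definition specnorm :: "bool \<Rightarrow> nat \<Rightarrow> cmat \<Rightarrow> real" where
  "specnorm rc n A = Sup {vnorm n (mvec n A x) / vnorm n x | x. kvec rc n x \<and> x \<noteq> (\<lambda>_. 0)}"

definition Aop :: "nat \<Rightarrow> (nat \<Rightarrow> cmat) \<Rightarrow> cmat \<Rightarrow> (nat \<Rightarrow> real)" where
  "Aop n As Z = (\<lambda>i. minner n n (As i) Z)"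

definition Aadj :: "nat \<Rightarrow> (nat \<Rightarrow> cmat) \<Rightarrow> (nat \<Rightarrow> real) \<Rightarrow> cmat" where
  "Aadj m As \<mu> = (\<lambda>a c. \<Sum>i<m. complex_of_real (\<mu> i) * As i a c)"

text \<open>Moore--Penrose pseudo-inverse of a real m x m matrix (unique solution of
  the four Penrose equations, zero outside the index box).\<close>
definition rmmult :: "nat \<Rightarrow> (nat \<Rightarrow> nat \<Rightarrow> real) \<Rightarrow> (nat \<Rightarrow> nat \<Rightarrow> real) \<Rightarrow> (nat \<Rightarrow> nat \<Rightarrow> real)" where
  "rmmult m A B = (\<lambda>i j. \<Sum>r<m. A i r * B r j)"

definition pinv :: "nat \<Rightarrow> (nat \<Rightarrow> nat \<Rightarrow> real) \<Rightarrow> (nat \<Rightarrow> nat \<Rightarrow> real)" where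
  "pinv m G = (THE X. (\<forall>i j. \<not> (i < m \<and> j < m) \<longrightarrow> X i j = 0) \<and>
      (\<forall>i<m. \<forall>j<m. rmmult m (rmmult m G X) G i j = G i j) \<and>
      (\<forall>i<m. \<forall>j<m. rmmult m (rmmult m X G) X i j = X i j) \<and>
      (\<forall>i<m. \<forall>j<m. rmmult m G X j i = rmmult m G X i j) \<and>
      (\<forall>i<m. \<forall>j<m. rmmult m X G j i = rmmult m X G i j))"

definition feas :: "bool \<Rightarrow> nat \<Rightarrow> nat \<Rightarrow> (nat \<Rightarrow> cmat) \<Rightarrow> (nat \<Rightarrow> real) \<Rightarrow> cmat set" where
  "feas rc n m As b = {X. sadj rc n X \<and> (\<forall>i<m. Aop n As X i = b i) \<and> psd rc n X}"

definition sdp_opt :: "bool \<Rightarrow> nat \<Rightarrow> nat \<Rightarrow> cmat \<Rightarrow> (nat \<Rightarrow> cmat) \<Rightarrow> (nat \<Rightarrow> real) \<Rightarrow> real" where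
  "sdp_opt rc n m C As b = Inf ((\<lambda>X. minner n n C X) ` feas rc n m As b)"

definition Mk :: "bool \<Rightarrow> nat \<Rightarrow> nat \<Rightarrow> nat \<Rightarrow> (nat \<Rightarrow> cmat) \<Rightarrow> (nat \<Rightarrow> real) \<Rightarrow> cmat set" where
  "Mk rc n k m As b = {Y. kmat rc n k Y \<and> (\<forall>i<m. Aop n As (mmult k Y (madj Y)) i = b i)}"

definition Gram :: "nat \<Rightarrow> nat \<Rightarrow> nat \<Rightarrow> (nat \<Rightarrow> cmat) \<Rightarrow> cmat \<Rightarrow> (nat \<Rightarrow> nat \<Rightarrow> real)" where
  "Gram n k m As Y = (\<lambda>i j. if i < m \<and> j < m
      then minner n k (mmult n (As i) Y) (mmult n (As j) Y) else 0)"

definition mu :: "nat \<Rightarrow> nat \<Rightarrow> nat \<Rightarrow> (nat \<Rightarrow> cmat) \<Rightarrow> cmat \<Rightarrow> cmat \<Rightarrow> (nat \<Rightarrow> real)" where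
  "mu n k m As C Y = (\<lambda>i. \<Sum>j<m. pinv m (Gram n k m As Y) i j *
      Aop n As (mmult k (mmult n C Y) (madj Y)) j)"

definition Smat :: "nat \<Rightarrow> nat \<Rightarrow> nat \<Rightarrow> (nat \<Rightarrow> cmat) \<Rightarrow> cmat \<Rightarrow> cmat \<Rightarrow> cmat" where
  "Smat n k m As C Y = (\<lambda>a c. C a c - Aadj m As (mu n k m As C Y) a c)"

definition tangent :: "bool \<Rightarrow> nat \<Rightarrow> nat \<Rightarrow> nat \<Rightarrow> (nat \<Rightarrow> cmat) \<Rightarrow> cmat \<Rightarrow> cmat set" where
  "tangent rc n k m As Y = {Yd. kmat rc n k Yd \<and> (\<forall>i<m. minner n k (mmult n (As i) Y) Yd = 0)}"

definition gcost :: "nat \<Rightarrow> nat \<Rightarrow> cmat \<Rightarrow> cmat \<Rightarrow> real" where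
  "gcost n k C Y = minner n k (mmult n C Y) Y"

definition is_sosp :: "bool \<Rightarrow> nat \<Rightarrow> nat \<Rightarrow> nat \<Rightarrow> (nat \<Rightarrow> cmat) \<Rightarrow> (nat \<Rightarrow> real) \<Rightarrow> cmat \<Rightarrow> real \<Rightarrow> real \<Rightarrow> cmat \<Rightarrow> bool" where
  "is_sosp rc n k m As b C eg eH Y \<longleftrightarrow>
     Y \<in> Mk rc n k m As b \<and>
     fnorm n k (\<lambda>a c. 2 * mmult n (Smat n k m As C Y) Y a c) \<le> eg \<and>
     (\<forall>Yd \<in> tangent rc n k m As Y.
        minner n k Yd (mmult n (Smat n k m As C Y) Yd) \<ge> - eH * (fnorm n k Yd)\<^sup>2)"

definition rindep :: "(nat \<Rightarrow> cmat) \<Rightarrow> nat set \<Rightarrow> bool" where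
  "rindep vs S \<longleftrightarrow> (\<forall>c :: nat \<Rightarrow> real.
      (\<forall>a d. (\<Sum>i\<in>S. complex_of_real (c i) * vs i a d) = 0) \<longrightarrow> (\<forall>i\<in>S. c i = 0))"

definition spandim :: "nat \<Rightarrow> (nat \<Rightarrow> cmat) \<Rightarrow> nat" where
  "spandim m vs = Max {card S | S. S \<subseteq> {..<m} \<and> rindep vs S}"

definition SMA :: "bool \<Rightarrow> nat \<Rightarrow> nat \<Rightarrow> (nat \<Rightarrow> cmat) \<Rightarrow> (nat \<Rightarrow> real) \<Rightarrow> bool" where
  "SMA rc n m As b \<longleftrightarrow> (\<forall>k\<le>n. Mk rc n k m As b \<noteq> {} \<longrightarrow>
     ((\<forall>Y \<in> Mk rc n k m As b. rindep (\<lambda>i. mmult n (As i) Y) {..<m}) \<or>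
      (\<exists>U. openin (top_of_set (Kmats rc n k)) U \<and> Mk rc n k m As b \<subseteq> U \<and>
           (\<forall>Y\<in>U. \<forall>Y'\<in>U. spandim m (\<lambda>i. mmult n (As i) Y) = spandim m (\<lambda>i. mmult n (As i) Y')))))"

definition AGA_opnorm :: "bool \<Rightarrow> nat \<Rightarrow> nat \<Rightarrow> nat \<Rightarrow> (nat \<Rightarrow> cmat) \<Rightarrow> cmat \<Rightarrow> real" where
  "AGA_opnorm rc n k m As Y = Sup {fnorm n n (Aadj m As (\<lambda>i. \<Sum>j<m. pinv m (Gram n k m As Y) i j * Aop n As Z j))
        / fnorm n n Z | Z. kmat rc n n Z \<and> Z \<noteq> (\<lambda>_ _. 0)}"

text \<open>Gaussian Wigner matrix. Sample space: independent standard normals indexed by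
  ((i,j),t); the matrix entry (i,j), i<j, is sigma*g in the real case and
  sigma/sqrt 2 (g + i g') in the complex case (so E|W_ij|^2 = sigma^2);
  diagonal entries are real N(0,sigma^2); lower triangle by self-adjointness.\<close>
definition wig_space :: "nat \<Rightarrow> ((nat \<times> nat) \<times> bool \<Rightarrow> real) measure" where
  "wig_space n = PiM (({..<n} \<times> {..<n}) \<times> UNIV) (\<lambda>_. density lborel std_normal_density)"

definition wig_entry :: "bool \<Rightarrow> real \<Rightarrow> ((nat \<times> nat) \<times> bool \<Rightarrow> real) \<Rightarrow> nat \<Rightarrow> nat \<Rightarrow> complex" where
  "wig_entry rc \<sigma> \<omega> i j = (if rc then complex_of_real (\<sigma> * \<omega> ((i,j),False))
      else complex_of_real (\<sigma> / sqrt 2) * (complex_of_real (\<omega> ((i,j),False)) + \<i> * complex_of_real (\<omega> ((i,j),True))))"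

definition wigner :: "bool \<Rightarrow> nat \<Rightarrow> real \<Rightarrow> ((nat \<times> nat) \<times> bool \<Rightarrow> real) \<Rightarrow> cmat" where
  "wigner rc n \<sigma> \<omega> = (\<lambda>i j. if i < n \<and> j < n then
      (if i = j then complex_of_real (\<sigma> * \<omega> ((i,i),False))
       else if i < j then wig_entry rc \<sigma> \<omega> i j else cnj (wig_entry rc \<sigma> \<omega> j i))
      else 0)"

end

theory Submission
  imports Defs
begin

text \<open>
  Let \<open>S = C + W - A\<^sup>*(\<mu>)\<close> be the dual matrix of a second order point \<open>Y\<close>. If some unit vector \<open>u\<close>
  makes \<open>Y u\<close> small, then testing the second order condition with the tangent part of \<open>x u\<^sup>*\<close> shows
  that \<open>S\<close> is almost positive semidefinite, and weak duality bounds the optimality gap. Otherwise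
  \<open>S Y \<approx> 0\<close> makes the range of \<open>Y\<close> a \<open>k\<close>-dimensional almost kernel of \<open>S\<close>.

  Such a large almost kernel is unlikely for any fixed \<open>\<mu>\<close>: the principal minor of \<open>S\<close> obtained
  by deleting an index \<open>i\<close> has an almost kernel of dimension \<open>k - 1\<close>, and for a suitable \<open>i\<close> the
  projection onto it of the independent column \<open>i\<close> is small, which is a Gaussian small ball event in
  dimension \<open>k - 1\<close>. Iterating \<open>k / 2\<close> times gives probability \<open>exp (- k\<^sup>2)\<close>. A net over the relevant
  multipliers \<open>A\<^sup>*(\<mu>)\<close>, which form a bounded set of dimension at most \<open>m\<close>, makes this uniform.
\<close>


section \<open>Linear algebra over finite index sets\<close>

text \<open>The obstacle is that the multiplier depends on both \<open>Y\<close> and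
  \<open>W\<close>, so \<open>S\<close> is not a Wigner matrix with a fixed shift. The net restores
  independence, and its size, about \<open>exp (2 * m * L)\<close>, is what forces \<open>k\<close>
  to dominate \<open>sqrt (m * L)\<close>. A probability of order \<open>exp (- k)\<close> for one
  shift would not pay for it: the exponent has to be quadratic in \<open>k\<close>. Each deletion
  contributes a factor exponential in the remaining dimension, so the recursion stops halfway, while
  that dimension is still proportional to \<open>k\<close>. The suitable index comes from a
  pigeonhole: the diagonal entries of the projection onto a \<open>d\<close>-dimensional space sum
  to \<open>d\<close>, so one of the \<open>n\<close> entries is at least \<open>d / n\<close>. This
  average is the source of the threshold \<open>k * \<sigma> / sqrt n\<close> and, with
  \<open>k\<^sup>2 \<ge> 9 * m * L\<close>, of the denominator of \<open>\<eta>\<close>. The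
  dimension \<open>m\<close> of the net is a real one, since multipliers are real even for complex
  matrices; hence real projections and a real Gram-Schmidt process stand next to complex linear
  algebra.\<close>

definition cip :: "'a set \<Rightarrow> ('a \<Rightarrow> complex) \<Rightarrow> ('a \<Rightarrow> complex) \<Rightarrow> complex" where
  "cip I x y = (\<Sum>i\<in>I. cnj (x i) * y i)"

definition cnm :: "'a set \<Rightarrow> ('a \<Rightarrow> complex) \<Rightarrow> real" where
  "cnm I x = L2_set (\<lambda>i. cmod (x i)) I"

lemma cip_cong: "(\<And>i. i \<in> I \<Longrightarrow> x i = x' i) \<Longrightarrow> (\<And>i. i \<in> I \<Longrightarrow> y i = y' i) \<Longrightarrow> cip I x y = cip I x' y'"
  by (simp add: cip_def)

lemma cnm_cong: "(\<And>i. i \<in> I \<Longrightarrow> x i = x' i) \<Longrightarrow> cnm I x = cnm I x'"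
  by (simp add: cnm_def L2_set_def)

lemma cnm_nonneg [simp]: "0 \<le> cnm I x"
  by (simp add: cnm_def)

lemma cnm_sq: "(cnm I x)\<^sup>2 = (\<Sum>i\<in>I. (cmod (x i))\<^sup>2)"
  by (simp add: cnm_def L2_set_def sum_nonneg)

lemma cip_self: "cip I x x = complex_of_real ((cnm I x)\<^sup>2)"
  by (simp add: cip_def cnm_sq mult.commute[of "cnj _"] complex_norm_square[symmetric])

lemma cip_cnj: "cnj (cip I x y) = cip I y x"
  by (simp add: cip_def mult.commute)

lemma cip_add_left: "cip I (\<lambda>i. x i + y i) z = cip I x z + cip I y z"
  and cip_add_right: "cip I z (\<lambda>i. x i + y i) = cip I z x + cip I z y"
  and cip_diff_left: "cip I (\<lambda>i. x i - y i) z = cip I x z - cip I y z"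
  and cip_diff_right: "cip I z (\<lambda>i. x i - y i) = cip I z x - cip I z y"
  and cip_scale_left: "cip I (\<lambda>i. c * x i) z = cnj c * cip I x z"
  and cip_scale_right: "cip I z (\<lambda>i. c * x i) = c * cip I z x"
  by (simp_all add: cip_def algebra_simps sum.distrib sum_subtractf sum_distrib_left)

lemma cip_sum_left: "cip I (\<lambda>i. \<Sum>a\<in>A. f a * x a i) z = (\<Sum>a\<in>A. cnj (f a) * cip I (x a) z)"
  unfolding cip_def by (simp add: sum_distrib_left sum_distrib_right mult.assoc) (rule sum.swap)

lemma cip_sum_right: "cip I z (\<lambda>i. \<Sum>a\<in>A. f a * x a i) = (\<Sum>a\<in>A. f a * cip I z (x a))"
  unfolding cip_def by (simp add: sum_distrib_left mult_ac) (rule sum.swap)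

lemma cip_Cauchy_Schwarz: "cmod (cip I x y) \<le> cnm I x * cnm I y"
proof -
  have "cmod (cip I x y) \<le> (\<Sum>i\<in>I. \<bar>cmod (x i)\<bar> * \<bar>cmod (y i)\<bar>)"
    unfolding cip_def by (rule order_trans[OF norm_sum]) (simp add: norm_mult)
  also have "\<dots> \<le> cnm I x * cnm I y"
    unfolding cnm_def by (rule L2_set_mult_ineq)
  finally show ?thesis .
qed

lemma cnm_triangle: "cnm I (\<lambda>i. x i + y i) \<le> cnm I x + cnm I y"
proof -
  have "cnm I (\<lambda>i. x i + y i) \<le> L2_set (\<lambda>i. cmod (x i) + cmod (y i)) I"
    unfolding cnm_def by (intro L2_set_mono norm_triangle_ineq) auto
  also have "\<dots> \<le> cnm I x + cnm I y" unfolding cnm_def by (rule L2_set_triangle_ineq)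
  finally show ?thesis .
qed

lemma cnm_scale: "cnm I (\<lambda>i. c * x i) = cmod c * cnm I x"
  unfolding cnm_def by (simp add: norm_mult L2_set_right_distrib)

lemma cnm_minus: "cnm I (\<lambda>i. - x i) = cnm I x"
  by (simp add: cnm_def)

lemma cnm_triangle_diff: "cnm I (\<lambda>i. x i - y i) \<le> cnm I x + cnm I y"
  using cnm_triangle[of I x "\<lambda>i. - y i"] by (simp add: cnm_minus)

lemma cnm_0 [simp]: "cnm I (\<lambda>i. 0) = 0"
  by (simp add: cnm_def L2_set_def)

lemma cnm_eq_0_iff: "finite I \<Longrightarrow> cnm I x = 0 \<longleftrightarrow> (\<forall>i\<in>I. x i = 0)"
  by (simp add: cnm_def L2_set_eq_0_iff)

lemma cnm_mono: "finite J \<Longrightarrow> I \<subseteq> J \<Longrightarrow> cnm I x \<le> cnm J x"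
  unfolding cnm_def L2_set_def by (intro real_sqrt_le_mono sum_mono2) auto

lemma norm_le_cnm: "finite I \<Longrightarrow> i \<in> I \<Longrightarrow> cmod (x i) \<le> cnm I x"
  unfolding cnm_def by (rule member_le_L2_set)

lemma cnm_sum_le: "cnm I (\<lambda>i. \<Sum>a\<in>A. f a * x a i) \<le> (\<Sum>a\<in>A. cmod (f a) * cnm I (x a))"
proof (induction A rule: infinite_finite_induct)
  case (insert a A)
  thus ?case
    using cnm_triangle[of I "\<lambda>i. f a * x a i" "\<lambda>i. \<Sum>a\<in>A. f a * x a i"]
    by (simp add: cnm_scale)
qed auto

section \<open>The scalar field and homogeneous linear systems\<close>

lemma Kset_closed:
  "0 \<in> Kset rc" "1 \<in> Kset rc" "complex_of_real r \<in> Kset rc"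
  "x \<in> Kset rc \<Longrightarrow> y \<in> Kset rc \<Longrightarrow> x + y \<in> Kset rc"
  "x \<in> Kset rc \<Longrightarrow> y \<in> Kset rc \<Longrightarrow> x - y \<in> Kset rc"
  "x \<in> Kset rc \<Longrightarrow> y \<in> Kset rc \<Longrightarrow> x * y \<in> Kset rc"
  "x \<in> Kset rc \<Longrightarrow> y \<in> Kset rc \<Longrightarrow> x / y \<in> Kset rc"
  "x \<in> Kset rc \<Longrightarrow> - x \<in> Kset rc"
  "x \<in> Kset rc \<Longrightarrow> cnj x \<in> Kset rc"
  by (auto simp: Kset_def Reals_cnj_iff)

lemma Kset_sum: "(\<And>i. i \<in> A \<Longrightarrow> f i \<in> Kset rc) \<Longrightarrow> sum f A \<in> Kset rc"
  by (auto simp: Kset_def)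

text \<open>Gaussian elimination by induction on the number of equations. Keeping the solution
  inside \<open>Kset rc\<close> lets all later dimension counts serve both scalar fields at
  once.\<close>

lemma underdetermined:
  fixes c :: "nat \<Rightarrow> 'a \<Rightarrow> complex"
  assumes "finite J" "r < card J" "\<And>e j. e < r \<Longrightarrow> j \<in> J \<Longrightarrow> c e j \<in> Kset rc"
  shows "\<exists>h. (\<forall>j. h j \<in> Kset rc) \<and> (\<forall>j. j \<notin> J \<longrightarrow> h j = 0) \<and> (\<exists>j\<in>J. h j \<noteq> 0)
    \<and> (\<forall>e<r. (\<Sum>j\<in>J. c e j * h j) = 0)"
  using assms
proof (induction r arbitrary: J c)
  case 0
  then obtain j0 where "j0 \<in> J" by (metis card.empty ex_in_conv less_numeral_extra(3))
  thus ?case by (intro exI[of _ "\<lambda>j. if j = j0 then 1 else 0"]) (auto simp: Kset_closed)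
next
  case (Suc r)
  show ?case
  proof (cases "\<forall>j\<in>J. c r j = 0")
    case True
    obtain h where "\<forall>j. h j \<in> Kset rc" "\<forall>j. j \<notin> J \<longrightarrow> h j = 0" "\<exists>j\<in>J. h j \<noteq> 0"
      "\<forall>e<r. (\<Sum>j\<in>J. c e j * h j) = 0"
      using Suc.IH[of J c] Suc.prems by auto
    thus ?thesis using True by (intro exI[of _ h]) (auto simp: less_Suc_eq)
  next
    case False
    then obtain p where p: "p \<in> J" "c r p \<noteq> 0" by auto
    \<comment> \<open>Equation \<open>e\<close> after the unknown at the pivot \<open>p\<close> has
      been eliminated by means of equation \<open>r\<close>.\<close>
    define d where "d e j = c e j - c e p * c r j / c r p" for e j
    have "r < card (J - {p})" using Suc.prems p by simp
    moreover have "d e j \<in> Kset rc" if "e < r" "j \<in> J - {p}" for e j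
      unfolding d_def using that p Suc.prems(3) by (intro Kset_closed) auto
    ultimately obtain h where h: "\<forall>j. h j \<in> Kset rc" "\<forall>j. j \<notin> J - {p} \<longrightarrow> h j = 0"
      "\<exists>j\<in>J - {p}. h j \<noteq> 0" "\<forall>e<r. (\<Sum>j\<in>J - {p}. d e j * h j) = 0"
      using Suc.IH[of "J - {p}" d] Suc.prems(1) by auto
    define s where "s = (\<Sum>j\<in>J - {p}. c r j * h j)"
    define g where "g = h(p := - s / c r p)"
    have s: "s \<in> Kset rc" unfolding s_def using h(1) Suc.prems(3) by (intro Kset_sum Kset_closed) auto
    have split: "(\<Sum>j\<in>J. c e j * g j) = c e p * (- s / c r p) + (\<Sum>j\<in>J - {p}. c e j * h j)" for e
      using p Suc.prems(1) by (subst sum.remove[of J p]) (auto simp: g_def intro!: sum.cong)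
    have "(\<Sum>j\<in>J. c e j * g j) = 0" if "e < Suc r" for e
    proof (cases "e = r")
      case True
      thus ?thesis using p split[of r] by (simp add: s_def)
    next
      case False
      hence "(\<Sum>j\<in>J - {p}. d e j * h j) = 0" using that h by auto
      hence "(\<Sum>j\<in>J - {p}. c e j * h j) = c e p * s / c r p"
        by (simp add: d_def s_def algebra_simps sum_subtractf sum_distrib_left sum_divide_distrib)
      thus ?thesis using split[of e] by simp
    qed
    moreover have "g j \<in> Kset rc" for j
      using h(1) s p Suc.prems(3) by (auto simp: g_def intro!: Kset_closed)
    ultimately show ?thesis using h p by (intro exI[of _ g]) (auto simp: g_def)
  qed
qed

section \<open>Subspaces represented by orthonormal frames\<close>

definition frames :: "bool \<Rightarrow> 'a set \<Rightarrow> nat \<Rightarrow> (nat \<Rightarrow> 'a \<Rightarrow> complex) set" where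
  "frames rc S d = {u. (\<forall>a<d. \<forall>i. u a i \<in> Kset rc \<and> (i \<notin> S \<longrightarrow> u a i = 0))
     \<and> (\<forall>a<d. \<forall>b<d. cip S (u a) (u b) = (if a = b then 1 else 0))}"

definition comb :: "nat \<Rightarrow> (nat \<Rightarrow> 'a \<Rightarrow> complex) \<Rightarrow> (nat \<Rightarrow> complex) \<Rightarrow> 'a \<Rightarrow> complex" where
  "comb d u h = (\<lambda>i. \<Sum>a<d. h a * u a i)"

lemma cip_frame_comb:
  assumes "u \<in> frames rc S d" "a < d"
  shows "cip S (u a) (comb d u h) = h a"
proof -
  have "cip S (u a) (comb d u h) = (\<Sum>b<d. h b * (if a = b then 1 else 0))"
    unfolding comb_def cip_sum_right using assms by (intro sum.cong) (auto simp: frames_def)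
  also have "\<dots> = h a" using assms(2) by (simp add: if_distrib[of "(*) _"] cong: if_cong)
  finally show ?thesis .
qed

lemma cip_comb_comb:
  assumes "u \<in> frames rc S d"
  shows "cip S (comb d u g) (comb d u h) = cip {..<d} g h"
  unfolding comb_def[of d u g] cip_sum_left cip_def[of "{..<d}"]
  by (intro sum.cong) (use cip_frame_comb[OF assms] in auto)

lemma cnm_comb:
  assumes "u \<in> frames rc S d"
  shows "cnm S (comb d u h) = cnm {..<d} h"
proof -
  have "complex_of_real ((cnm S (comb d u h))\<^sup>2) = complex_of_real ((cnm {..<d} h)\<^sup>2)"
    using cip_comb_comb[OF assms, of h h] by (simp only: cip_self)
  thus ?thesis by (metis cnm_nonneg of_real_eq_iff power2_eq_iff_nonneg)
qed

text \<open>A dimension count in place of Gram-Schmidt: the next vector solves the \<open>r\<close>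
  prescribed equations together with \<open>d\<close> orthogonality equations to the vectors already
  found, and \<open>Suc d + r \<le> N\<close> leaves an unknown to spare. Working with coefficients
  \<open>g\<close> keeps the result in the span of \<open>v\<close>.\<close>

lemma orthonormal_frame_in_span:
  fixes v :: "nat \<Rightarrow> 'a \<Rightarrow> complex"
  assumes fin: "finite S"
    and v: "\<And>a i. a < N \<Longrightarrow> v a i \<in> Kset rc" "\<And>a i. a < N \<Longrightarrow> i \<notin> S \<Longrightarrow> v a i = 0"
    and indep: "\<And>h. (\<forall>a. h a \<in> Kset rc) \<Longrightarrow> (\<exists>a<N. h a \<noteq> 0) \<Longrightarrow> \<exists>i\<in>S. comb N v h i \<noteq> 0"
    and c: "\<And>e a. e < r \<Longrightarrow> a < N \<Longrightarrow> c e a \<in> Kset rc"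
    and d: "d + r \<le> N"
  shows "\<exists>g. (\<forall>b<d. \<forall>a. g b a \<in> Kset rc) \<and> (\<forall>b<d. \<forall>e<r. (\<Sum>a<N. c e a * g b a) = 0)
     \<and> (\<lambda>b. comb N v (g b)) \<in> frames rc S d"
  using d
proof (induction d)
  case 0
  show ?case by (auto simp: frames_def)
next
  case (Suc d)
  then obtain g where g: "\<forall>b<d. \<forall>a. g b a \<in> Kset rc"
    "\<forall>b<d. \<forall>e<r. (\<Sum>a<N. c e a * g b a) = 0" "(\<lambda>b. comb N v (g b)) \<in> frames rc S d"
    by auto
  have combK: "comb N v h i \<in> Kset rc" if "\<forall>a. h a \<in> Kset rc" for h i
    unfolding comb_def using that v by (auto intro!: Kset_sum Kset_closed)
  define c' where "c' e a = (if e < r then c e a else cip S (comb N v (g (e - r))) (v a))" for e a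
  have "\<exists>h. (\<forall>j. h j \<in> Kset rc) \<and> (\<forall>j. j \<notin> {..<N} \<longrightarrow> h j = 0) \<and> (\<exists>j\<in>{..<N}. h j \<noteq> 0)
    \<and> (\<forall>e<r + d. (\<Sum>j\<in>{..<N}. c' e j * h j) = 0)"
  proof (rule underdetermined)
    show "c' e j \<in> Kset rc" if "e < r + d" "j \<in> {..<N}" for e j
      using that c g(1) v combK unfolding c'_def cip_def
      by (auto intro!: Kset_sum Kset_closed)
  qed (use Suc.prems in auto)
  then obtain h where h: "\<forall>j. h j \<in> Kset rc" "\<exists>j<N. h j \<noteq> 0"
    "\<forall>e<r + d. (\<Sum>j<N. c' e j * h j) = 0" by auto
  have hc: "(\<Sum>a<N. c e a * h a) = 0" if "e < r" for e
    using h(3)[rule_format, of e] that by (simp add: c'_def)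
  have ho: "cip S (comb N v (g b)) (comb N v h) = 0" if "b < d" for b
    using h(3)[rule_format, of "r + b"] that
    unfolding comb_def[of N v h] cip_sum_right by (simp add: c'_def mult.commute)
  define s where "s = cnm S (comb N v h)"
  have s: "0 < s"
    using indep[OF h(1) h(2)] cnm_eq_0_iff[OF fin, of "comb N v h"]
    unfolding s_def by (metis cnm_nonneg less_eq_real_def)
  define f where "f a = complex_of_real (1 / s) * h a" for a
  have f_comb: "comb N v f = (\<lambda>i. complex_of_real (1 / s) * comb N v h i)"
    by (simp add: f_def comb_def sum_distrib_left mult.assoc)
  have fK: "\<forall>a. f a \<in> Kset rc" using h(1) by (auto simp: f_def intro!: Kset_closed simp del: of_real_divide)
  have fself: "cip S (comb N v f) (comb N v f) = 1"
    unfolding cip_self f_comb cnm_scale s_def[symmetric] using s by (simp add: norm_divide)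
  have fo: "cip S (comb N v (g b)) (comb N v f) = 0" if "b < d" for b
    unfolding f_comb cip_scale_right using ho[OF that] by simp
  have fo': "cip S (comb N v f) (comb N v (g b)) = 0" if "b < d" for b
    using fo[OF that] cip_cnj by (metis complex_cnj_zero)
  have fc: "(\<Sum>a<N. c e a * f a) = 0" if "e < r" for e
  proof -
    have "(\<Sum>a<N. c e a * f a) = complex_of_real (1 / s) * (\<Sum>a<N. c e a * h a)"
      by (simp add: f_def sum_distrib_left mult_ac)
    thus ?thesis using hc[OF that] by simp
  qed
  define g' where "g' b = (if b = d then f else g b)" for b
  have supp: "comb N v w i = 0" if "i \<notin> S" for w i
    using v(2) that by (simp add: comb_def)
  have "(\<lambda>b. comb N v (g' b)) \<in> frames rc S (Suc d)"
    using g(3) fo fo' fself combK[OF fK] supp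
    by (auto simp: frames_def g'_def less_Suc_eq)
  moreover have "\<forall>b<Suc d. \<forall>a. g' b a \<in> Kset rc" using g(1) fK by (auto simp: g'_def less_Suc_eq)
  moreover have "\<forall>b<Suc d. \<forall>e<r. (\<Sum>a<N. c e a * g' b a) = 0"
    using g(2) fc by (auto simp: g'_def less_Suc_eq)
  ultimately show ?case by blast
qed

section \<open>Moore--Penrose inverses of Gram matrices\<close>

abbreviation rip :: "'a set \<Rightarrow> ('a \<Rightarrow> complex) \<Rightarrow> ('a \<Rightarrow> complex) \<Rightarrow> real" where
  "rip I x y \<equiv> Re (cip I x y)"

lemma rip_commute: "rip I x y = rip I y x"
  by (metis cip_cnj cnj.sel(1))

lemma rip_diff_right: "rip I z (\<lambda>p. x p - y p) = rip I z x - rip I z y"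
  by (simp add: cip_diff_right)

lemma rip_sum_right: "rip I z (\<lambda>p. \<Sum>j\<in>J. complex_of_real (c j) * x j p) = (\<Sum>j\<in>J. c j * rip I z (x j))"
  by (simp add: cip_sum_right)

lemma rip_sum_left: "rip I (\<lambda>p. \<Sum>j\<in>J. complex_of_real (c j) * x j p) z = (\<Sum>j\<in>J. c j * rip I (x j) z)"
  by (simp add: cip_sum_left)

lemma rip_self: "rip I x x = (cnm I x)\<^sup>2"
  by (simp add: cip_self flip: of_real_power)

text \<open>Real coefficients are essential: the constraint matrices are combined with real
  multipliers only, also over the complex field. Linearly dependent families are covered.\<close>

lemma orthogonal_projection:
  fixes a :: "nat \<Rightarrow> 'a \<Rightarrow> complex"
  shows "\<exists>c :: nat \<Rightarrow> real. \<forall>i<m. rip I (a i) (\<lambda>p. z p - (\<Sum>j<m. complex_of_real (c j) * a j p)) = 0"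
proof (induction m arbitrary: z)
  case (Suc m)
  from Suc.IH[of z] obtain c where c: "\<forall>i<m. rip I (a i) (\<lambda>p. z p - (\<Sum>j<m. complex_of_real (c j) * a j p)) = 0" ..
  from Suc.IH[of "a m"] obtain d where d: "\<forall>i<m. rip I (a i) (\<lambda>p. a m p - (\<Sum>j<m. complex_of_real (d j) * a j p)) = 0" ..
  define w where "w p = z p - (\<Sum>j<m. complex_of_real (c j) * a j p)" for p
  define r where "r p = a m p - (\<Sum>j<m. complex_of_real (d j) * a j p)" for p
  \<comment> \<open>If \<open>a m\<close> is dependent on its predecessors, \<open>r\<close> has
    norm zero and \<open>\<tau>\<close> is a quotient by zero, hence 0; Cauchy-Schwarz then makes
    \<open>rip I r w\<close> vanish, so the correction is still exact.\<close>
  define \<tau> where "\<tau> = rip I r w / rip I r r"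
  define c' where "c' j = (if j = m then \<tau> else c j - \<tau> * d j)" for j
  have aw: "rip I (a i) w = 0" and ar: "rip I (a i) r = 0" if "i < m" for i
    using c d that by (auto simp: w_def[abs_def] r_def[abs_def])
  have am: "rip I (a m) y = rip I r y + (\<Sum>j<m. d j * rip I (a j) y)" for y
  proof -
    have "rip I r y = rip I (a m) y - rip I (\<lambda>p. \<Sum>j<m. complex_of_real (d j) * a j p) y"
      unfolding r_def[abs_def] by (simp add: cip_diff_left)
    thus ?thesis by (simp add: rip_sum_left)
  qed
  have \<tau>: "rip I r w - \<tau> * rip I r r = 0"
  proof (cases "rip I r r = 0")
    case True
    hence "cnm I r = 0" by (simp add: rip_self)
    hence "cip I r w = 0" using cip_Cauchy_Schwarz[of I r w] by simp
    thus ?thesis using True by simp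
  qed (simp add: \<tau>_def)
  have eq: "z p - (\<Sum>j<Suc m. complex_of_real (c' j) * a j p) = w p - complex_of_real \<tau> * r p" for p
    by (simp add: c'_def w_def r_def algebra_simps sum_subtractf sum_distrib_left)
  have res: "rip I x (\<lambda>p. w p - complex_of_real \<tau> * r p) = rip I x w - \<tau> * rip I x r" for x
    by (simp add: cip_diff_right cip_scale_right)
  have "rip I (a i) (\<lambda>p. z p - (\<Sum>j<Suc m. complex_of_real (c' j) * a j p)) = 0" if "i < Suc m" for i
    unfolding eq res
  proof (cases "i = m")
    case True
    thus "rip I (a i) w - \<tau> * rip I (a i) r = 0" using \<tau> aw ar by (simp add: am)
  next
    case False
    thus "rip I (a i) w - \<tau> * rip I (a i) r = 0" using that aw[of i] ar[of i] by simp
  qed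
  thus ?case by blast
qed simp

text \<open>Vanishing outside the index box turns entrywise equality of matrices into equality of
  functions, so that matrix identities can be used as rewrite rules.\<close>

definition boxed :: "nat \<Rightarrow> (nat \<Rightarrow> nat \<Rightarrow> real) \<Rightarrow> bool" where
  "boxed m A \<longleftrightarrow> (\<forall>i j. \<not> (i < m \<and> j < m) \<longrightarrow> A i j = 0)"

definition rtr :: "(nat \<Rightarrow> nat \<Rightarrow> real) \<Rightarrow> nat \<Rightarrow> nat \<Rightarrow> real" where
  "rtr A = (\<lambda>i j. A j i)"

lemma rmmult_assoc: "rmmult m (rmmult m A B) C = rmmult m A (rmmult m B C)"
  unfolding rmmult_def
  by (simp add: sum_distrib_left sum_distrib_right mult.assoc) (rule ext, rule ext, rule sum.swap)

lemma rtr_rmmult: "rtr (rmmult m A B) = rmmult m (rtr B) (rtr A)"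
  by (simp add: rtr_def rmmult_def mult.commute)

lemma rtr_rtr [simp]: "rtr (rtr A) = A"
  by (simp add: rtr_def)

lemma boxed_rmmult: "boxed m A \<Longrightarrow> boxed m B \<Longrightarrow> boxed m (rmmult m A B)"
  by (auto simp: boxed_def rmmult_def)

lemma boxed_rtr: "boxed m A \<Longrightarrow> boxed m (rtr A)"
  by (auto simp: boxed_def rtr_def)

lemma boxed_eqI: "boxed m A \<Longrightarrow> boxed m B \<Longrightarrow> (\<And>i j. i < m \<Longrightarrow> j < m \<Longrightarrow> A i j = B i j) \<Longrightarrow> A = B"
  unfolding boxed_def by (intro ext) metis

text \<open>The entrywise conditions in \<open>pinv\<close> as equations between functions; the two
  versions agree for a boxed \<open>G\<close>.\<close>

definition penrose :: "nat \<Rightarrow> (nat \<Rightarrow> nat \<Rightarrow> real) \<Rightarrow> (nat \<Rightarrow> nat \<Rightarrow> real) \<Rightarrow> bool" where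
  "penrose m G X \<longleftrightarrow> boxed m X \<and> rmmult m (rmmult m G X) G = G \<and> rmmult m (rmmult m X G) X = X
     \<and> rtr (rmmult m G X) = rmmult m G X \<and> rtr (rmmult m X G) = rmmult m X G"

text \<open>\<open>rmmult m G X\<close> and \<open>rmmult m G Z\<close> are symmetric idempotents
  with the same range, that of \<open>G\<close>, hence equal; likewise for the products in the other
  order. Then \<open>X = X G X = Z G X = Z G Z = Z\<close>.\<close>

lemma penrose_unique:
  assumes X: "penrose m G X" and Z: "penrose m G Z"
  shows "X = Z"
proof -
  note assoc = rmmult_assoc
  have GX: "rmmult m G X = rmmult m G Z"
  proof -
    have "rmmult m G X = rmmult m (rmmult m G Z) (rmmult m G X)"
      using Z by (metis penrose_def assoc)
    hence "rtr (rmmult m G X) = rmmult m (rtr (rmmult m G X)) (rtr (rmmult m G Z))"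
      by (metis rtr_rmmult)
    hence "rmmult m G X = rmmult m (rmmult m G X) (rmmult m G Z)" using X Z by (simp add: penrose_def)
    also have "\<dots> = rmmult m G Z" using X by (metis penrose_def assoc)
    finally show ?thesis .
  qed
  have XG: "rmmult m X G = rmmult m Z G"
  proof -
    have "rmmult m X G = rmmult m (rmmult m X G) (rmmult m Z G)"
      using Z by (metis penrose_def assoc)
    hence "rtr (rmmult m X G) = rmmult m (rtr (rmmult m Z G)) (rtr (rmmult m X G))"
      by (metis rtr_rmmult)
    hence "rmmult m X G = rmmult m (rmmult m Z G) (rmmult m X G)" using X Z by (simp add: penrose_def)
    also have "\<dots> = rmmult m Z G" using X by (metis penrose_def assoc)
    finally show ?thesis .
  qed
  show ?thesis using X Z GX XG by (metis penrose_def assoc)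
qed

text \<open>The columns of \<open>X0\<close> are least squares solutions for the unit vectors, so
  \<open>P = G X0\<close> is the orthogonal projection onto the range of \<open>G\<close>. Since
  \<open>X0\<close> is determined only up to the kernel of \<open>G\<close>, the pseudo-inverse is
  taken to be the transpose of \<open>X0\<close> times \<open>G X0\<close>.\<close>

lemma penrose_exists:
  assumes G: "boxed m G" "rtr G = G"
  shows "\<exists>X. penrose m G X"
proof -
  note assoc = rmmult_assoc
  have "\<exists>c :: nat \<Rightarrow> real. \<forall>i<m. (\<Sum>b<m. c b * (\<Sum>p<m. G p i * G p b)) = G j i" if j: "j < m" for j
  proof -
    define g where "g b p = complex_of_real (G p b)" for b p
    define e where "e p = (if p = j then 1 else 0 :: complex)" for p
    obtain c :: "nat \<Rightarrow> real" where c: "\<forall>i<m. rip {..<m} (g i) (\<lambda>p. e p - (\<Sum>b<m. complex_of_real (c b) * g b p)) = 0"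
      using orthogonal_projection[of m "{..<m}" g e] by blast
    have gg: "rip {..<m} (g i) (g b) = (\<Sum>p<m. G p i * G p b)" for i b
      by (simp add: cip_def g_def)
    have ge: "rip {..<m} (g i) e = G j i" for i
      using j by (simp add: cip_def g_def e_def if_distrib[of "(*) _"] cong: if_cong)
    show ?thesis
      using c by (intro exI[of _ c]) (simp add: rip_diff_right rip_sum_right gg ge)
  qed
  then obtain c :: "nat \<Rightarrow> nat \<Rightarrow> real"
    where c: "\<And>i j. i < m \<Longrightarrow> j < m \<Longrightarrow> (\<Sum>b<m. c j b * (\<Sum>p<m. G p i * G p b)) = G j i"
    by metis
  define X0 where "X0 = (\<lambda>b j. if b < m \<and> j < m then c j b else 0)"
  have bX0: "boxed m X0" by (simp add: boxed_def X0_def)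
  have sym: "G i j = G j i" for i j using fun_cong[OF fun_cong[OF G(2)], of j i] by (simp add: rtr_def)
  have GGX0: "rmmult m G (rmmult m G X0) = G"
  proof (rule boxed_eqI[where m = m])
    fix i j assume ij: "i < m" "j < m"
    have "rmmult m G (rmmult m G X0) i j = (\<Sum>p<m. \<Sum>b<m. G i p * (G p b * c j b))"
      unfolding rmmult_def X0_def using ij by (simp add: sum_distrib_left)
    also have "\<dots> = (\<Sum>b<m. c j b * (\<Sum>p<m. G p i * G p b))"
      by (subst sum.swap) (simp add: sum_distrib_left sym[of i] mult_ac)
    also have "\<dots> = G i j" using c[OF ij] sym by simp
    finally show "rmmult m G (rmmult m G X0) i j = G i j" .
  qed (use G bX0 in \<open>auto intro: boxed_rmmult\<close>)
  define P where "P = rmmult m G X0"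
  define T where "T = rtr X0"
  define X where "X = rmmult m T P"
  have GP: "rmmult m G P = G" using GGX0 by (simp add: P_def)
  have tP: "rtr P = rmmult m T G" by (simp add: P_def T_def rtr_rmmult G(2))
  \<comment> \<open>The left side is symmetric, so this identity forces \<open>P\<close> to be
    symmetric and idempotent.\<close>
  have "rmmult m (rtr P) P = rtr P" unfolding tP by (simp add: assoc GP)
  hence "rtr (rmmult m (rtr P) P) = rtr (rtr P)" by simp
  hence "rmmult m (rtr P) P = P" by (simp add: rtr_rmmult)
  hence Psym: "rtr P = P" and PP: "rmmult m P P = P" using \<open>rmmult m (rtr P) P = rtr P\<close> by simp_all
  have TG: "rmmult m T G = P" using tP Psym by simp
  have PG: "rmmult m P G = G"
    using arg_cong[OF GP, of rtr] by (simp add: rtr_rmmult Psym G(2))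
  have X': "X = rmmult m P X0" 
  proof -
    have "X = rmmult m T (rmmult m G X0)" by (simp add: X_def P_def)
    also have "\<dots> = rmmult m P X0" unfolding assoc[symmetric] TG ..
    finally show ?thesis .
  qed
  have GX: "rmmult m G X = P" unfolding X' assoc[symmetric] GP by (simp add: P_def)
  have Xsym: "rtr X = X"
    unfolding X' rtr_rmmult Psym by (simp add: T_def[symmetric] X_def[symmetric] X'[symmetric])
  have XG: "rmmult m X G = P"
    using arg_cong[OF GX, of rtr] by (simp add: rtr_rmmult Psym Xsym G(2))
  have PX: "rmmult m P X = X" unfolding X' assoc[symmetric] PP ..
  have "boxed m X" unfolding X_def T_def P_def using G bX0 by (intro boxed_rmmult boxed_rtr)
  thus ?thesis unfolding penrose_def using GX XG PX PG Psym by (intro exI[of _ X]) simp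
qed

lemma pinv_penrose:
  assumes G: "boxed m G" "rtr G = G"
  shows "penrose m G (pinv m G)"
proof -
  have eq: "((\<forall>i j. \<not> (i < m \<and> j < m) \<longrightarrow> X i j = 0) \<and>
      (\<forall>i<m. \<forall>j<m. rmmult m (rmmult m G X) G i j = G i j) \<and>
      (\<forall>i<m. \<forall>j<m. rmmult m (rmmult m X G) X i j = X i j) \<and>
      (\<forall>i<m. \<forall>j<m. rmmult m G X j i = rmmult m G X i j) \<and>
      (\<forall>i<m. \<forall>j<m. rmmult m X G j i = rmmult m X G i j)) \<longleftrightarrow> penrose m G X" (is "?L \<longleftrightarrow> _") for X
  proof
    assume L: ?L
    hence b: "boxed m X" by (simp add: boxed_def)
    note bs = boxed_rmmult boxed_rtr b G(1)
    show "penrose m G X" unfolding penrose_def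
    proof (intro conjI b)
      show "rmmult m (rmmult m G X) G = G" by (rule boxed_eqI[where m = m]) (use L in \<open>auto intro!: bs\<close>)
      show "rmmult m (rmmult m X G) X = X" by (rule boxed_eqI[where m = m]) (use L in \<open>auto intro!: bs\<close>)
      show "rtr (rmmult m G X) = rmmult m G X"
        by (rule boxed_eqI[where m = m], intro bs, intro bs) (use L in \<open>simp add: rtr_def\<close>)
      show "rtr (rmmult m X G) = rmmult m X G"
        by (rule boxed_eqI[where m = m], intro bs, intro bs) (use L in \<open>simp add: rtr_def\<close>)
    qed
  next
    assume P: "penrose m G X"
    have "rtr (rmmult m G X) i j = rmmult m G X i j" "rtr (rmmult m X G) i j = rmmult m X G i j" for i j
      using P by (simp_all add: penrose_def)
    hence r: "rmmult m G X j i = rmmult m G X i j" "rmmult m X G j i = rmmult m X G i j" for i j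
      by (simp_all add: rtr_def)
    have "boxed m X" "rmmult m (rmmult m G X) G = G" "rmmult m (rmmult m X G) X = X"
      using P by (simp_all add: penrose_def)
    thus ?L unfolding boxed_def by (intro conjI allI impI r) simp_all
  qed
  have "pinv m G = (THE X. penrose m G X)" unfolding pinv_def eq ..
  moreover have "\<exists>!X. penrose m G X" using penrose_exists[OF G] penrose_unique by blast
  ultimately show ?thesis by (simp add: theI'[of "penrose m G"])
qed

text \<open>The inner products of the \<open>a i\<close> with \<open>z\<close> depend only on the
  projection of \<open>z\<close> onto their span, so they form a vector in the range of
  \<open>G\<close>, where \<open>G\<close> times its pseudo-inverse acts as the identity. This
  covers dependent \<open>a i\<close>, the constant rank case of the manifold assumption.\<close>

lemma gram_pinv_range:
  fixes a :: "nat \<Rightarrow> 'a \<Rightarrow> complex" and m :: nat and I :: "'a set"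
  defines "G \<equiv> \<lambda>i j. if i < m \<and> j < m then rip I (a i) (a j) else 0"
  assumes "i < m"
  shows "(\<Sum>j<m. rip I (a i) (a j) * (\<Sum>l<m. pinv m G j l * rip I (a l) z)) = rip I (a i) z"
proof -
  have bG: "boxed m G" by (simp add: boxed_def G_def)
  have sG: "rtr G = G" unfolding rtr_def G_def by (rule ext, rule ext, rule if_cong[OF _ rip_commute]) auto
  have GXG: "rmmult m (rmmult m G (pinv m G)) G = G"
    using pinv_penrose[OF bG sG] by (simp add: penrose_def)
  obtain c :: "nat \<Rightarrow> real" where c: "\<forall>i<m. rip I (a i) (\<lambda>p. z p - (\<Sum>j<m. complex_of_real (c j) * a j p)) = 0"
    using orthogonal_projection by blast
  have v: "rip I (a l) z = (\<Sum>q<m. G l q * c q)" if "l < m" for l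
    using c that by (simp add: rip_diff_right rip_sum_right G_def mult.commute)
  have "(\<Sum>j<m. rip I (a i) (a j) * (\<Sum>l<m. pinv m G j l * rip I (a l) z))
      = (\<Sum>j<m. G i j * (\<Sum>l<m. pinv m G j l * (\<Sum>q<m. G l q * c q)))"
    using assms(2) v by (intro sum.cong refl) (simp add: G_def)
  also have "\<dots> = (\<Sum>j<m. \<Sum>l<m. \<Sum>q<m. G i j * pinv m G j l * G l q * c q)"
    by (simp add: sum_distrib_left mult.assoc)
  also have "\<dots> = (\<Sum>j<m. \<Sum>q<m. \<Sum>l<m. G i j * pinv m G j l * G l q * c q)"
    by (rule sum.cong[OF refl], rule sum.swap)
  also have "\<dots> = (\<Sum>q<m. \<Sum>j<m. \<Sum>l<m. G i j * pinv m G j l * G l q * c q)"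
    by (rule sum.swap)
  also have "\<dots> = (\<Sum>q<m. \<Sum>l<m. \<Sum>j<m. G i j * pinv m G j l * G l q * c q)"
    by (rule sum.cong[OF refl], rule sum.swap)
  also have "\<dots> = (\<Sum>q<m. rmmult m (rmmult m G (pinv m G)) G i q * c q)"
    by (simp add: rmmult_def sum_distrib_right)
  also have "\<dots> = rip I (a i) z" unfolding GXG by (rule v[OF assms(2), symmetric])
  finally show ?thesis .
qed

section \<open>Gaussian vectors\<close>

abbreviation gauss :: "'i set \<Rightarrow> ('i \<Rightarrow> real) measure" where
  "gauss I \<equiv> PiM I (\<lambda>_. std_normal_distribution)"

lemma prob_space_std_normal: "prob_space std_normal_distribution"
  by (rule prob_space_normal_density) simp

lemma prob_space_gauss: "prob_space (gauss I)"
  by (rule prob_space_PiM) (rule prob_space_std_normal)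

interpretation std_normal: product_sigma_finite "\<lambda>_. std_normal_distribution"
  using prob_space_std_normal
  by (simp add: product_sigma_finite_def prob_space_imp_sigma_finite)

lemma nn_integral_normal_density:
  assumes "0 < \<sigma>"
  shows "(\<integral>\<^sup>+ x. ennreal (normal_density \<mu> \<sigma> x) \<partial>lborel) = 1"
  using prob_space.emeasure_space_1[OF prob_space_normal_density[OF assms, of \<mu>]]
  by (simp add: emeasure_density)

lemma nn_integral_exp_linear_std_normal:
  "(\<integral>\<^sup>+ x. ennreal (exp (a * x)) \<partial>std_normal_distribution) = ennreal (exp (a\<^sup>2 / 2))"
proof -
  have eq: "std_normal_density x * exp (a * x) = exp (a\<^sup>2 / 2) * normal_density a 1 x" for x
  proof -
    have "- x\<^sup>2 / 2 + a * x = a\<^sup>2 / 2 + - (x - a)\<^sup>2 / 2"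
      by (simp add: power2_eq_square field_simps)
    hence "exp (- x\<^sup>2 / 2) * exp (a * x) = exp (a\<^sup>2 / 2) * exp (- (x - a)\<^sup>2 / 2)"
      by (simp only: exp_add[symmetric])
    thus ?thesis by (simp add: normal_density_def)
  qed
  have "(\<integral>\<^sup>+ x. ennreal (exp (a * x)) \<partial>std_normal_distribution)
      = (\<integral>\<^sup>+ x. ennreal (std_normal_density x) * ennreal (exp (a * x)) \<partial>lborel)"
    by (subst nn_integral_density) auto
  also have "\<dots> = (\<integral>\<^sup>+ x. ennreal (exp (a\<^sup>2 / 2)) * ennreal (normal_density a 1 x) \<partial>lborel)"
    by (intro nn_integral_cong) (simp add: eq ennreal_mult[symmetric])
  also have "\<dots> = ennreal (exp (a\<^sup>2 / 2))"
    by (subst nn_integral_cmult) (auto simp: nn_integral_normal_density)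
  finally show ?thesis .
qed

lemma nn_integral_exp_square_std_normal:
  assumes "0 \<le> l"
  shows "(\<integral>\<^sup>+ x. ennreal (exp (- (l * x\<^sup>2 / 2))) \<partial>std_normal_distribution)
    = ennreal (1 / sqrt (1 + l))"
proof -
  define s where "s = 1 / sqrt (1 + l)"
  have s: "0 < s" "s\<^sup>2 = 1 / (1 + l)" using assms by (auto simp: s_def power_divide)
  have eq: "std_normal_density x * exp (- (l * x\<^sup>2 / 2)) = s * normal_density 0 s x" for x
  proof -
    have "- x\<^sup>2 / 2 + - (l * x\<^sup>2 / 2) = - x\<^sup>2 / (2 * s\<^sup>2)"
      using assms by (simp add: s(2) field_simps)
    hence "exp (- x\<^sup>2 / 2) * exp (- (l * x\<^sup>2 / 2)) = exp (- x\<^sup>2 / (2 * s\<^sup>2))"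
      by (simp only: exp_add[symmetric])
    moreover have "sqrt (2 * pi * s\<^sup>2) = sqrt (2 * pi) * s"
      using s(1) by (simp add: real_sqrt_mult)
    ultimately show ?thesis using s(1) by (simp add: normal_density_def)
  qed
  have "(\<integral>\<^sup>+ x. ennreal (exp (- (l * x\<^sup>2 / 2))) \<partial>std_normal_distribution)
      = (\<integral>\<^sup>+ x. ennreal (std_normal_density x) * ennreal (exp (- (l * x\<^sup>2 / 2))) \<partial>lborel)"
    by (subst nn_integral_density) auto
  also have "\<dots> = (\<integral>\<^sup>+ x. ennreal s * ennreal (normal_density 0 s x) \<partial>lborel)"
    using s(1) by (intro nn_integral_cong) (simp add: eq ennreal_mult[symmetric])
  also have "\<dots> = ennreal s"
    using s(1) by (subst nn_integral_cmult) (auto simp: nn_integral_normal_density)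
  finally show ?thesis by (simp add: s_def)
qed

lemma gauss_linear_tail:
  assumes fin: "finite I" and v: "(\<Sum>c\<in>I. (a c)\<^sup>2) \<le> v" "0 < v" and u: "0 \<le> u"
  shows "measure (gauss I) {\<omega> \<in> space (gauss I). u < (\<Sum>c\<in>I. a c * \<omega> c)} \<le> exp (- (u\<^sup>2 / (2 * v)))"
proof -
  interpret P: prob_space "gauss I" by (rule prob_space_gauss)
  \<comment> \<open>The minimiser of the Chernoff exponent
    \<open>\<theta>\<^sup>2 * v / 2 - \<theta> * u\<close>.\<close>
  define \<theta> where "\<theta> = u / v"
  have \<theta>: "0 \<le> \<theta>" using u v by (simp add: \<theta>_def)
  have [measurable]: "(\<lambda>\<omega>. \<Sum>c\<in>I. a c * \<omega> c) \<in> borel_measurable (gauss I)"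
    by (intro borel_measurable_sum borel_measurable_times) auto
  have "(\<integral>\<^sup>+ \<omega>. ennreal (exp (\<theta> * (\<Sum>c\<in>I. a c * \<omega> c))) \<partial>gauss I)
      = (\<integral>\<^sup>+ \<omega>. (\<Prod>c\<in>I. ennreal (exp ((\<theta> * a c) * \<omega> c))) \<partial>gauss I)"
    using fin by (intro nn_integral_cong) (simp add: prod_ennreal exp_sum sum_distrib_left mult.assoc)
  also have "\<dots> = (\<Prod>c\<in>I. ennreal (exp ((\<theta> * a c)\<^sup>2 / 2)))"
    using fin by (subst std_normal.product_nn_integral_prod) (auto simp: nn_integral_exp_linear_std_normal)
  also have "\<dots> = ennreal (exp (\<theta>\<^sup>2 / 2 * (\<Sum>c\<in>I. (a c)\<^sup>2)))"
    using fin by (simp add: prod_ennreal exp_sum sum_distrib_left power_mult_distrib)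
  also have "\<dots> \<le> ennreal (exp (\<theta>\<^sup>2 / 2 * v))"
    using v by (intro ennreal_leI) (simp add: mult_left_mono)
  finally have E: "(\<integral>\<^sup>+ \<omega>. ennreal (exp (\<theta> * (\<Sum>c\<in>I. a c * \<omega> c))) \<partial>gauss I) \<le> ennreal (exp (\<theta>\<^sup>2 / 2 * v))" .
  have "emeasure (gauss I) {\<omega> \<in> space (gauss I). u < (\<Sum>c\<in>I. a c * \<omega> c)}
      \<le> emeasure (gauss I) {\<omega> \<in> space (gauss I). 1 \<le> ennreal (exp (- \<theta> * u)) * ennreal (exp (\<theta> * (\<Sum>c\<in>I. a c * \<omega> c)))}"
  proof (intro emeasure_mono subsetI)
    fix \<omega> assume "\<omega> \<in> {\<omega> \<in> space (gauss I). u < (\<Sum>c\<in>I. a c * \<omega> c)}"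
    hence w: "\<omega> \<in> space (gauss I)" "u < (\<Sum>c\<in>I. a c * \<omega> c)" by auto
    have "1 \<le> exp (- \<theta> * u + \<theta> * (\<Sum>c\<in>I. a c * \<omega> c))"
      using mult_left_mono[OF less_imp_le[OF w(2)] \<theta>] by (simp only: one_le_exp_iff)
    hence "ennreal 1 \<le> ennreal (exp (- \<theta> * u) * exp (\<theta> * (\<Sum>c\<in>I. a c * \<omega> c)))"
      by (intro ennreal_leI) (simp only: exp_add)
    thus "\<omega> \<in> {\<omega> \<in> space (gauss I). 1 \<le> ennreal (exp (- \<theta> * u)) * ennreal (exp (\<theta> * (\<Sum>c\<in>I. a c * \<omega> c)))}"
      using w(1) by (simp add: ennreal_mult)
  qed auto
  also have "\<dots> \<le> ennreal (exp (- \<theta> * u)) * (\<integral>\<^sup>+ \<omega>. ennreal (exp (\<theta> * (\<Sum>c\<in>I. a c * \<omega> c))) * indicator (space (gauss I)) \<omega> \<partial>gauss I)"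
    by (rule nn_integral_Markov_inequality) auto
  also have "\<dots> \<le> ennreal (exp (- \<theta> * u)) * ennreal (exp (\<theta>\<^sup>2 / 2 * v))"
    by (intro mult_left_mono order_trans[OF _ E] nn_integral_mono) (auto simp: indicator_def)
  also have "\<dots> = ennreal (exp (- \<theta> * u + \<theta>\<^sup>2 / 2 * v))"
    by (simp only: exp_add ennreal_mult'' exp_ge_zero)
  also have "- \<theta> * u + \<theta>\<^sup>2 / 2 * v = - (u\<^sup>2 / (2 * v))"
    using v by (simp add: \<theta>_def power2_eq_square field_simps)
  finally show ?thesis by (simp add: P.emeasure_eq_measure)
qed

section \<open>Small ball probabilities from characteristic functions\<close>

lemma std_normal_integral_iexp:
  "(\<integral>x. iexp (t * x) \<partial>std_normal_distribution) = complex_of_real (exp (- t\<^sup>2 / 2))"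
  using fun_cong[OF char_std_normal_distribution, of t] by (simp add: char_def)

lemma gauss_integral_iexp:
  assumes "finite I"
  shows "(\<integral>\<omega>. iexp (\<Sum>c\<in>I. a c * \<omega> c) \<partial>gauss I) = complex_of_real (exp (- (\<Sum>c\<in>I. (a c)\<^sup>2) / 2))"
proof -
  interpret S: prob_space std_normal_distribution by (rule prob_space_std_normal)
  have "(\<integral>\<omega>. iexp (\<Sum>c\<in>I. a c * \<omega> c) \<partial>gauss I) = (\<integral>\<omega>. (\<Prod>c\<in>I. iexp (a c * \<omega> c)) \<partial>gauss I)"
    using assms by (simp add: exp_sum sum_distrib_left)
  also have "\<dots> = (\<Prod>c\<in>I. \<integral>x. iexp (a c * x) \<partial>std_normal_distribution)"
    using assms
    by (intro std_normal.product_integral_prod)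
       (auto intro!: S.integrable_const_bound[where B=1] simp del: of_real_mult)
  also have "\<dots> = (\<Prod>c\<in>I. complex_of_real (exp (- (a c)\<^sup>2 / 2)))"
    by (simp only: std_normal_integral_iexp)
  also have "\<dots> = complex_of_real (exp (\<Sum>c\<in>I. - (a c)\<^sup>2 / 2))"
    using assms by (simp only: exp_sum of_real_prod)
  also have "(\<Sum>c\<in>I. - (a c)\<^sup>2 / 2) = - (\<Sum>c\<in>I. (a c)\<^sup>2) / 2"
    by (simp add: sum_divide_distrib sum_negf)
  finally show ?thesis .
qed

text \<open>Linearise the quadratic exponent by an auxiliary Gaussian vector \<open>h\<close>,
  \<open>exp (- s\<^sup>2 / 2) = E\<^sub>h exp (\<i> h s)\<close>, and integrate over \<open>y\<close> first.\<close>
lemma gauss_exp_quadratic_bound: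
  fixes \<alpha> :: "nat \<Rightarrow> 'i \<Rightarrow> real" and \<beta> :: "nat \<Rightarrow> real"
  assumes fin: "finite Q" and l: "0 \<le> l" and \<tau>: "0 \<le> \<tau>"
    and low: "\<And>h::nat \<Rightarrow> real. \<tau> * (\<Sum>a<D. (h a)\<^sup>2) \<le> (\<Sum>c\<in>Q. (\<Sum>a<D. h a * \<alpha> a c)\<^sup>2)"
  shows "(\<integral>y. exp (- (l * (\<Sum>a<D. (\<beta> a + (\<Sum>c\<in>Q. \<alpha> a c * y c))\<^sup>2) / 2)) \<partial>gauss Q)
    \<le> (1 / sqrt (1 + l * \<tau>)) ^ D"
proof -
  interpret Y: prob_space "gauss Q" by (rule prob_space_gauss)
  interpret H: prob_space "gauss {..<D}" by (rule prob_space_gauss)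
  interpret YH: pair_prob_space "gauss Q" "gauss {..<D}" ..
  define s where "s y a = \<beta> a + (\<Sum>c\<in>Q. \<alpha> a c * y c)" for y a
  define F where "F y h = iexp (sqrt l * (\<Sum>a<D. s y a * h a))" for y and h :: "nat \<Rightarrow> real"
  have [measurable]: "(\<lambda>p. \<Sum>a<D. s (fst p) a * snd p a) \<in> borel_measurable (gauss Q \<Otimes>\<^sub>M gauss {..<D})"
  proof -
    have 1: "(\<lambda>p. fst p c) \<in> borel_measurable (gauss Q \<Otimes>\<^sub>M gauss {..<D})" if "c \<in> Q" for c
      using that by (intro measurable_compose[OF measurable_fst]) auto
    have 2: "(\<lambda>p. snd p a) \<in> borel_measurable (gauss Q \<Otimes>\<^sub>M gauss {..<D})" if "a \<in> {..<D}" for a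
      using measurable_compose[OF measurable_snd, of "\<lambda>h. h a" "gauss {..<D}" borel "gauss Q"] that
      by auto
    show ?thesis unfolding s_def
      by (intro borel_measurable_sum borel_measurable_times borel_measurable_add borel_measurable_const 1 2) auto
  qed
  have nF: "norm (F y h) = 1" for y h
    unfolding F_def by (simp del: of_real_mult of_real_sum)
  have mF: "(\<lambda>(y, h). F y h) \<in> borel_measurable (gauss Q \<Otimes>\<^sub>M gauss {..<D})"
    unfolding F_def case_prod_beta by measurable
  \<comment> \<open>\<open>F\<close> has modulus one, hence is integrable on the product and the two
    integrations may be interchanged.\<close>
  have intF: "integrable (gauss Q \<Otimes>\<^sub>M gauss {..<D}) (\<lambda>(y, h). F y h)"
    using mF by (intro YH.integrable_const_bound[where B = 1]) (auto simp: nF case_prod_beta)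
  have inner_h: "(\<integral>h. F y h \<partial>gauss {..<D}) = complex_of_real (exp (- (l * (\<Sum>a<D. (s y a)\<^sup>2) / 2)))" for y
  proof -
    have "(\<integral>h. F y h \<partial>gauss {..<D}) = (\<integral>h. iexp (\<Sum>a<D. (sqrt l * s y a) * h a) \<partial>gauss {..<D})"
      unfolding F_def by (simp only: sum_distrib_left mult.assoc)
    also have "\<dots> = complex_of_real (exp (- (\<Sum>a<D. (sqrt l * s y a)\<^sup>2) / 2))"
      by (rule gauss_integral_iexp) simp
    also have "(\<Sum>a<D. (sqrt l * s y a)\<^sup>2) = l * (\<Sum>a<D. (s y a)\<^sup>2)"
      using l by (simp add: power_mult_distrib sum_distrib_left)
    finally show ?thesis by simp
  qed
  \<comment> \<open>The shift \<open>\<beta>\<close> enters only as a phase of modulus one, so the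
    bound is uniform in it; what remains is the characteristic function of a linear form, controlled
    by \<open>low\<close>.\<close>
  have inner_y: "norm (\<integral>y. F y h \<partial>gauss Q) \<le> exp (- (l * \<tau> * (\<Sum>a<D. (h a)\<^sup>2) / 2))" for h
  proof -
    have "sqrt l * (\<Sum>a<D. s y a * h a)
        = sqrt l * (\<Sum>a<D. \<beta> a * h a) + (\<Sum>c\<in>Q. (sqrt l * (\<Sum>a<D. h a * \<alpha> a c)) * y c)" for y
    proof -
      have "(\<Sum>a<D. s y a * h a) = (\<Sum>a<D. \<beta> a * h a) + (\<Sum>a<D. \<Sum>c\<in>Q. \<alpha> a c * y c * h a)"
        by (simp add: s_def distrib_right sum.distrib sum_distrib_right)
      also have "(\<Sum>a<D. \<Sum>c\<in>Q. \<alpha> a c * y c * h a) = (\<Sum>c\<in>Q. (\<Sum>a<D. h a * \<alpha> a c) * y c)"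
        by (subst sum.swap) (simp add: sum_distrib_left sum_distrib_right mult_ac)
      finally show ?thesis
        by (simp only: distrib_left) (simp add: sum_distrib_left[of "sqrt l" _ Q] mult.assoc)
    qed
    hence "(\<integral>y. F y h \<partial>gauss Q) = (\<integral>y. iexp (sqrt l * (\<Sum>a<D. \<beta> a * h a))
        * iexp (\<Sum>c\<in>Q. (sqrt l * (\<Sum>a<D. h a * \<alpha> a c)) * y c) \<partial>gauss Q)"
      unfolding F_def by (simp only: of_real_add distrib_left exp_add)
    also have "\<dots> = iexp (sqrt l * (\<Sum>a<D. \<beta> a * h a))
        * (\<integral>y. iexp (\<Sum>c\<in>Q. (sqrt l * (\<Sum>a<D. h a * \<alpha> a c)) * y c) \<partial>gauss Q)"
      by (rule integral_mult_right_zero)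
    also have "\<dots> = iexp (sqrt l * (\<Sum>a<D. \<beta> a * h a))
        * complex_of_real (exp (- (\<Sum>c\<in>Q. (sqrt l * (\<Sum>a<D. h a * \<alpha> a c))\<^sup>2) / 2))"
      by (simp only: gauss_integral_iexp[OF fin])
    finally have "norm (\<integral>y. F y h \<partial>gauss Q)
        = exp (- (\<Sum>c\<in>Q. (sqrt l * (\<Sum>a<D. h a * \<alpha> a c))\<^sup>2) / 2)"
      by (simp add: norm_mult del: of_real_mult of_real_sum)
    also have "\<dots> \<le> exp (- (l * \<tau> * (\<Sum>a<D. (h a)\<^sup>2) / 2))"
      using mult_left_mono[OF low[of h] l] l
      by (simp add: power_mult_distrib sum_distrib_left[symmetric] mult.assoc)
    finally show ?thesis .
  qed
  have "complex_of_real (\<integral>y. exp (- (l * (\<Sum>a<D. (s y a)\<^sup>2) / 2)) \<partial>gauss Q)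
      = (\<integral>y. (\<integral>h. F y h \<partial>gauss {..<D}) \<partial>gauss Q)"
    by (simp only: inner_h integral_complex_of_real)
  also have "\<dots> = (\<integral>h. (\<integral>y. F y h \<partial>gauss Q) \<partial>gauss {..<D})"
    by (rule YH.Fubini_integral[symmetric]) (rule intF)
  finally have eq: "\<bar>\<integral>y. exp (- (l * (\<Sum>a<D. (s y a)\<^sup>2) / 2)) \<partial>gauss Q\<bar>
      = norm (\<integral>h. (\<integral>y. F y h \<partial>gauss Q) \<partial>gauss {..<D})"
    by (metis norm_of_real)
  have l\<tau>: "0 \<le> l * \<tau>" using l \<tau> by simp
  have E: "(\<integral>\<^sup>+ h. ennreal (exp (- (l * \<tau> * (\<Sum>a<D. (h a)\<^sup>2) / 2))) \<partial>gauss {..<D})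
      = ennreal ((1 / sqrt (1 + l * \<tau>)) ^ D)"
  proof -
    have "(\<integral>\<^sup>+ h. ennreal (exp (- (l * \<tau> * (\<Sum>a<D. (h a)\<^sup>2) / 2))) \<partial>gauss {..<D})
        = (\<integral>\<^sup>+ h. (\<Prod>a<D. ennreal (exp (- (l * \<tau> * (h a)\<^sup>2 / 2)))) \<partial>gauss {..<D})"
      by (intro nn_integral_cong)
         (simp add: prod_ennreal exp_sum[symmetric] sum_distrib_left sum_divide_distrib sum_negf)
    also have "\<dots> = (\<Prod>a<D. ennreal (1 / sqrt (1 + l * \<tau>)))"
      by (subst std_normal.product_nn_integral_prod)
         (auto simp: nn_integral_exp_square_std_normal[OF l\<tau>])
    finally show ?thesis using l\<tau> by (simp add: ennreal_power)
  qed
  have meas: "(\<lambda>h. exp (- (l * \<tau> * (\<Sum>a<D. (h a)\<^sup>2) / 2))) \<in> borel_measurable (gauss {..<D})"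
    by measurable
  have int: "integrable (gauss {..<D}) (\<lambda>h. exp (- (l * \<tau> * (\<Sum>a<D. (h a)\<^sup>2) / 2)))"
    using l\<tau> by (intro H.integrable_const_bound[where B = 1] meas AE_I2) (auto intro!: mult_nonneg_nonneg sum_nonneg)
  have "norm (\<integral>h. (\<integral>y. F y h \<partial>gauss Q) \<partial>gauss {..<D})
      \<le> (\<integral>h. exp (- (l * \<tau> * (\<Sum>a<D. (h a)\<^sup>2) / 2)) \<partial>gauss {..<D})"
    by (rule order_trans[OF integral_norm_bound integral_mono[OF integrable_norm[OF YH.integrable_snd[OF intF]] int]])
       (rule inner_y)
  also have "\<dots> = (1 / sqrt (1 + l * \<tau>)) ^ D"
    using E l\<tau> meas by (subst integral_eq_nn_integral) (auto simp del: ennreal_power)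
  finally show ?thesis using eq by (simp add: s_def)
qed

text \<open>Markov's inequality for \<open>exp (- (l * f / 2))\<close>, with \<open>l\<close> left
  free for the caller. The number \<open>\<tau>\<close> bounds the eigenvalues of the covariance of
  the \<open>D\<close> affine forms from below.\<close>

lemma gauss_small_ball:
  fixes \<alpha> :: "nat \<Rightarrow> 'i \<Rightarrow> real" and \<beta> :: "nat \<Rightarrow> real"
  assumes fin: "finite Q" and l: "0 \<le> l" and \<tau>: "0 \<le> \<tau>"
    and low: "\<And>h::nat \<Rightarrow> real. \<tau> * (\<Sum>a<D. (h a)\<^sup>2) \<le> (\<Sum>c\<in>Q. (\<Sum>a<D. h a * \<alpha> a c)\<^sup>2)"
  shows "emeasure (gauss Q) {y \<in> space (gauss Q). (\<Sum>a<D. (\<beta> a + (\<Sum>c\<in>Q. \<alpha> a c * y c))\<^sup>2) \<le> r}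
    \<le> ennreal (exp (l * r / 2) * (1 / sqrt (1 + l * \<tau>)) ^ D)"
proof -
  interpret Y: prob_space "gauss Q" by (rule prob_space_gauss)
  define f where "f y = (\<Sum>a<D. (\<beta> a + (\<Sum>c\<in>Q. \<alpha> a c * y c))\<^sup>2)" for y
  have [measurable]: "f \<in> borel_measurable (gauss Q)"
    unfolding f_def by (intro borel_measurable_sum borel_measurable_power borel_measurable_add
        borel_measurable_const borel_measurable_times) auto
  have f0: "0 \<le> f y" for y unfolding f_def by (intro sum_nonneg) auto
  have int: "integrable (gauss Q) (\<lambda>y. exp (- (l * f y / 2)))"
    using l f0 by (intro Y.integrable_const_bound[where B = 1] AE_I2) auto
  have "Y.prob {y \<in> space (gauss Q). f y \<le> r}
      \<le> Y.prob {y \<in> space (gauss Q). exp (- (l * r / 2)) \<le> exp (- (l * f y / 2))}"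
    using l by (intro Y.finite_measure_mono) (auto intro: mult_left_mono)
  also have "\<dots> \<le> (\<integral>y. exp (- (l * f y / 2)) \<partial>gauss Q) / exp (- (l * r / 2))"
    using integral_Markov_inequality_measure[OF int, where A = "{}" and c = "exp (- (l * r / 2))"] by simp
  also have "\<dots> \<le> (1 / sqrt (1 + l * \<tau>)) ^ D / exp (- (l * r / 2))"
    using gauss_exp_quadratic_bound[OF fin l \<tau> low, of \<beta>] unfolding f_def[symmetric]
    by (intro divide_right_mono) auto
  finally have "Y.prob {y \<in> space (gauss Q). f y \<le> r} \<le> exp (l * r / 2) * (1 / sqrt (1 + l * \<tau>)) ^ D"
    by (simp add: exp_minus field_simps)
  thus ?thesis
    unfolding f_def[symmetric] Y.emeasure_eq_measure by (rule ennreal_leI)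
qed

section \<open>Overcrowding of small singular values\<close>

definition smulv :: "nat set \<Rightarrow> cmat \<Rightarrow> (nat \<Rightarrow> complex) \<Rightarrow> nat \<Rightarrow> complex" where
  "smulv S M x = (\<lambda>i. \<Sum>j\<in>S. M i j * x j)"

text \<open>For a frame \<open>u\<close>, the variational form of the statement that the minor of
  \<open>M\<close> indexed by \<open>S\<close> has at least \<open>d\<close> singular values up to
  \<open>r\<close>.\<close>

definition almost_kernel :: "bool \<Rightarrow> nat set \<Rightarrow> nat \<Rightarrow> real \<Rightarrow> cmat \<Rightarrow> (nat \<Rightarrow> nat \<Rightarrow> complex) \<Rightarrow> bool" where
  "almost_kernel rc S d r M u \<longleftrightarrow>
     (\<forall>h. (\<forall>a<d. h a \<in> Kset rc) \<longrightarrow> cnm S (smulv S M (comb d u h)) \<le> r * cnm {..<d} h)"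

text \<open>The slack \<open>r < \<epsilon>\<close> makes degeneracy an open condition, hence a measurable one.\<close>
definition degenerate :: "bool \<Rightarrow> nat set \<Rightarrow> nat \<Rightarrow> real \<Rightarrow> (nat \<Rightarrow> nat \<Rightarrow> complex) set \<Rightarrow> cmat set" where
  "degenerate rc S d \<epsilon> U = {M. \<exists>u\<in>U. \<exists>r<\<epsilon>. almost_kernel rc S d r M u}"

lemma cnm_le_sum: "cnm I x \<le> (\<Sum>i\<in>I. cmod (x i))"
  unfolding cnm_def by (rule L2_set_le_sum) simp

text \<open>Crude, but applied only where some finite constant suffices: for openness and for
  boundedness of an operator.\<close>

lemma cnm_smulv_le:
  assumes "finite S" "\<And>i j. i \<in> S \<Longrightarrow> j \<in> S \<Longrightarrow> cmod (M i j) \<le> \<tau>"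
  shows "cnm S (smulv S M x) \<le> real (card S) * real (card S) * \<tau> * cnm S x"
proof -
  have "cmod (smulv S M x i) \<le> real (card S) * (\<tau> * cnm S x)" if "i \<in> S" for i
  proof -
    have "cmod (smulv S M x i) \<le> (\<Sum>j\<in>S. cmod (M i j * x j))"
      unfolding smulv_def by (rule norm_sum)
    also have "\<dots> \<le> (\<Sum>j\<in>S. \<tau> * cnm S x)"
      unfolding norm_mult using assms that
      by (intro sum_mono mult_mono norm_le_cnm) (auto intro: order_trans[OF norm_ge_zero])
    finally show ?thesis by simp
  qed
  hence "(\<Sum>i\<in>S. cmod (smulv S M x i)) \<le> (\<Sum>i\<in>S. real (card S) * (\<tau> * cnm S x))"
    by (intro sum_mono) auto
  thus ?thesis using cnm_le_sum[of S "smulv S M x"] by (simp add: mult.assoc)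
qed

lemma open_degenerate:
  assumes fin: "finite S" and U: "U \<subseteq> frames rc S d"
  shows "open (degenerate rc S d \<epsilon> U)"
proof (subst open_subopen, intro ballI)
  fix M assume "M \<in> degenerate rc S d \<epsilon> U"
  then obtain u r where u: "u \<in> U" "r < \<epsilon>" "almost_kernel rc S d r M u"
    by (auto simp: degenerate_def)
  define s where "s = real (card S) * real (card S)"
  \<comment> \<open>Moving every entry by less than \<open>\<tau>\<close> raises \<open>r\<close> by
    at most \<open>s * \<tau>\<close>, which is below \<open>\<epsilon> - r\<close>; the summand 1
    allows for an empty \<open>S\<close>.\<close>
  define \<tau> where "\<tau> = (\<epsilon> - r) / (2 * (s + 1))"
  have s: "0 \<le> s" by (simp add: s_def)
  have \<tau>: "0 < \<tau>" using u(2) s by (simp add: \<tau>_def)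
  have "s * \<tau> < \<epsilon> - r"
  proof -
    have "s * \<tau> = (\<epsilon> - r) * (s / (2 * (s + 1)))" by (simp add: \<tau>_def)
    also have "\<dots> < (\<epsilon> - r) * 1" using u(2) s by (intro mult_strict_left_mono) auto
    finally show ?thesis by simp
  qed
  hence r': "r + s * \<tau> < \<epsilon>" by simp
  define T where "T = (\<Inter>p\<in>S \<times> S. {M' :: cmat. cmod (M' (fst p) (snd p) - M (fst p) (snd p)) < \<tau>})"
  have c: "continuous_on UNIV (\<lambda>M' :: cmat. M' i j)" for i j
  proof -
    have "continuous_on UNIV (\<lambda>f :: nat \<Rightarrow> complex. f j)"
      by (rule continuous_on_product_coordinates)
    from continuous_on_compose2[OF this continuous_on_product_coordinates[of i]]
    show ?thesis by simp
  qed
  have "open T" unfolding T_def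
    by (intro open_INT open_Collect_less continuous_intros c finite_SigmaI fin ballI)
  moreover have "M \<in> T" using \<tau> by (simp add: T_def)
  moreover have "T \<subseteq> degenerate rc S d \<epsilon> U"
  proof
    fix M' assume M': "M' \<in> T"
    have "almost_kernel rc S d (r + s * \<tau>) M' u"
      unfolding almost_kernel_def
    proof (intro allI impI)
      fix h assume h: "\<forall>a<d. h a \<in> Kset rc"
      define x where "x = comb d u h"
      have x: "cnm S x = cnm {..<d} h" unfolding x_def using U u(1) by (intro cnm_comb) auto
      have eq: "smulv S M' x = (\<lambda>i. smulv S M x i + smulv S (\<lambda>i j. M' i j - M i j) x i)"
        by (simp add: smulv_def algebra_simps sum_subtractf)
      have "cnm S (smulv S M' x) \<le> cnm S (smulv S M x) + cnm S (smulv S (\<lambda>i j. M' i j - M i j) x)"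
        unfolding eq by (rule cnm_triangle)
      also have "\<dots> \<le> r * cnm {..<d} h + s * \<tau> * cnm {..<d} h"
      proof (rule add_mono)
        show "cnm S (smulv S M x) \<le> r * cnm {..<d} h"
          using u(3) h by (simp add: almost_kernel_def x_def)
        show "cnm S (smulv S (\<lambda>i j. M' i j - M i j) x) \<le> s * \<tau> * cnm {..<d} h"
          unfolding s_def x[symmetric] using fin M' by (intro cnm_smulv_le) (auto simp: T_def less_imp_le)
      qed
      finally show "cnm S (smulv S M' (comb d u h)) \<le> (r + s * \<tau>) * cnm {..<d} h"
        by (simp add: x_def distrib_right)
    qed
    thus "M' \<in> degenerate rc S d \<epsilon> U" using u(1) r' by (auto simp: degenerate_def)
  qed
  ultimately show "\<exists>T. open T \<and> M \<in> T \<and> T \<subseteq> degenerate rc S d \<epsilon> U" by blast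
qed

text \<open>The sum is the \<open>i\<close>-th diagonal entry of the orthogonal projection onto the
  span of the frame. The threshold is the average of these entries, since the projection has trace
  \<open>d\<close>.\<close>

definition heavy_frames :: "bool \<Rightarrow> nat set \<Rightarrow> nat \<Rightarrow> nat \<Rightarrow> (nat \<Rightarrow> nat \<Rightarrow> complex) set" where
  "heavy_frames rc S d i = {u \<in> frames rc S d. real d / real (card S) \<le> (\<Sum>a<d. (cmod (u a i))\<^sup>2)}"

lemma frames_heavy:
  assumes fin: "finite S" and d: "0 < d" and u: "u \<in> frames rc S d"
  shows "\<exists>i\<in>S. u \<in> heavy_frames rc S d i"
proof (rule ccontr)
  assume "\<not> ?thesis"
  hence less: "(\<Sum>a<d. (cmod (u a i))\<^sup>2) < real d / real (card S)" if "i \<in> S" for i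
    using u that by (auto simp: heavy_frames_def not_le)
  have one: "(cnm S (u a))\<^sup>2 = 1" if "a < d" for a
  proof -
    have "cip S (u a) (u a) = 1" using u that unfolding frames_def by simp
    thus ?thesis unfolding cip_self by (simp only: of_real_eq_1_iff)
  qed
  have "real d = (\<Sum>a<d. (cnm S (u a))\<^sup>2)" using one by simp
  also have "\<dots> = (\<Sum>i\<in>S. \<Sum>a<d. (cmod (u a i))\<^sup>2)"
    unfolding cnm_sq by (rule sum.swap)
  finally have eq: "real d = (\<Sum>i\<in>S. \<Sum>a<d. (cmod (u a i))\<^sup>2)" .
  have ne: "S \<noteq> {}"
  proof
    assume "S = {}"
    thus False using eq d by simp
  qed
  have "(\<Sum>i\<in>S. \<Sum>a<d. (cmod (u a i))\<^sup>2) < (\<Sum>i\<in>S. real d / real (card S))"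
    by (rule sum_strict_mono[OF fin ne less])
  also have "\<dots> = real d" using ne fin by simp
  finally show False using eq by simp
qed

lemma smulv_cip_sym:
  assumes "\<And>i j. i \<in> S \<Longrightarrow> j \<in> S \<Longrightarrow> M j i = cnj (M i j)"
  shows "cip S x (smulv S M y) = cip S (smulv S M x) y"
proof -
  have "cip S x (smulv S M y) = (\<Sum>i\<in>S. \<Sum>j\<in>S. cnj (x i) * M i j * y j)"
    by (simp add: cip_def smulv_def sum_distrib_left mult.assoc)
  also have "\<dots> = (\<Sum>j\<in>S. \<Sum>i\<in>S. cnj (M j i * x i) * y j)"
  proof (subst sum.swap, intro sum.cong refl)
    fix i j assume "i \<in> S" "j \<in> S"
    have "M i j = cnj (M j i)" using \<open>i \<in> S\<close> \<open>j \<in> S\<close> by (rule assms[rotated])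
    thus "cnj (x i) * M i j * y j = cnj (M j i * x i) * y j" by (simp add: mult.commute)
  qed
  also have "\<dots> = cip S (smulv S M x) y"
    by (simp add: cip_def smulv_def sum_distrib_right)
  finally show ?thesis .
qed

text \<open>Keep the combinations vanishing at \<open>i\<close>.\<close>
lemma degenerate_minor:
  assumes fin: "finite S" and M: "M \<in> degenerate rc S (Suc D) \<epsilon> (frames rc S (Suc D))"
  shows "M \<in> degenerate rc (S - {i}) D \<epsilon> (frames rc (S - {i}) D)"
proof -
  from M obtain u r where u: "u \<in> frames rc S (Suc D)" "r < \<epsilon>" "almost_kernel rc S (Suc D) r M u"
    by (auto simp: degenerate_def)
  have "\<exists>g. (\<forall>b<D. \<forall>a. g b a \<in> Kset rc) \<and> (\<forall>b<D. \<forall>e<1::nat. (\<Sum>a<Suc D. u a i * g b a) = 0)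
     \<and> (\<lambda>b. comb (Suc D) u (g b)) \<in> frames rc S D"
  proof (rule orthonormal_frame_in_span[OF fin])
    fix h :: "nat \<Rightarrow> complex" assume "\<exists>a<Suc D. h a \<noteq> 0"
    hence "cnm {..<Suc D} h \<noteq> 0" by (auto simp: cnm_eq_0_iff)
    hence "cnm S (comb (Suc D) u h) \<noteq> 0" using cnm_comb[OF u(1)] by simp
    thus "\<exists>j\<in>S. comb (Suc D) u h j \<noteq> 0" using fin by (auto simp: cnm_eq_0_iff)
  qed (use u(1) in \<open>auto simp: frames_def\<close>)
  then obtain g where g: "\<forall>b<D. \<forall>a. g b a \<in> Kset rc" "\<forall>b<D. (\<Sum>a<Suc D. u a i * g b a) = 0"
    "(\<lambda>b. comb (Suc D) u (g b)) \<in> frames rc S D" by auto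
  define v where "v b = comb (Suc D) u (g b)" for b
  have v: "v \<in> frames rc S D" using g(3) by (simp add: v_def[abs_def])
  have vi: "v b i = 0" if "b < D" for b
    using g(2) that by (simp add: v_def comb_def mult.commute)
  have cipS: "cip (S - {i}) (v a) (v b) = cip S (v a) (v b)" if "a < D" "b < D" for a b
    unfolding cip_def using fin vi that by (intro sum.mono_neutral_left) auto
  have v': "v \<in> frames rc (S - {i}) D"
    using v vi cipS by (auto simp: frames_def)
  have "almost_kernel rc (S - {i}) D r M v"
    unfolding almost_kernel_def
  proof (intro allI impI)
    fix h assume h: "\<forall>a<D. h a \<in> Kset rc"
    define f where "f a = (\<Sum>b<D. h b * g b a)" for a
    have eq: "comb D v h = comb (Suc D) u f"
    proof
      fix j
      have "comb D v h j = (\<Sum>b<D. \<Sum>a<Suc D. h b * g b a * u a j)"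
        unfolding comb_def v_def sum_distrib_left by (simp only: mult.assoc)
      also have "\<dots> = (\<Sum>a<Suc D. \<Sum>b<D. h b * g b a * u a j)" by (rule sum.swap)
      also have "\<dots> = comb (Suc D) u f j" unfolding comb_def f_def sum_distrib_right ..
      finally show "comb D v h j = comb (Suc D) u f j" .
    qed
    have z: "comb D v h i = 0" using vi by (simp add: comb_def)
    have "smulv (S - {i}) M (comb D v h) j = smulv S M (comb D v h) j" for j
      unfolding smulv_def using fin z by (intro sum.mono_neutral_left) auto
    hence "cnm (S - {i}) (smulv (S - {i}) M (comb D v h)) \<le> cnm S (smulv S M (comb D v h))"
      using cnm_mono[OF fin, of "S - {i}" "smulv S M (comb D v h)"] by (simp add: cnm_def)
    also have "\<dots> \<le> r * cnm {..<Suc D} f"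
    proof -
      have "\<forall>a<Suc D. f a \<in> Kset rc" unfolding f_def using g(1) h by (auto intro!: Kset_sum Kset_closed)
      thus ?thesis unfolding eq using u(3) by (simp add: almost_kernel_def)
    qed
    also have "cnm {..<Suc D} f = cnm {..<D} h"
      using cnm_comb[OF u(1), of f] cnm_comb[OF v, of h] eq by simp
    finally show "cnm (S - {i}) (smulv (S - {i}) M (comb D v h)) \<le> r * cnm {..<D} h" .
  qed
  thus ?thesis using v' u(2) by (auto simp: degenerate_def)
qed

text \<open>The key deterministic step: test the equation \<open>M w \<approx> 0\<close>, for \<open>w\<close> in the almost kernel with
  a large \<open>i\<close>-th entry, against the almost kernel of the minor. By self-adjointness only the
  \<open>i\<close>-th column survives.\<close>
lemma heavy_column_small:
  assumes fin: "finite S" and i: "i \<in> S" and d: "0 < d"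
    and sym: "\<And>a b. a \<in> S \<Longrightarrow> b \<in> S \<Longrightarrow> M b a = cnj (M a b)"
    and M: "M \<in> degenerate rc S d \<epsilon> (heavy_frames rc S d i)"
    and v: "v \<in> frames rc (S - {i}) D" "r' < \<epsilon>" "almost_kernel rc (S - {i}) D r' M v"
  shows "(\<Sum>a<D. (Re (cip (S - {i}) (v a) (\<lambda>j. M j i)))\<^sup>2) \<le> (2 * \<epsilon>)\<^sup>2 * real (card S) / real d"
proof -
  let ?S = "S - {i}"
  from M obtain u r where u: "u \<in> heavy_frames rc S d i" "r < \<epsilon>" "almost_kernel rc S d r M u"
    by (auto simp: degenerate_def)
  have uf: "u \<in> frames rc S d" and heavy: "real d / real (card S) \<le> (\<Sum>a<d. (cmod (u a i))\<^sup>2)"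
    using u(1) by (simp_all add: heavy_frames_def)
  \<comment> \<open>With these coefficients \<open>w\<close> is the projection of the
    \<open>i\<close>-th unit vector onto the span of \<open>u\<close>; hence its \<open>i\<close>-th
    entry equals its squared norm \<open>A\<^sup>2\<close>, which is at least
    \<open>d / card S\<close>.\<close>
  define h where "h a = cnj (u a i)" for a
  define w where "w = comb d u h"
  define g where "g a = Re (cip ?S (v a) (\<lambda>j. M j i))" for a
  \<comment> \<open>Chosen so that its pairing with column \<open>i\<close> has real part
    \<open>G\<^sup>2\<close> while its norm is only \<open>G\<close>.\<close>
  define x where "x = comb D v (\<lambda>a. complex_of_real (g a))"
  define A where "A = cnm {..<d} h"
  define G where "G = cnm {..<D} (\<lambda>a. complex_of_real (g a))"
  have A2: "A\<^sup>2 = (\<Sum>a<d. (cmod (u a i))\<^sup>2)" by (simp add: A_def cnm_sq h_def)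
  have G2: "G\<^sup>2 = (\<Sum>a<D. (g a)\<^sup>2)" by (simp add: G_def cnm_sq)
  have wi: "w i = complex_of_real (A\<^sup>2)"
    unfolding A2 w_def comb_def h_def of_real_sum by (simp only: complex_norm_square mult.commute)
  have w: "cnm S w = A" unfolding w_def A_def by (rule cnm_comb[OF uf])
  have x: "cnm ?S x = G" unfolding x_def G_def by (rule cnm_comb[OF v(1)])
  have hK: "\<forall>a<d. h a \<in> Kset rc" using uf by (auto simp: h_def frames_def intro: Kset_closed)
  have split: "smulv S M w j = smulv ?S M w j + w i * M j i" for j
    unfolding smulv_def using fin i by (subst sum.remove[of S i]) auto
  have "Re (cip ?S x (\<lambda>j. M j i)) = (\<Sum>a<D. g a * g a)"
    unfolding x_def comb_def cip_sum_left by (simp add: g_def)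
  hence xM: "Re (cip ?S x (\<lambda>j. M j i)) = G\<^sup>2" using G2 by (simp add: power2_eq_square)
  have "cip ?S x (smulv S M w) = cip ?S x (smulv ?S M w) + w i * cip ?S x (\<lambda>j. M j i)"
    unfolding split[abs_def] cip_add_right cip_scale_right ..
  hence "A\<^sup>2 * G\<^sup>2 = Re (cip ?S x (smulv S M w)) - Re (cip ?S x (smulv ?S M w))"
    using wi xM by simp
  also have "\<dots> \<le> cmod (cip ?S x (smulv S M w)) + cmod (cip ?S x (smulv ?S M w))"
    using abs_Re_le_cmod[of "cip ?S x (smulv S M w)"] abs_Re_le_cmod[of "cip ?S x (smulv ?S M w)"] by linarith
  also have "cmod (cip ?S x (smulv S M w)) \<le> G * (\<epsilon> * A)"
  proof -
    have "cnm ?S (smulv S M w) \<le> cnm S (smulv S M w)" using fin by (intro cnm_mono) auto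
    also have "\<dots> \<le> r * A" using u(3) hK by (simp add: almost_kernel_def w_def A_def)
    also have "\<dots> \<le> \<epsilon> * A" using u(2) by (intro mult_right_mono) (auto simp: A_def)
    finally show ?thesis
      using cip_Cauchy_Schwarz[of ?S x "smulv S M w"] x by (smt (verit) cnm_nonneg mult_left_mono)
  qed
  also have "cmod (cip ?S x (smulv ?S M w)) \<le> G * (\<epsilon> * A)"
  proof -
    have "cip ?S x (smulv ?S M w) = cip ?S (smulv ?S M x) w"
      by (rule smulv_cip_sym) (rule sym, auto)
    hence "cmod (cip ?S x (smulv ?S M w)) \<le> cnm ?S (smulv ?S M x) * cnm ?S w"
      using cip_Cauchy_Schwarz by metis
    also have "\<dots> \<le> (r' * G) * A"
    proof (rule mult_mono)
      show "cnm ?S (smulv ?S M x) \<le> r' * G"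
        using v(3) unfolding almost_kernel_def x_def G_def by (auto intro: Kset_closed)
      then show "0 \<le> r' * G" by (rule order_trans[OF cnm_nonneg])
      show "cnm ?S w \<le> A" unfolding w[symmetric] using fin by (intro cnm_mono) auto
    qed simp
    also have "\<dots> \<le> G * (\<epsilon> * A)"
      using v(2) by (simp add: mult_ac mult_left_mono mult_right_mono A_def G_def)
    finally show ?thesis .
  qed
  finally have key: "A\<^sup>2 * G\<^sup>2 \<le> 2 * \<epsilon> * A * G" by (simp add: algebra_simps)
  have cS: "0 < real (card S)" using fin i by (simp add: card_gt_0_iff) auto
  have A0: "real d / real (card S) \<le> A\<^sup>2" using heavy A2 by simp
  have Apos: "0 < A" using A0 cS d by (smt (verit) A_def cnm_nonneg divide_pos_pos of_nat_0_less_iff zero_power2)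
  show ?thesis
  proof (cases "G = 0")
    case True
    thus ?thesis using G2 by (simp add: g_def)
  next
    case False
    hence G: "0 < G" by (simp add: G_def less_le)
    have "(A * G) * (A * G) \<le> (2 * \<epsilon>) * (A * G)" using key by (simp add: power2_eq_square mult_ac)
    hence AG: "A * G \<le> 2 * \<epsilon>" using Apos G by simp
    hence "(A * G)\<^sup>2 \<le> (2 * \<epsilon>)\<^sup>2" using Apos G by (intro power_mono) auto
    hence "(real d / real (card S)) * G\<^sup>2 \<le> (2 * \<epsilon>)\<^sup>2"
      using mult_right_mono[OF A0, of "G\<^sup>2"] by (simp add: power_mult_distrib)
    hence "G\<^sup>2 \<le> (2 * \<epsilon>)\<^sup>2 * real (card S) / real d" using cS d by (simp add: field_simps)
    thus ?thesis using G2 by (simp add: g_def)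
  qed
qed

section \<open>The Wigner matrix and the randomness of one of its columns\<close>

abbreviation wig_index :: "nat \<Rightarrow> ((nat \<times> nat) \<times> bool) set" where
  "wig_index n \<equiv> ({..<n} \<times> {..<n}) \<times> UNIV"

lemma wig_space_gauss: "wig_space n = gauss (wig_index n)"
  by (simp add: wig_space_def)

lemma measurable_wigner: "wigner rc n \<sigma> \<in> borel_measurable (wig_space n)"
proof -
  have [measurable]: "(\<lambda>\<omega>. \<omega> ((i, j), t)) \<in> borel_measurable (wig_space n)" if "i < n" "j < n" for i j t
    unfolding wig_space_def using measurable_component_singleton[of "((i, j), t)" "wig_index n" "\<lambda>_. std_normal_distribution"] that
    by simp
  have "(\<lambda>\<omega>. wigner rc n \<sigma> \<omega> i j) \<in> borel_measurable (wig_space n)" for i j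
  proof (cases "i < n \<and> j < n")
    case True
    hence [measurable]: "(\<lambda>\<omega>. wig_entry rc \<sigma> \<omega> i j) \<in> borel_measurable (wig_space n)"
      "(\<lambda>\<omega>. wig_entry rc \<sigma> \<omega> j i) \<in> borel_measurable (wig_space n)"
      unfolding wig_entry_def by (cases rc; simp)+
    have [measurable]: "(\<lambda>\<omega>. cnj (wig_entry rc \<sigma> \<omega> j i)) \<in> borel_measurable (wig_space n)"
      by (rule borel_measurable_continuous_on[OF continuous_on_cnj[OF continuous_on_id]]) measurable
    show ?thesis unfolding wigner_def using True by (cases "i = j"; cases "i < j") simp_all
  next
    case False
    hence "(\<lambda>\<omega>. wigner rc n \<sigma> \<omega> i j) = (\<lambda>\<omega>. 0)" unfolding wigner_def by auto
    thus ?thesis by simp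
  qed
  thus ?thesis by (intro measurable_coordinatewise_then_product)
qed

text \<open>Off the diagonal only the upper triangle carries randomness, so the entry of column
  \<open>i\<close> in row \<open>j\<close> is driven by the coordinates of the ordered pair.\<close>

definition col_index :: "nat \<Rightarrow> nat \<times> bool \<Rightarrow> (nat \<times> nat) \<times> bool" where
  "col_index i = (\<lambda>(j, t). ((min i j, max i j), t))"

definition col_row :: "nat \<Rightarrow> (nat \<times> nat) \<times> bool \<Rightarrow> nat" where
  "col_row i c = (if fst (fst c) = i then snd (fst c) else fst (fst c))"

text \<open>The stored pair gives the entry itself for \<open>j < i\<close> and its conjugate for
  \<open>j > i\<close>, hence the sign of the imaginary coefficient.\<close>

definition col_coeff :: "bool \<Rightarrow> real \<Rightarrow> nat \<Rightarrow> nat \<Rightarrow> bool \<Rightarrow> complex" where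
  "col_coeff rc \<sigma> i j t = (if rc then (if t then 0 else complex_of_real \<sigma>)
     else complex_of_real (\<sigma> / sqrt 2) * (if t then (if j < i then \<i> else - \<i>) else 1))"

lemma col_row_index: "col_row i (col_index i (j, t)) = j"
  by (auto simp: col_row_def col_index_def min_def max_def)

lemma inj_col_index: "inj_on (col_index i) A"
  by (rule inj_on_inverseI[where g = "\<lambda>c. (col_row i c, snd c)"])
     (auto simp: col_row_index, auto simp: col_index_def)

lemma wigner_column:
  assumes "i < n" "j < n" "i \<noteq> j"
  shows "wigner rc n \<sigma> \<omega> j i = (\<Sum>t\<in>UNIV. col_coeff rc \<sigma> i j t * complex_of_real (\<omega> (col_index i (j, t))))"
  using assms by (cases "j < i") (auto simp: wigner_def wig_entry_def col_coeff_def col_index_def UNIV_bool min_def max_def algebra_simps)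

text \<open>The sum is the variance of the real part of an entry multiplied by \<open>cnj v\<close>.
  In the complex case only half of the variance \<open>\<sigma>\<^sup>2\<close> falls on the real
  part, which explains the factor.\<close>

lemma col_coeff_lower_bound:
  assumes "v \<in> Kset rc"
  shows "\<sigma>\<^sup>2 / 2 * (cmod v)\<^sup>2 \<le> (\<Sum>t\<in>UNIV. (Re (cnj v * col_coeff rc \<sigma> i j t))\<^sup>2)"
proof (cases rc)
  case True
  then obtain r where "v = complex_of_real r" using assms by (auto simp: Kset_def elim: Reals_cases)
  thus ?thesis using True by (simp add: col_coeff_def UNIV_bool power_mult_distrib mult.commute)
next
  case False
  have "(\<sigma> / sqrt 2)\<^sup>2 = \<sigma>\<^sup>2 / 2" by (simp add: power_divide)
  thus ?thesis using False
    by (auto simp: col_coeff_def UNIV_bool cmod_power2 power_mult_distrib power_divide algebra_simps)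
qed

lemma wigner_hermitian: "wigner rc n \<sigma> \<omega> j i = cnj (wigner rc n \<sigma> \<omega> i j)"
  by (auto simp: wigner_def)

text \<open>Here \<open>y\<close> is the randomness of column \<open>i\<close> and \<open>x\<close> freezes the rest.\<close>
lemma column_small_ball:
  fixes B :: cmat
  assumes S: "S \<subseteq> {..<n}" and i: "i \<in> S" and v: "v \<in> frames rc (S - {i}) D" and l: "0 \<le> l"
    and Q: "Q = col_index i ` ((S - {i}) \<times> UNIV)" and PQ: "P \<inter> Q = {}"
  shows "emeasure (gauss Q) {y \<in> space (gauss Q).
      (\<Sum>a<D. (Re (cip (S - {i}) (v a) (\<lambda>j. B j i + wigner rc n \<sigma> (merge P Q (x, y)) j i)))\<^sup>2) \<le> r}
    \<le> ennreal (exp (l * r / 2) * (1 / sqrt (1 + l * (\<sigma>\<^sup>2 / 2))) ^ D)"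
proof -
  have finS: "finite S" using S finite_subset by blast
  have finQ: "finite Q" using finS by (simp add: Q)
  define \<alpha> where "\<alpha> a c = Re (cnj (v a (col_row i c)) * col_coeff rc \<sigma> i (col_row i c) (snd c))" for a c
  define \<beta> where "\<beta> a = Re (cip (S - {i}) (v a) (\<lambda>j. B j i))" for a
  have snd_col: "snd (col_index i (j, t)) = t" for j t by (simp add: col_index_def)
  have sumQ: "(\<Sum>c\<in>Q. f c) = (\<Sum>j\<in>S - {i}. \<Sum>t\<in>UNIV. f (col_index i (j, t)))" for f :: "_ \<Rightarrow> real"
    unfolding Q by (subst sum.reindex[OF inj_col_index]) (simp add: sum.cartesian_product)
  have lin: "Re (cip (S - {i}) (v a) (\<lambda>j. B j i + wigner rc n \<sigma> (merge P Q (x, y)) j i))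
      = \<beta> a + (\<Sum>c\<in>Q. \<alpha> a c * y c)" for a y
  proof -
    have m: "merge P Q (x, y) (col_index i (j, t)) = y (col_index i (j, t))" if "j \<in> S - {i}" for j t
    proof -
      have "col_index i (j, t) \<in> Q" using that by (auto simp: Q)
      thus ?thesis using PQ by (auto simp: merge_def)
    qed
    have "Re (cip (S - {i}) (v a) (\<lambda>j. wigner rc n \<sigma> (merge P Q (x, y)) j i))
        = (\<Sum>j\<in>S - {i}. \<Sum>t\<in>UNIV. Re (cnj (v a j) * col_coeff rc \<sigma> i j t) * y (col_index i (j, t)))"
      unfolding cip_def Re_sum
    proof (intro sum.cong refl)
      fix j assume j: "j \<in> S - {i}"
      have "wigner rc n \<sigma> (merge P Q (x, y)) j i
          = (\<Sum>t\<in>UNIV. col_coeff rc \<sigma> i j t * complex_of_real (y (col_index i (j, t))))"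
        using j S i by (subst wigner_column) (auto simp: m[OF j])
      hence "Re (cnj (v a j) * wigner rc n \<sigma> (merge P Q (x, y)) j i)
          = (\<Sum>t\<in>UNIV. Re (cnj (v a j) * (col_coeff rc \<sigma> i j t * complex_of_real (y (col_index i (j, t))))))"
        by (simp only: sum_distrib_left Re_sum)
      thus "Re (cnj (v a j) * wigner rc n \<sigma> (merge P Q (x, y)) j i)
          = (\<Sum>t\<in>UNIV. Re (cnj (v a j) * col_coeff rc \<sigma> i j t) * y (col_index i (j, t)))"
        by (simp add: algebra_simps)
    qed
    also have "\<dots> = (\<Sum>c\<in>Q. \<alpha> a c * y c)"
      unfolding sumQ \<alpha>_def col_row_index snd_col ..
    finally show ?thesis by (simp add: cip_add_right \<beta>_def)
  qed
  \<comment> \<open>As \<open>comb\<close> is an isometry, the lower bound per entry becomes a lower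
    bound for the covariance of the \<open>D\<close> real parts.\<close>
  have low: "\<sigma>\<^sup>2 / 2 * (\<Sum>a<D. (h a)\<^sup>2) \<le> (\<Sum>c\<in>Q. (\<Sum>a<D. h a * \<alpha> a c)\<^sup>2)" for h :: "nat \<Rightarrow> real"
  proof -
    define w where "w = comb D v (\<lambda>a. complex_of_real (h a))"
    have "(\<Sum>a<D. (h a)\<^sup>2) = (cnm (S - {i}) w)\<^sup>2"
      unfolding w_def cnm_comb[OF v] cnm_sq by simp
    also have "\<dots> = (\<Sum>j\<in>S - {i}. (cmod (w j))\<^sup>2)" by (rule cnm_sq)
    finally have "\<sigma>\<^sup>2 / 2 * (\<Sum>a<D. (h a)\<^sup>2) = (\<Sum>j\<in>S - {i}. \<sigma>\<^sup>2 / 2 * (cmod (w j))\<^sup>2)"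
      by (simp add: sum_distrib_left)
    also have "\<dots> \<le> (\<Sum>j\<in>S - {i}. \<Sum>t\<in>UNIV. (Re (cnj (w j) * col_coeff rc \<sigma> i j t))\<^sup>2)"
    proof (intro sum_mono col_coeff_lower_bound)
      fix j show "w j \<in> Kset rc" unfolding w_def comb_def
        using v by (auto simp: frames_def intro!: Kset_sum Kset_closed)
    qed
    also have "\<dots> = (\<Sum>c\<in>Q. (\<Sum>a<D. h a * \<alpha> a c)\<^sup>2)"
      unfolding sumQ \<alpha>_def col_row_index snd_col
      by (intro sum.cong refl arg_cong[where f = "\<lambda>x. x\<^sup>2"])
         (simp add: w_def comb_def sum_distrib_right mult.assoc)
    finally show ?thesis .
  qed
  show ?thesis unfolding lin
    by (rule gauss_small_ball[OF finQ l _ low]) simp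
qed


section \<open>Recursion over principal minors\<close>

definition shifted_degenerate where
  "shifted_degenerate rc n \<sigma> B S d \<epsilon> U
    = {\<omega> \<in> space (wig_space n). (\<lambda>i j. B i j + wigner rc n \<sigma> \<omega> i j) \<in> degenerate rc S d \<epsilon> U}"

text \<open>The event is a union over uncountably many frames; it is measurable because
  \<open>degenerate\<close> is open in the product topology.\<close>

lemma sets_shifted_degenerate:
  assumes "finite S" "U \<subseteq> frames rc S d"
  shows "shifted_degenerate rc n \<sigma> B S d \<epsilon> U \<in> sets (wig_space n)"
proof -
  have "(\<lambda>\<omega>. wigner rc n \<sigma> \<omega> i j) \<in> borel_measurable (wig_space n)" for i j
  proof -
    have "(\<lambda>\<omega>. wigner rc n \<sigma> \<omega> i) \<in> borel_measurable (wig_space n)"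
      using measurable_product_then_coordinatewise[OF measurable_wigner] by simp
    thus ?thesis by (rule measurable_product_then_coordinatewise)
  qed
  hence "(\<lambda>\<omega> i j. B i j + wigner rc n \<sigma> \<omega> i j) \<in> borel_measurable (wig_space n)"
    by (intro measurable_coordinatewise_then_product borel_measurable_add) auto
  from measurable_sets[OF this borel_open[OF open_degenerate[OF assms]]]
  show ?thesis by (simp add: shifted_degenerate_def vimage_def Int_def conj_commute)
qed

text \<open>Fubini over column \<open>i\<close> and the rest. Degeneracy of the minor is an event of
  the rest alone, and on it the column must fall into a small ball of the kind treated in
  \<open>column_small_ball\<close>; so the two bounds multiply.\<close>

lemma shifted_degenerate_heavy:
  assumes S: "S \<subseteq> {..<n}" and i: "i \<in> S" and l: "0 \<le> l"
    and B: "\<And>a b. a < n \<Longrightarrow> b < n \<Longrightarrow> B b a = cnj (B a b)"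
  shows "emeasure (wig_space n) (shifted_degenerate rc n \<sigma> B S (Suc D) \<epsilon> (heavy_frames rc S (Suc D) i))
    \<le> ennreal (exp (l * ((2 * \<epsilon>)\<^sup>2 * real (card S) / real (Suc D)) / 2) * (1 / sqrt (1 + l * (\<sigma>\<^sup>2 / 2))) ^ D)
      * emeasure (wig_space n) (shifted_degenerate rc n \<sigma> B (S - {i}) D \<epsilon> (frames rc (S - {i}) D))"
    (is "emeasure _ ?A \<le> ennreal ?q * emeasure _ ?A'")
proof -
  have finS: "finite S" using S finite_subset by blast
  define Q where "Q = col_index i ` ((S - {i}) \<times> UNIV)"
  define P where "P = wig_index n - Q"
  have QI: "Q \<subseteq> wig_index n" using S i by (auto simp: Q_def col_index_def min_def max_def)
  have fin: "finite P" "finite Q" using finS by (auto simp: P_def Q_def)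
  have PQ: "P \<inter> Q = {}" "P \<union> Q = wig_index n" using QI by (auto simp: P_def)
  interpret GQ: prob_space "gauss Q" by (rule prob_space_gauss)
  have sA: "?A \<in> sets (wig_space n)" and sA': "?A' \<in> sets (wig_space n)"
    using finS by (auto intro!: sets_shifted_degenerate simp: heavy_frames_def)
  have fold: "emeasure (wig_space n) X = (\<integral>\<^sup>+ x. \<integral>\<^sup>+ y. indicator X (merge P Q (x, y)) \<partial>gauss Q \<partial>gauss P)"
    if "X \<in> sets (wig_space n)" for X
  proof -
    have "emeasure (wig_space n) X = (\<integral>\<^sup>+ \<omega>. indicator X \<omega> \<partial>gauss (P \<union> Q))"
      using that by (simp add: PQ(2) wig_space_gauss)
    also have "\<dots> = (\<integral>\<^sup>+ x. \<integral>\<^sup>+ y. indicator X (merge P Q (x, y)) \<partial>gauss Q \<partial>gauss P)"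
      using that by (intro std_normal.product_nn_integral_fold PQ(1) fin) (simp add: PQ(2) wig_space_gauss)
    finally show ?thesis .
  qed
  let ?M = "\<lambda>x y i j. B i j + wigner rc n \<sigma> (merge P Q (x, y)) i j"
  have minor: "?M x y a b = ?M x y' a b" if "a \<in> S - {i}" "b \<in> S - {i}" for x y y' a b
  proof -
    have "((a, b), t) \<notin> Q" if "a \<in> S - {i}" "b \<in> S - {i}" for a b t
      using that by (auto simp: Q_def col_index_def min_def max_def split: if_splits)
    hence "merge P Q (x, y) ((a, b), t) = merge P Q (x, y') ((a, b), t)" if "a \<in> S - {i}" "b \<in> S - {i}" for a b t
      using that by (simp add: merge_def)
    thus ?thesis using that by (simp add: wigner_def wig_entry_def)
  qed
  have ak: "almost_kernel rc (S - {i}) D r (?M x y) u = almost_kernel rc (S - {i}) D r (?M x y') u" for r x y y' u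
  proof -
    have "cnm (S - {i}) (smulv (S - {i}) (?M x y) z) = cnm (S - {i}) (smulv (S - {i}) (?M x y') z)" for z
      unfolding smulv_def by (intro cnm_cong sum.cong refl) (use minor in metis)
    thus ?thesis by (simp add: almost_kernel_def)
  qed
  have inner: "(\<integral>\<^sup>+ y. indicator ?A (merge P Q (x, y)) \<partial>gauss Q)
      \<le> ennreal ?q * (\<integral>\<^sup>+ y. indicator ?A' (merge P Q (x, y)) \<partial>gauss Q)" if x: "x \<in> space (gauss P)" for x
  proof (cases "\<exists>y0\<in>space (gauss Q). merge P Q (x, y0) \<in> ?A")
    case False
    hence "(\<integral>\<^sup>+ y. indicator ?A (merge P Q (x, y)) \<partial>gauss Q) = (\<integral>\<^sup>+ y. 0 \<partial>gauss Q)"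
      by (intro nn_integral_cong) (auto simp: indicator_def)
    thus ?thesis by simp
  next
    case True
    then obtain y0 where y0: "y0 \<in> space (gauss Q)"
      "?M x y0 \<in> degenerate rc S (Suc D) \<epsilon> (heavy_frames rc S (Suc D) i)"
      by (auto simp: shifted_degenerate_def)
    have "?M x y0 \<in> degenerate rc S (Suc D) \<epsilon> (frames rc S (Suc D))"
      using y0(2) by (auto simp: degenerate_def heavy_frames_def)
    \<comment> \<open>One value \<open>y0\<close> of the column already provides a frame
      \<open>v\<close> for the minor. As the minor does not change with \<open>y\<close>, the same
      \<open>v\<close> serves the whole fibre over \<open>x\<close>, and the estimate proceeds fibre
      by fibre without a measurable selection of \<open>v\<close>.\<close>
    from degenerate_minor[OF finS this, of i] obtain v r' where v: "v \<in> frames rc (S - {i}) D" "r' < \<epsilon>"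
      "almost_kernel rc (S - {i}) D r' (?M x y0) v"
      by (auto simp: degenerate_def)
    have v': "almost_kernel rc (S - {i}) D r' (?M x y) v" for y
      using v(3) ak by blast
    have sp: "merge P Q (x, y) \<in> space (wig_space n)" if "y \<in> space (gauss Q)" for y
      using x that by (auto simp: wig_space_gauss space_PiM PQ(2)[symmetric])
    have A': "merge P Q (x, y) \<in> ?A'" if "y \<in> space (gauss Q)" for y
      using sp[OF that] v(1,2) v'[of y] by (auto simp: shifted_degenerate_def degenerate_def)
    let ?E = "{y \<in> space (gauss Q).
      (\<Sum>a<D. (Re (cip (S - {i}) (v a) (\<lambda>j. B j i + wigner rc n \<sigma> (merge P Q (x, y)) j i)))\<^sup>2)
        \<le> (2 * \<epsilon>)\<^sup>2 * real (card S) / real (Suc D)}"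
    have sub: "y \<in> ?E" if y: "y \<in> space (gauss Q)" "merge P Q (x, y) \<in> ?A" for y
    proof -
      have "?M x y b a = cnj (?M x y a b)" if "a \<in> S" "b \<in> S" for a b
        using that S B[of a b] wigner_hermitian[of rc n \<sigma> "merge P Q (x, y)" b a] by auto
      moreover have "?M x y \<in> degenerate rc S (Suc D) \<epsilon> (heavy_frames rc S (Suc D) i)"
        using y by (simp add: shifted_degenerate_def)
      ultimately show ?thesis
        using y(1) heavy_column_small[OF finS i _ _ _ v(1,2) v', of "Suc D"] by simp
    qed
    have mE: "?E \<in> sets (gauss Q)"
    proof -
      have m1: "(\<lambda>y. wigner rc n \<sigma> (merge P Q (x, y)) j i) \<in> borel_measurable (gauss Q)" for j
      proof -
        have "(\<lambda>y. merge P Q (x, y)) \<in> measurable (gauss Q) (wig_space n)"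
          unfolding wig_space_gauss PQ(2)[symmetric] using x by measurable
        from measurable_compose[OF this measurable_wigner]
        have "(\<lambda>y. wigner rc n \<sigma> (merge P Q (x, y)) j) \<in> borel_measurable (gauss Q)"
          by (rule measurable_product_then_coordinatewise)
        thus ?thesis by (rule measurable_product_then_coordinatewise)
      qed
      show ?thesis unfolding cip_def using m1 by measurable
    qed
    have "(\<integral>\<^sup>+ y. indicator ?A (merge P Q (x, y)) \<partial>gauss Q) \<le> (\<integral>\<^sup>+ y. indicator ?E y \<partial>gauss Q)"
      using sub by (intro nn_integral_mono) (auto simp: indicator_def simp del: mem_Collect_eq)
    also have "\<dots> = emeasure (gauss Q) ?E" using mE by (rule nn_integral_indicator)
    also have "\<dots> \<le> ennreal ?q"
      by (rule column_small_ball[OF S i v(1) l Q_def PQ(1)])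
    also have "\<dots> = ennreal ?q * (\<integral>\<^sup>+ y. indicator ?A' (merge P Q (x, y)) \<partial>gauss Q)"
    proof -
      have "(\<integral>\<^sup>+ y. indicator ?A' (merge P Q (x, y)) \<partial>gauss Q) = (\<integral>\<^sup>+ y. 1 \<partial>gauss Q)"
        using A' by (intro nn_integral_cong) auto
      thus ?thesis by (simp add: GQ.emeasure_space_1)
    qed
    finally show ?thesis .
  qed
  have mfold: "(\<lambda>x. \<integral>\<^sup>+ y. indicator ?A' (merge P Q (x, y)) \<partial>gauss Q) \<in> borel_measurable (gauss P)"
  proof -
    have "(\<lambda>p. merge P Q p) \<in> measurable (gauss P \<Otimes>\<^sub>M gauss Q) (wig_space n)"
      unfolding wig_space_gauss PQ(2)[symmetric] by (rule measurable_merge)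
    from measurable_compose[OF this borel_measurable_indicator[OF sA']]
    have "(\<lambda>p. indicator ?A' (merge P Q p) :: ennreal) \<in> borel_measurable (gauss P \<Otimes>\<^sub>M gauss Q)" .
    hence "(\<lambda>(x, y). indicator ?A' (merge P Q (x, y)) :: ennreal) \<in> borel_measurable (gauss P \<Otimes>\<^sub>M gauss Q)"
      by (simp add: case_prod_beta)
    thus ?thesis by (rule GQ.borel_measurable_nn_integral)
  qed
  have "emeasure (wig_space n) ?A
      \<le> (\<integral>\<^sup>+ x. ennreal ?q * (\<integral>\<^sup>+ y. indicator ?A' (merge P Q (x, y)) \<partial>gauss Q) \<partial>gauss P)"
    unfolding fold[OF sA] by (intro nn_integral_mono inner)
  also have "\<dots> = ennreal ?q * emeasure (wig_space n) ?A'"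
    unfolding fold[OF sA'] by (rule nn_integral_cmult[OF mfold])
  finally show ?thesis .
qed

text \<open>Each of the \<open>j\<close> deletions costs the factor \<open>n\<close> from the choice
  of a heavy index and gains a small ball factor. At least \<open>e\<close> dimensions remain
  throughout, which makes that factor uniform.\<close>

lemma shifted_degenerate_bound:
  assumes S: "S \<subseteq> {..<n}" and l: "0 \<le> l" and e: "1 \<le> e"
    and B: "\<And>a b. a < n \<Longrightarrow> b < n \<Longrightarrow> B b a = cnj (B a b)"
  shows "emeasure (wig_space n) (shifted_degenerate rc n \<sigma> B S (e + j) \<epsilon> (frames rc S (e + j)))
    \<le> ennreal ((real n * (exp (l * (2 * \<epsilon>\<^sup>2 * real n / real e)) * (1 / sqrt (1 + l * (\<sigma>\<^sup>2 / 2))) ^ e)) ^ j)"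
  using S
proof (induction j arbitrary: S)
  case 0
  interpret prob_space "wig_space n" unfolding wig_space_gauss by (rule prob_space_gauss)
  show ?case by (simp add: emeasure_le_1)
next
  case (Suc j)
  define q where "q = exp (l * (2 * \<epsilon>\<^sup>2 * real n / real e)) * (1 / sqrt (1 + l * (\<sigma>\<^sup>2 / 2))) ^ e"
  have q0: "0 \<le> q" using l by (simp add: q_def)
  have finS: "finite S" using Suc.prems finite_subset by blast
  have cS: "card S \<le> n" using card_mono[OF _ Suc.prems] by simp
  have le_q: "exp (l * ((2 * \<epsilon>)\<^sup>2 * real (card S) / real (Suc (e + j))) / 2) * (1 / sqrt (1 + l * (\<sigma>\<^sup>2 / 2))) ^ (e + j) \<le> q"
    unfolding q_def
  proof (rule mult_mono)
    have "(2 * \<epsilon>)\<^sup>2 * real (card S) / real (Suc (e + j)) / 2 = 2 * \<epsilon>\<^sup>2 * real (card S) / real (Suc (e + j))"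
      by (simp add: power_mult_distrib field_simps del: of_nat_Suc)
    also have "\<dots> \<le> 2 * \<epsilon>\<^sup>2 * real n / real e"
      using cS e by (intro frac_le mult_left_mono) auto
    finally have F: "(2 * \<epsilon>)\<^sup>2 * real (card S) / real (Suc (e + j)) / 2 \<le> 2 * \<epsilon>\<^sup>2 * real n / real e" .
    show "exp (l * ((2 * \<epsilon>)\<^sup>2 * real (card S) / real (Suc (e + j))) / 2) \<le> exp (l * (2 * \<epsilon>\<^sup>2 * real n / real e))"
      using mult_left_mono[OF F l] by (simp only: exp_le_cancel_iff times_divide_eq_right)
    show "(1 / sqrt (1 + l * (\<sigma>\<^sup>2 / 2))) ^ (e + j) \<le> (1 / sqrt (1 + l * (\<sigma>\<^sup>2 / 2))) ^ e"
    proof (rule power_decreasing)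
      have "1 \<le> sqrt (1 + l * (\<sigma>\<^sup>2 / 2))" using l by simp
      thus "1 / sqrt (1 + l * (\<sigma>\<^sup>2 / 2)) \<le> 1" "0 \<le> 1 / sqrt (1 + l * (\<sigma>\<^sup>2 / 2))"
        by (auto simp only: divide_le_eq_1 zero_le_divide_1_iff)
    qed simp
  qed (use l in auto)
  have "shifted_degenerate rc n \<sigma> B S (e + Suc j) \<epsilon> (frames rc S (e + Suc j))
      \<subseteq> (\<Union>i\<in>S. shifted_degenerate rc n \<sigma> B S (Suc (e + j)) \<epsilon> (heavy_frames rc S (Suc (e + j)) i))"
    using frames_heavy[OF finS, of "Suc (e + j)" _ rc]
    by (fastforce simp: shifted_degenerate_def degenerate_def)
  hence "emeasure (wig_space n) (shifted_degenerate rc n \<sigma> B S (e + Suc j) \<epsilon> (frames rc S (e + Suc j)))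
      \<le> emeasure (wig_space n) (\<Union>i\<in>S. shifted_degenerate rc n \<sigma> B S (Suc (e + j)) \<epsilon> (heavy_frames rc S (Suc (e + j)) i))"
    by (rule emeasure_mono)
       (auto intro!: sets.finite_UN sets_shifted_degenerate finS simp: heavy_frames_def)
  also have "\<dots> \<le> (\<Sum>i\<in>S. emeasure (wig_space n)
      (shifted_degenerate rc n \<sigma> B S (Suc (e + j)) \<epsilon> (heavy_frames rc S (Suc (e + j)) i)))"
    using finS by (intro emeasure_subadditive_finite) (auto intro!: sets_shifted_degenerate simp: heavy_frames_def)
  also have "\<dots> \<le> (\<Sum>i\<in>S. ennreal q * ennreal ((real n * q) ^ j))"
  proof (rule sum_mono)
    fix i assume i: "i \<in> S"
    show "emeasure (wig_space n) (shifted_degenerate rc n \<sigma> B S (Suc (e + j)) \<epsilon> (heavy_frames rc S (Suc (e + j)) i))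
        \<le> ennreal q * ennreal ((real n * q) ^ j)"
      using Suc.IH[of "S - {i}"] Suc.prems
      by (intro order_trans[OF shifted_degenerate_heavy[OF Suc.prems i l B]] mult_mono ennreal_leI le_q)
         (auto simp: q_def)
  qed
  also have "\<dots> = ennreal (real (card S) * (q * (real n * q) ^ j))"
    using q0 by (simp add: ennreal_mult ennreal_of_nat_eq_real_of_nat)
  also have "\<dots> \<le> ennreal (real n * (q * (real n * q) ^ j))"
    using cS q0 by (intro ennreal_leI mult_right_mono) auto
  finally show ?case by (simp add: q_def mult_ac)
qed

section \<open>Nets\<close>

text \<open>A two-sided geometric series with ratio \<open>q = exp (- 1 / X)\<close>; one side sums
  to at most \<open>q / (1 - q) = 1 / (exp (1 / X) - 1)\<close>, which is at most
  \<open>X\<close>.\<close>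

lemma sum_exp_neg_abs_le:
  assumes X: "0 < X"
  shows "(\<Sum>z\<in>{- int N..int N}. exp (- \<bar>real_of_int z\<bar> / X)) \<le> 1 + 2 * X"
proof -
  define q where "q = exp (- 1 / X)"
  have q: "0 < q" "q < 1" using X by (auto simp: q_def)
  have "1 + 1 / X \<le> exp (1 / X)" by (rule exp_ge_add_one_self)
  hence "q * (1 + 1 / X) \<le> q * exp (1 / X)" using q by (intro mult_left_mono) auto
  also have "q * exp (1 / X) = 1" by (simp add: q_def exp_minus)
  finally have "q * (X + 1) \<le> X" using X by (simp add: field_simps)
  hence qX: "q / (1 - q) \<le> X" using q by (simp add: field_simps)
  have "(\<Sum>z\<in>{- int N..int N}. exp (- \<bar>real_of_int z\<bar> / X)) \<le> 1 + 2 * (\<Sum>i<N. q ^ Suc i)"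
  proof (induction N)
    case (Suc N)
    have "{- int (Suc N)..int (Suc N)} = insert (int (Suc N)) (insert (- int (Suc N)) {- int N..int N})"
      by auto
    hence "(\<Sum>z\<in>{- int (Suc N)..int (Suc N)}. exp (- \<bar>real_of_int z\<bar> / X))
        = exp (- real (Suc N) / X) + (exp (- real (Suc N) / X)
          + (\<Sum>z\<in>{- int N..int N}. exp (- \<bar>real_of_int z\<bar> / X)))"
      by (simp add: add_divide_distrib diff_divide_distrib)
    also have "exp (- real (Suc N) / X) = q ^ Suc N"
      unfolding q_def exp_of_nat_mult[symmetric] by (simp del: of_nat_Suc)
    finally show ?case using Suc.IH by simp
  qed simp
  also have "(\<Sum>i<N. q ^ Suc i) \<le> q / (1 - q)"
  proof -
    have "(\<Sum>i<N. q ^ Suc i) = q * (\<Sum>i<N. q ^ i)" by (simp add: sum_distrib_left)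
    also have "\<dots> \<le> q * (1 / (1 - q))"
    proof (intro mult_left_mono)
      have "(\<Sum>i<N. q ^ i) = (1 - q ^ N) / (1 - q)" using q by (subst sum_gp_strict) auto
      also have "\<dots> \<le> 1 / (1 - q)" using q by (intro divide_right_mono) auto
      finally show "(\<Sum>i<N. q ^ i) \<le> 1 / (1 - q)" .
    qed (use q in auto)
    finally show ?thesis by simp
  qed
  finally show ?thesis using qX by linarith
qed

text \<open>Counting with the weight \<open>exp (- |z| / X)\<close> avoids any volume computation.\<close>
lemma card_integer_points_le:
  fixes J :: "'a set"
  assumes fin: "finite J" and X: "0 < X"
  defines "Z \<equiv> {z \<in> J \<rightarrow>\<^sub>E (UNIV :: int set). (\<Sum>i\<in>J. (real_of_int (z i))\<^sup>2) \<le> real (card J) * X\<^sup>2}"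
  shows "finite Z" "real (card Z) \<le> (exp 1 * (1 + 2 * X)) ^ card J"
proof -
  \<comment> \<open>\<open>N\<close> only provides a finite box for the summation; it is absent from
    the final count because the one-dimensional sums are bounded uniformly in it.\<close>
  obtain N :: nat where N: "real (card J) * X\<^sup>2 \<le> real N" using real_arch_simple by blast
  have box: "z i \<in> {- int N..int N}" if z: "z \<in> Z" and i: "i \<in> J" for z i
  proof -
    have "(real_of_int (z i))\<^sup>2 \<le> (\<Sum>i\<in>J. (real_of_int (z i))\<^sup>2)"
      using fin i by (intro member_le_sum) auto
    hence "(real_of_int (z i))\<^sup>2 \<le> real N" using z N by (auto simp: Z_def)
    hence sq: "(z i)\<^sup>2 \<le> int N" by (metis of_int_of_nat_eq of_int_le_iff of_int_power)
    have "\<bar>z i\<bar> * 1 \<le> \<bar>z i\<bar> * \<bar>z i\<bar>"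
    proof (cases "z i = 0")
      case False
      thus ?thesis by (intro mult_left_mono) auto
    qed simp
    hence "\<bar>z i\<bar> \<le> (z i)\<^sup>2" by (simp add: power2_eq_square)
    thus ?thesis using sq by auto
  qed
  have sub: "Z \<subseteq> J \<rightarrow>\<^sub>E {- int N..int N}" using box by (auto simp: Z_def PiE_iff extensional_def)
  have finB: "finite (J \<rightarrow>\<^sub>E {- int N..int N})" by (intro finite_PiE fin) auto
  show finZ: "finite Z" by (rule finite_subset[OF sub finB])
  \<comment> \<open>By Cauchy-Schwarz the ball lies in the \<open>l1\<close> ball of radius
    \<open>card J * X\<close>, on which the weight is at least
    \<open>exp (- card J)\<close>.\<close>
  have w: "exp (- real (card J)) \<le> (\<Prod>i\<in>J. exp (- \<bar>real_of_int (z i)\<bar> / X))" if z: "z \<in> Z" for z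
  proof -
    have "(\<Sum>i\<in>J. \<bar>real_of_int (z i)\<bar> * \<bar>1\<bar>) \<le> L2_set (\<lambda>i. real_of_int (z i)) J * L2_set (\<lambda>i. 1) J"
      by (rule L2_set_mult_ineq)
    also have "\<dots> \<le> sqrt (real (card J) * X\<^sup>2) * sqrt (real (card J))"
      using z by (auto simp: L2_set_def Z_def intro!: mult_right_mono)
    also have "\<dots> = real (card J) * X" using X by (simp add: real_sqrt_mult)
    finally have "(\<Sum>i\<in>J. \<bar>real_of_int (z i)\<bar>) / X \<le> real (card J)"
      using X by (simp add: pos_divide_le_eq)
    hence "exp (- real (card J)) \<le> exp (- ((\<Sum>i\<in>J. \<bar>real_of_int (z i)\<bar>) / X))" by simp
    also have "\<dots> = (\<Prod>i\<in>J. exp (- \<bar>real_of_int (z i)\<bar> / X))"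
      using fin by (simp add: exp_sum[symmetric] sum_negf sum_divide_distrib)
    finally show ?thesis .
  qed
  have "real (card Z) * exp (- real (card J)) = (\<Sum>z\<in>Z. exp (- real (card J)))" by simp
  also have "\<dots> \<le> (\<Sum>z\<in>Z. \<Prod>i\<in>J. exp (- \<bar>real_of_int (z i)\<bar> / X))" by (intro sum_mono w)
  also have "\<dots> \<le> (\<Sum>z\<in>J \<rightarrow>\<^sub>E {- int N..int N}. \<Prod>i\<in>J. exp (- \<bar>real_of_int (z i)\<bar> / X))"
    using finB sub by (intro sum_mono2 prod_nonneg) auto
  also have "\<dots> = (\<Prod>i\<in>J. \<Sum>z\<in>{- int N..int N}. exp (- \<bar>real_of_int z\<bar> / X))"
    by (rule prod_sum_PiE[symmetric]) (auto simp: fin)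
  also have "\<dots> \<le> (\<Prod>i\<in>J. 1 + 2 * X)"
    using sum_exp_neg_abs_le[OF X] by (intro prod_mono) (auto intro!: sum_nonneg)
  also have "\<dots> = (1 + 2 * X) ^ card J" by simp
  finally have "real (card Z) * exp (- real (card J)) \<le> (1 + 2 * X) ^ card J" .
  hence "real (card Z) \<le> (1 + 2 * X) ^ card J * exp (real (card J))"
    by (simp add: exp_minus field_simps)
  also have "exp (real (card J)) = exp 1 ^ card J" by (metis exp_of_nat_mult mult.right_neutral)
  finally show "real (card Z) \<le> (exp 1 * (1 + 2 * X)) ^ card J"
    by (simp add: power_mult_distrib mult.commute)
qed

text \<open>Rounding to the grid of mesh \<open>s / sqrt (card J)\<close> moves a point by at most
  \<open>s\<close>. The rounded points lie in the ball of radius \<open>\<rho> + s\<close>, whence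
  the summand 1 in \<open>X\<close>, and are counted as integer points.\<close>

lemma ball_net:
  fixes J :: "'a set"
  assumes fin: "finite J" and s: "0 < s" and \<rho>: "0 \<le> \<rho>"
  shows "\<exists>F. finite F \<and> real (card F) \<le> (exp 1 * (3 + 2 * \<rho> / s)) ^ card J
    \<and> (\<forall>c :: 'a \<Rightarrow> real. (\<Sum>i\<in>J. (c i)\<^sup>2) \<le> \<rho>\<^sup>2 \<longrightarrow> (\<exists>f\<in>F. (\<Sum>i\<in>J. (c i - f i)\<^sup>2) \<le> s\<^sup>2))"
proof (cases "J = {}")
  case True
  thus ?thesis by (intro exI[of _ "{\<lambda>_. 0}"]) auto
next
  case False
  define N where "N = real (card J)"
  have N: "0 < N" using fin False by (simp add: N_def card_gt_0_iff)
  define X where "X = \<rho> / s + 1"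
  have X: "0 < X" using s \<rho> by (simp add: X_def add_nonneg_pos)
  define \<theta> where "\<theta> = s / sqrt N"
  have \<theta>: "0 < \<theta>" using s N by (simp add: \<theta>_def)
  define Z where "Z = {z \<in> J \<rightarrow>\<^sub>E (UNIV :: int set). (\<Sum>i\<in>J. (real_of_int (z i))\<^sup>2) \<le> N * X\<^sup>2}"
  have Z: "finite Z" "real (card Z) \<le> (exp 1 * (1 + 2 * X)) ^ card J"
    using card_integer_points_le[OF fin X] by (simp_all add: Z_def N_def)
  define F where "F = (\<lambda>z i. \<theta> * real_of_int (z i)) ` Z"
  have "real (card F) \<le> real (card Z)" unfolding F_def using card_image_le[OF Z(1)] by simp
  also note Z(2)
  also have "1 + 2 * X = 3 + 2 * \<rho> / s" by (simp add: X_def)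
  finally have cF: "real (card F) \<le> (exp 1 * (3 + 2 * \<rho> / s)) ^ card J" .
  have "\<exists>f\<in>F. (\<Sum>i\<in>J. (c i - f i)\<^sup>2) \<le> s\<^sup>2" if c: "(\<Sum>i\<in>J. (c i)\<^sup>2) \<le> \<rho>\<^sup>2" for c :: "'a \<Rightarrow> real"
  proof -
    define z where "z = restrict (\<lambda>i. \<lfloor>c i / \<theta>\<rfloor>) J"
    have fl: "\<bar>c i / \<theta> - real_of_int (z i)\<bar> \<le> 1" if "i \<in> J" for i
      using that by (simp add: z_def) linarith
    have err: "\<bar>c i - \<theta> * real_of_int (z i)\<bar> \<le> \<theta>" if "i \<in> J" for i
    proof -
      have "\<bar>c i - \<theta> * real_of_int (z i)\<bar> = \<theta> * \<bar>c i / \<theta> - real_of_int (z i)\<bar>"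
      proof -
        have "c i - \<theta> * real_of_int (z i) = \<theta> * (c i / \<theta> - real_of_int (z i))"
          using \<theta> by (simp add: right_diff_distrib)
        thus ?thesis using \<theta> by (simp only: abs_mult abs_of_pos)
      qed
      also have "\<dots> \<le> \<theta> * 1" using fl[OF that] \<theta> by (intro mult_left_mono) auto
      finally show ?thesis by simp
    qed
    have "L2_set (\<lambda>i. real_of_int (z i)) J \<le> L2_set (\<lambda>i. c i / \<theta> + (real_of_int (z i) - c i / \<theta>)) J"
      by simp
    also have "\<dots> \<le> L2_set (\<lambda>i. c i / \<theta>) J + L2_set (\<lambda>i. real_of_int (z i) - c i / \<theta>) J"
      by (rule L2_set_triangle_ineq)
    also have "L2_set (\<lambda>i. c i / \<theta>) J \<le> \<rho> / \<theta>"
    proof -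
      have "(\<Sum>i\<in>J. (c i / \<theta>)\<^sup>2) = (\<Sum>i\<in>J. (c i)\<^sup>2) / \<theta>\<^sup>2" by (simp add: power_divide sum_divide_distrib)
      also have "\<dots> \<le> \<rho>\<^sup>2 / \<theta>\<^sup>2" using c by (intro divide_right_mono) auto
      finally show ?thesis unfolding L2_set_def
        using \<rho> \<theta> by (intro real_le_lsqrt) (auto simp: power_divide sum_nonneg)
    qed
    also have "L2_set (\<lambda>i. real_of_int (z i) - c i / \<theta>) J \<le> sqrt N"
    proof -
      have "(real_of_int (z i) - c i / \<theta>)\<^sup>2 \<le> 1" if "i \<in> J" for i
        using fl[OF that] by (simp add: abs_minus_commute abs_square_le_1)
      hence "(\<Sum>i\<in>J. (real_of_int (z i) - c i / \<theta>)\<^sup>2) \<le> (\<Sum>i\<in>J. 1)" by (intro sum_mono)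
      thus ?thesis by (simp add: L2_set_def N_def)
    qed
    also have "\<rho> / \<theta> + sqrt N = sqrt N * X" using N s by (simp add: \<theta>_def X_def field_simps)
    finally have L: "L2_set (\<lambda>i. real_of_int (z i)) J \<le> sqrt N * X" by simp
    have "(\<Sum>i\<in>J. (real_of_int (z i))\<^sup>2) = (L2_set (\<lambda>i. real_of_int (z i)) J)\<^sup>2"
      by (simp add: L2_set_def sum_nonneg)
    also have "\<dots> \<le> (sqrt N * X)\<^sup>2" using L by (intro power_mono) auto
    also have "\<dots> = N * X\<^sup>2" using N by (simp add: power_mult_distrib)
    finally have "z \<in> Z" by (simp add: Z_def z_def)
    moreover have "(\<Sum>i\<in>J. (c i - \<theta> * real_of_int (z i))\<^sup>2) \<le> (\<Sum>i\<in>J. \<theta>\<^sup>2)"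
      using err \<theta> by (intro sum_mono) (simp add: abs_le_square_iff[symmetric])
    hence "(\<Sum>i\<in>J. (c i - \<theta> * real_of_int (z i))\<^sup>2) \<le> s\<^sup>2"
      using N by (simp add: \<theta>_def N_def[symmetric] power_divide)
    moreover from \<open>z \<in> Z\<close> have "(\<lambda>i. \<theta> * real_of_int (z i)) \<in> F" by (auto simp: F_def)
    ultimately show ?thesis by (intro bexI[of _ "\<lambda>i. \<theta> * real_of_int (z i)"])
  qed
  thus ?thesis using cF Z(1) by (intro exI[of _ F]) (auto simp: F_def)
qed

section \<open>Operator norm of a Wigner matrix\<close>

lemma smulv_scale: "smulv S M (\<lambda>i. c * x i) = (\<lambda>i. c * smulv S M x i)"
  by (simp add: smulv_def sum_distrib_left mult_ac)

lemma smulv_diff: "smulv S M (\<lambda>i. x i - y i) = (\<lambda>i. smulv S M x i - smulv S M y i)"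
  by (simp add: smulv_def right_diff_distrib sum_subtractf)

text \<open>There are two passages to the net, one for \<open>y\<close> and one for
  \<open>x\<close>; each has mesh \<open>1 / 2\<close> and loses a factor 2.\<close>

lemma opnorm_le_net:
  assumes fin: "finite I" and u: "0 \<le> u"
    and net: "\<And>x. cnm I x \<le> 1 \<Longrightarrow> \<exists>x'\<in>F. cnm I (\<lambda>i. x i - x' i) \<le> 1 / 2"
    and F: "\<And>x y. x \<in> F \<Longrightarrow> y \<in> F \<Longrightarrow> Re (cip I y (smulv I W x)) \<le> u"
  shows "cnm I (smulv I W x) \<le> 4 * u * cnm I x"
proof -
  have stepA: "cnm I (smulv I W x) \<le> 2 * u" if x: "x \<in> F" for x
  proof (cases "cnm I (smulv I W x) = 0")
    case True
    thus ?thesis using u by simp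
  next
    case False
    define z where "z = smulv I W x"
    define N where "N = cnm I z"
    have N: "0 < N" using False by (simp add: N_def z_def less_le)
    define y where "y i = complex_of_real (1 / N) * z i" for i
    have "cnm I y = 1" unfolding y_def cnm_scale N_def[symmetric] using N by (simp add: norm_divide)
    then obtain y' where y': "y' \<in> F" "cnm I (\<lambda>i. y i - y' i) \<le> 1 / 2" using net[of y] by auto
    have "cip I y z = complex_of_real N"
    proof -
      have "cip I y z = cnj (complex_of_real (1 / N)) * cip I z z"
        unfolding y_def by (rule cip_scale_left)
      also have "\<dots> = complex_of_real (1 / N * N\<^sup>2)" unfolding cip_self N_def[symmetric] by simp
      also have "1 / N * N\<^sup>2 = N" using N by (simp add: power2_eq_square)
      finally show ?thesis .
    qed
    hence "N = Re (cip I y' z) + Re (cip I (\<lambda>i. y i - y' i) z)" by (simp add: cip_diff_left)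
    also have "Re (cip I y' z) \<le> u" unfolding z_def by (rule F[OF x y'(1)])
    also have "Re (cip I (\<lambda>i. y i - y' i) z) \<le> 1 / 2 * N"
    proof -
      have "Re (cip I (\<lambda>i. y i - y' i) z) \<le> cmod (cip I (\<lambda>i. y i - y' i) z)" by (rule complex_Re_le_cmod)
      also have "\<dots> \<le> cnm I (\<lambda>i. y i - y' i) * N" unfolding N_def by (rule cip_Cauchy_Schwarz)
      also have "\<dots> \<le> 1 / 2 * N" using y'(2) N by (intro mult_right_mono) auto
      finally show ?thesis .
    qed
    finally show ?thesis by (simp add: N_def z_def)
  qed
  define T where "T = {x. cnm I x \<le> 1}"
  define s where "s = (SUP x\<in>T. cnm I (smulv I W x))"
  \<comment> \<open>A crude bound on the entries makes \<open>s\<close> a finite supremum; only then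
    can \<open>s / 2\<close> be absorbed in \<open>s \<le> 2 * u + s / 2\<close>.\<close>
  define \<tau> where "\<tau> = (\<Sum>i\<in>I. \<Sum>j\<in>I. cmod (W i j))"
  have \<tau>: "cmod (W i j) \<le> \<tau>" if "i \<in> I" "j \<in> I" for i j
  proof -
    have "cmod (W i j) \<le> (\<Sum>j\<in>I. cmod (W i j))" using fin that by (intro member_le_sum) auto
    also have "\<dots> \<le> \<tau>" unfolding \<tau>_def using fin that by (intro member_le_sum[of i I "\<lambda>i. \<Sum>j\<in>I. cmod (W i j)"]) (auto intro: sum_nonneg)
    finally show ?thesis .
  qed
  have \<tau>0: "0 \<le> \<tau>" unfolding \<tau>_def by (intro sum_nonneg) auto
  have Wb: "cnm I (smulv I W x) \<le> real (card I) * real (card I) * \<tau> * cnm I x" for x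
    using fin \<tau> by (rule cnm_smulv_le)
  have bdd: "bdd_above ((\<lambda>x. cnm I (smulv I W x)) ` T)"
  proof (rule bdd_aboveI2)
    fix x assume "x \<in> T"
    hence "real (card I) * real (card I) * \<tau> * cnm I x \<le> real (card I) * real (card I) * \<tau> * 1"
      using \<tau>0 by (intro mult_left_mono) (auto simp: T_def)
    thus "cnm I (smulv I W x) \<le> real (card I) * real (card I) * \<tau> * 1"
      using Wb[of x] by linarith
  qed
  have le_s: "cnm I (smulv I W x) \<le> s" if "cnm I x \<le> 1" for x
    unfolding s_def using that by (intro cSUP_upper bdd) (auto simp: T_def)
  have "s \<le> 2 * u + s / 2" unfolding s_def
  proof (rule cSUP_least, goal_cases)
    case 1
    have "(\<lambda>_. 0) \<in> T" by (simp add: T_def)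
    thus ?case by blast
  next
    case (2 x)
    then obtain x' where x': "x' \<in> F" "cnm I (\<lambda>i. x i - x' i) \<le> 1 / 2" using net by (auto simp: T_def)
    have "cnm I (smulv I W (\<lambda>i. 2 * (x i - x' i))) \<le> s"
      using x'(2) by (intro le_s, subst cnm_scale) simp
    hence "cnm I (smulv I W (\<lambda>i. x i - x' i)) \<le> s / 2" unfolding smulv_scale cnm_scale by simp
    moreover have "cnm I (smulv I W x) \<le> cnm I (smulv I W x') + cnm I (smulv I W (\<lambda>i. x i - x' i))"
      using cnm_triangle[of I "smulv I W x'" "smulv I W (\<lambda>i. x i - x' i)"] by (simp add: smulv_diff)
    ultimately show ?case using stepA[OF x'(1)] by (simp add: s_def)
  qed
  hence s4: "s \<le> 4 * u" by simp
  show ?thesis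
  proof (cases "cnm I x = 0")
    case True
    thus ?thesis using Wb[of x] cnm_nonneg[of I "smulv I W x"] by simp
  next
    case False
    define N where "N = cnm I x"
    have N: "0 < N" using False by (simp add: N_def less_le)
    have "cnm I (\<lambda>i. complex_of_real (1 / N) * x i) \<le> 1"
      unfolding cnm_scale N_def[symmetric] using N by (simp add: norm_divide)
    hence "cnm I (smulv I W (\<lambda>i. complex_of_real (1 / N) * x i)) \<le> 4 * u"
      by (rule order_trans[OF le_s s4])
    hence "1 / N * cnm I (smulv I W x) \<le> 4 * u"
      unfolding smulv_scale cnm_scale using N by (simp add: norm_divide)
    thus ?thesis using N by (simp add: N_def[symmetric] field_simps)
  qed
qed

section \<open>Bilinear forms of the Wigner matrix and the union bound\<close>

definition wig_coeff :: "bool \<Rightarrow> real \<Rightarrow> bool \<Rightarrow> complex" where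
  "wig_coeff rc \<sigma> t = (if rc then (if t then 0 else complex_of_real \<sigma>)
     else complex_of_real (\<sigma> / sqrt 2) * (if t then \<i> else 1))"

lemma wig_coeff_sq: "(\<Sum>t\<in>UNIV. (cmod (wig_coeff rc \<sigma> t))\<^sup>2) = \<sigma>\<^sup>2"
  by (simp add: UNIV_bool wig_coeff_def norm_mult norm_divide power_mult_distrib power_divide)

lemma sum_wig_index:
  "(\<Sum>c\<in>wig_index n. f c) = (\<Sum>i<n. \<Sum>j<n. \<Sum>t\<in>UNIV. f ((i, j), t))" for f :: "_ \<Rightarrow> 'a :: comm_monoid_add"
proof -
  have "(\<Sum>c\<in>wig_index n. f c) = (\<Sum>p\<in>{..<n} \<times> {..<n}. \<Sum>t\<in>UNIV. f (p, t))"
    unfolding sum.cartesian_product by simp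
  also have "\<dots> = (\<Sum>i<n. \<Sum>j<n. \<Sum>t\<in>UNIV. f ((i, j), t))"
    by (subst sum.cartesian_product) (simp add: case_prod_beta)
  finally show ?thesis .
qed

text \<open>The form is real linear in the independent coordinates. A coordinate off the diagonal
  enters through two mirrored entries, and
  \<open>(p + q)\<^sup>2 \<le> 2 * p\<^sup>2 + 2 * q\<^sup>2\<close> turns this into the factor
  4.\<close>

lemma wigner_bilinear_form:
  "\<exists>a. (\<forall>\<omega>. Re (cip {..<n} y (smulv {..<n} (wigner rc n \<sigma> \<omega>) x)) = (\<Sum>c\<in>wig_index n. a c * \<omega> c))
     \<and> (\<Sum>c\<in>wig_index n. (a c)\<^sup>2) \<le> 4 * \<sigma>\<^sup>2 * (cnm {..<n} x)\<^sup>2 * (cnm {..<n} y)\<^sup>2"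
proof -
  \<comment> \<open>\<open>U\<close> covers the upper triangle with the diagonal, \<open>L\<close>
    only the strict one, so that the diagonal is not counted twice when the lower triangle is added
    as the conjugate of \<open>L\<close>.\<close>
  define U where "U i j t = (if i < j then wig_coeff rc \<sigma> t else if i = j \<and> \<not> t then complex_of_real \<sigma> else 0)" for i j :: nat and t
  define L where "L i j t = (if i < j then wig_coeff rc \<sigma> t else 0)" for i j :: nat and t
  define A where "A i j t = cnj (y i) * U i j t * x j + cnj (y j) * cnj (L i j t) * x i" for i j t
  define a where "a = (\<lambda>((i, j), t). Re (A i j t))"
  have W: "wigner rc n \<sigma> \<omega> i j = (\<Sum>t\<in>UNIV. U i j t * complex_of_real (\<omega> ((i, j), t)))
      + (\<Sum>t\<in>UNIV. cnj (L j i t) * complex_of_real (\<omega> ((j, i), t)))" if "i < n" "j < n" for i j \<omega>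
    using that by (auto simp: wigner_def wig_entry_def U_def L_def wig_coeff_def UNIV_bool algebra_simps)
  have lin: "Re (cip {..<n} y (smulv {..<n} (wigner rc n \<sigma> \<omega>) x)) = (\<Sum>c\<in>wig_index n. a c * \<omega> c)" for \<omega>
  proof -
    have "cip {..<n} y (smulv {..<n} (wigner rc n \<sigma> \<omega>) x)
        = (\<Sum>i<n. \<Sum>j<n. \<Sum>t\<in>UNIV. cnj (y i) * U i j t * x j * complex_of_real (\<omega> ((i, j), t)))
        + (\<Sum>i<n. \<Sum>j<n. \<Sum>t\<in>UNIV. cnj (y i) * cnj (L j i t) * x j * complex_of_real (\<omega> ((j, i), t)))"
      unfolding cip_def smulv_def
      by (simp add: W sum_distrib_left sum_distrib_right distrib_left distrib_right sum.distrib mult_ac)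
    also have "(\<Sum>i<n. \<Sum>j<n. \<Sum>t\<in>UNIV. cnj (y i) * cnj (L j i t) * x j * complex_of_real (\<omega> ((j, i), t)))
        = (\<Sum>i<n. \<Sum>j<n. \<Sum>t\<in>UNIV. cnj (y j) * cnj (L i j t) * x i * complex_of_real (\<omega> ((i, j), t)))"
      by (rule sum.swap)
    finally have "cip {..<n} y (smulv {..<n} (wigner rc n \<sigma> \<omega>) x)
        = (\<Sum>i<n. \<Sum>j<n. \<Sum>t\<in>UNIV. A i j t * complex_of_real (\<omega> ((i, j), t)))"
      by (simp add: A_def sum.distrib[symmetric] distrib_right)
    hence "Re (cip {..<n} y (smulv {..<n} (wigner rc n \<sigma> \<omega>) x))
        = (\<Sum>i<n. \<Sum>j<n. \<Sum>t\<in>UNIV. a ((i, j), t) * \<omega> ((i, j), t))"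
      by (simp add: a_def)
    thus ?thesis by (simp only: sum_wig_index)
  qed
  have sq: "(a ((i, j), t))\<^sup>2 \<le> 2 * ((cmod (U i j t))\<^sup>2 * ((cmod (y i))\<^sup>2 * (cmod (x j))\<^sup>2))
      + 2 * ((cmod (L i j t))\<^sup>2 * ((cmod (y j))\<^sup>2 * (cmod (x i))\<^sup>2))" for i j t
  proof -
    have "\<bar>a ((i, j), t)\<bar> \<le> cmod (A i j t)" by (simp add: a_def abs_Re_le_cmod)
    also have "\<dots> \<le> cmod (y i) * cmod (U i j t) * cmod (x j) + cmod (y j) * cmod (L i j t) * cmod (x i)"
      unfolding A_def by (rule order_trans[OF norm_triangle_ineq]) (simp add: norm_mult)
    finally have "(a ((i, j), t))\<^sup>2 \<le> (cmod (y i) * cmod (U i j t) * cmod (x j) + cmod (y j) * cmod (L i j t) * cmod (x i))\<^sup>2"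
      by (metis abs_le_square_iff abs_ge_zero abs_of_nonneg order_trans power2_abs)
    also have "\<dots> \<le> 2 * (cmod (y i) * cmod (U i j t) * cmod (x j))\<^sup>2 + 2 * (cmod (y j) * cmod (L i j t) * cmod (x i))\<^sup>2"
      using sum_squares_bound[of "cmod (y i) * cmod (U i j t) * cmod (x j)" "cmod (y j) * cmod (L i j t) * cmod (x i)"]
      by (simp add: power2_sum)
    finally show ?thesis by (simp add: power_mult_distrib mult_ac)
  qed
  have sumU: "(\<Sum>t\<in>UNIV. (cmod (U i j t))\<^sup>2) \<le> \<sigma>\<^sup>2" for i j
    using wig_coeff_sq[of rc \<sigma>] by (auto simp: U_def UNIV_bool)
  have sumL: "(\<Sum>t\<in>UNIV. (cmod (L i j t))\<^sup>2) \<le> \<sigma>\<^sup>2" for i j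
    using wig_coeff_sq[of rc \<sigma>] by (auto simp: L_def UNIV_bool)
  have "(\<Sum>c\<in>wig_index n. (a c)\<^sup>2) = (\<Sum>i<n. \<Sum>j<n. \<Sum>t\<in>UNIV. (a ((i, j), t))\<^sup>2)"
    by (rule sum_wig_index)
  also have "\<dots> \<le> (\<Sum>i<n. \<Sum>j<n. 2 * \<sigma>\<^sup>2 * ((cmod (y i))\<^sup>2 * (cmod (x j))\<^sup>2) + 2 * \<sigma>\<^sup>2 * ((cmod (y j))\<^sup>2 * (cmod (x i))\<^sup>2))"
  proof (intro sum_mono)
    fix i j
    have "(\<Sum>t\<in>UNIV. (a ((i, j), t))\<^sup>2) \<le> (\<Sum>t\<in>UNIV. 2 * ((cmod (U i j t))\<^sup>2 * ((cmod (y i))\<^sup>2 * (cmod (x j))\<^sup>2))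
      + 2 * ((cmod (L i j t))\<^sup>2 * ((cmod (y j))\<^sup>2 * (cmod (x i))\<^sup>2)))"
      by (intro sum_mono sq)
    also have "\<dots> = 2 * ((\<Sum>t\<in>UNIV. (cmod (U i j t))\<^sup>2) * ((cmod (y i))\<^sup>2 * (cmod (x j))\<^sup>2))
      + 2 * ((\<Sum>t\<in>UNIV. (cmod (L i j t))\<^sup>2) * ((cmod (y j))\<^sup>2 * (cmod (x i))\<^sup>2))"
      by (simp add: sum.distrib sum_distrib_left sum_distrib_right)
    also have "\<dots> \<le> 2 * (\<sigma>\<^sup>2 * ((cmod (y i))\<^sup>2 * (cmod (x j))\<^sup>2)) + 2 * (\<sigma>\<^sup>2 * ((cmod (y j))\<^sup>2 * (cmod (x i))\<^sup>2))"
      by (intro add_mono mult_left_mono mult_right_mono sumU sumL) auto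
    finally show "(\<Sum>t\<in>UNIV. (a ((i, j), t))\<^sup>2) \<le> 2 * \<sigma>\<^sup>2 * ((cmod (y i))\<^sup>2 * (cmod (x j))\<^sup>2)
      + 2 * \<sigma>\<^sup>2 * ((cmod (y j))\<^sup>2 * (cmod (x i))\<^sup>2)" by (simp add: mult_ac)
  qed
  also have "\<dots> = 2 * \<sigma>\<^sup>2 * (\<Sum>i<n. \<Sum>j<n. (cmod (y i))\<^sup>2 * (cmod (x j))\<^sup>2)
      + 2 * \<sigma>\<^sup>2 * (\<Sum>i<n. \<Sum>j<n. (cmod (y j))\<^sup>2 * (cmod (x i))\<^sup>2)"
    by (simp add: sum.distrib sum_distrib_left)
  also have "\<dots> = 4 * \<sigma>\<^sup>2 * (cnm {..<n} x)\<^sup>2 * (cnm {..<n} y)\<^sup>2"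
  proof -
    have 1: "(\<Sum>i<n. \<Sum>j<n. (cmod (y i))\<^sup>2 * (cmod (x j))\<^sup>2) = (cnm {..<n} y)\<^sup>2 * (cnm {..<n} x)\<^sup>2"
      unfolding cnm_sq sum_product ..
    have 2: "(\<Sum>i<n. \<Sum>j<n. (cmod (y j))\<^sup>2 * (cmod (x i))\<^sup>2) = (cnm {..<n} x)\<^sup>2 * (cnm {..<n} y)\<^sup>2"
      unfolding cnm_sq sum_product by (simp only: mult.commute)
    show ?thesis unfolding 1 2 by simp
  qed
  finally show ?thesis using lin by blast
qed


text \<open>A union bound: at most \<open>exp (28 * n)\<close> pairs of net points against tails of
  \<open>exp (- 60 * n)\<close>. The factor 200 is the 4 of \<open>opnorm_le_net\<close> times the
  50 in \<open>u\<close>. The net is complex, coming from real dimension \<open>2 * n\<close>, for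
  both scalar fields.\<close>

lemma prob_wigner_opnorm:
  assumes n: "1 \<le> n" and \<sigma>: "0 < \<sigma>"
  shows "\<exists>A\<in>sets (wig_space n). measure (wig_space n) A \<le> exp (- real n / 2)
    \<and> (\<forall>\<omega>\<in>space (wig_space n) - A. \<forall>x.
        cnm {..<n} (smulv {..<n} (wigner rc n \<sigma> \<omega>) x) \<le> 200 * \<sigma> * sqrt (real n) * cnm {..<n} x)"
proof -
  interpret prob_space "wig_space n" unfolding wig_space_gauss by (rule prob_space_gauss)
  define J :: "(nat \<times> bool) set" where "J = {..<n} \<times> UNIV"
  have J: "finite J" "card J = 2 * n" by (simp_all add: J_def)
  obtain F0 where F0: "finite F0" "real (card F0) \<le> (exp 1 * (3 + 2 * 1 / (1/2))) ^ card J"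
    "\<forall>c :: nat \<times> bool \<Rightarrow> real. (\<Sum>i\<in>J. (c i)\<^sup>2) \<le> 1\<^sup>2 \<longrightarrow> (\<exists>f\<in>F0. (\<Sum>i\<in>J. (c i - f i)\<^sup>2) \<le> (1/2)\<^sup>2)"
  proof -
    have "0 < (1 / 2 :: real)" "0 \<le> (1 :: real)" by simp_all
    from ball_net[OF J(1) this] show ?thesis using that by blast
  qed
  define vec where "vec f i = Complex (f (i, False)) (f (i, True))" for f :: "nat \<times> bool \<Rightarrow> real" and i :: nat
  \<comment> \<open>Approximants of points of the unit ball have norm at most \<open>3 / 2\<close>,
    so discarding the others keeps the net property and bounds the variance.\<close>
  define F where "F = {x \<in> vec ` F0. cnm {..<n} x \<le> 3 / 2}"
  have finF: "finite F" using F0(1) by (simp add: F_def)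
  have "real (card F) \<le> real (card F0)"
  proof -
    have "card F \<le> card (vec ` F0)" using F0(1) by (intro card_mono) (auto simp: F_def)
    also have "\<dots> \<le> card F0" by (rule card_image_le[OF F0(1)])
    finally show ?thesis by simp
  qed
  hence cF: "real (card F) \<le> (7 * exp 1) ^ (2 * n)" using F0(2) by (simp add: J(2) mult.commute)
  have net: "\<exists>x'\<in>F. cnm {..<n} (\<lambda>i. x i - x' i) \<le> 1 / 2" if x: "cnm {..<n} x \<le> 1" for x
  proof -
    define c where "c = (\<lambda>(i, t). if t then Im (x i) else Re (x i))"
    have sumJ: "(\<Sum>p\<in>J. g p) = (\<Sum>i<n. g (i, False) + g (i, True))" for g :: "_ \<Rightarrow> real"
    proof -
      have "(\<Sum>p\<in>J. g p) = (\<Sum>i<n. \<Sum>t\<in>UNIV. g (i, t))"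
        unfolding J_def by (subst sum.cartesian_product) simp
      thus ?thesis by (simp add: UNIV_bool)
    qed
    have "(\<Sum>i\<in>J. (c i)\<^sup>2) = (cnm {..<n} x)\<^sup>2"
      unfolding sumJ cnm_sq by (simp add: c_def cmod_power2)
    also have "\<dots> \<le> 1\<^sup>2" using x by (intro power_mono) auto
    finally obtain f where f: "f \<in> F0" "(\<Sum>i\<in>J. (c i - f i)\<^sup>2) \<le> (1/2)\<^sup>2" using F0(3) by blast
    have "(\<Sum>i\<in>J. (c i - f i)\<^sup>2) = (cnm {..<n} (\<lambda>i. x i - vec f i))\<^sup>2"
      unfolding sumJ cnm_sq by (simp add: c_def cmod_power2 vec_def)
    hence d: "cnm {..<n} (\<lambda>i. x i - vec f i) \<le> 1 / 2"
      using f(2) power2_le_imp_le[of "cnm {..<n} (\<lambda>i. x i - vec f i)" "1 / 2"] by simp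
    have "cnm {..<n} (vec f) \<le> cnm {..<n} x + cnm {..<n} (\<lambda>i. x i - vec f i)"
      using cnm_triangle_diff[of "{..<n}" x "\<lambda>i. x i - vec f i"] by simp
    hence "vec f \<in> F" using f(1) d x by (simp add: F_def)
    thus ?thesis using d by blast
  qed
  define u where "u = 50 * \<sigma> * sqrt (real n)"
  define E where "E p = {\<omega> \<in> space (wig_space n). u < Re (cip {..<n} (fst p) (smulv {..<n} (wigner rc n \<sigma> \<omega>) (snd p)))}" for p
  have E: "E p \<in> sets (wig_space n) \<and> prob (E p) \<le> exp (- (60 * real n))" if p: "p \<in> F \<times> F" for p
  proof -
    obtain y x where [simp]: "p = (y, x)" by force
    have yx: "cnm {..<n} y \<le> 3 / 2" "cnm {..<n} x \<le> 3 / 2" using p by (auto simp: F_def)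
    obtain a where a: "\<And>\<omega>. Re (cip {..<n} y (smulv {..<n} (wigner rc n \<sigma> \<omega>) x)) = (\<Sum>c\<in>wig_index n. a c * \<omega> c)"
      "(\<Sum>c\<in>wig_index n. (a c)\<^sup>2) \<le> 4 * \<sigma>\<^sup>2 * (cnm {..<n} x)\<^sup>2 * (cnm {..<n} y)\<^sup>2"
      using wigner_bilinear_form[of n y rc \<sigma> x] by blast
    have Ep: "E p = {\<omega> \<in> space (gauss (wig_index n)). u < (\<Sum>c\<in>wig_index n. a c * \<omega> c)}"
      unfolding E_def by (simp add: a(1) wig_space_gauss)
    have "(\<lambda>\<omega>. \<Sum>c\<in>wig_index n. a c * \<omega> c) \<in> borel_measurable (gauss (wig_index n))"
      by (intro borel_measurable_sum borel_measurable_times) auto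
    hence m: "E p \<in> sets (wig_space n)" unfolding Ep wig_space_gauss by measurable
    have "(cnm {..<n} x)\<^sup>2 * (cnm {..<n} y)\<^sup>2 \<le> (3 / 2)\<^sup>2 * (3 / 2)\<^sup>2"
      using yx by (intro mult_mono power_mono) auto
    hence "4 * \<sigma>\<^sup>2 * ((cnm {..<n} x)\<^sup>2 * (cnm {..<n} y)\<^sup>2) \<le> 4 * \<sigma>\<^sup>2 * ((3 / 2)\<^sup>2 * (3 / 2)\<^sup>2)"
      by (intro mult_left_mono) auto
    \<comment> \<open>The constant is \<open>4 * (3 / 2) ^ 4 = 20.25\<close>, rounded up.\<close>
    also have "\<dots> \<le> 20.5 * \<sigma>\<^sup>2" by (simp add: power2_eq_square)
    finally have v: "(\<Sum>c\<in>wig_index n. (a c)\<^sup>2) \<le> 20.5 * \<sigma>\<^sup>2" using a(2) by (simp add: mult_ac)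
    have "prob (E p) \<le> exp (- (u\<^sup>2 / (2 * (20.5 * \<sigma>\<^sup>2))))"
      unfolding Ep wig_space_gauss using v \<sigma> by (intro gauss_linear_tail) (auto simp: u_def)
    also have "u\<^sup>2 / (2 * (20.5 * \<sigma>\<^sup>2)) = 2500 / 41 * real n"
      using \<sigma> by (simp add: u_def power_mult_distrib)
    also have "exp (- (2500 / 41 * real n)) \<le> exp (- (60 * real n))" by simp
    finally show ?thesis using m by simp
  qed
  define A where "A = (\<Union>p\<in>F \<times> F. E p)"
  have mA: "A \<in> sets (wig_space n)" unfolding A_def using finF E by (intro sets.finite_UN) auto
  have "prob A \<le> (\<Sum>p\<in>F \<times> F. prob (E p))"
    unfolding A_def using finF E by (intro finite_measure_subadditive_finite) auto
  also have "\<dots> \<le> (\<Sum>p\<in>F \<times> F. exp (- (60 * real n)))" using E by (intro sum_mono) auto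
  also have "\<dots> = real (card F) * real (card F) * exp (- (60 * real n))" by (simp add: card_cartesian_product)
  also have "\<dots> \<le> (7 * exp 1) ^ (2 * n) * (7 * exp 1) ^ (2 * n) * exp (- (60 * real n))"
    using cF by (intro mult_right_mono mult_mono) auto
  also have "\<dots> \<le> exp (14 * real n) * exp (14 * real n) * exp (- (60 * real n))"
  proof -
    have "(7::real) \<le> exp 6" using exp_ge_add_one_self[of 6] by simp
    hence "(7 * exp 1) \<le> exp 6 * exp (1::real)" by (intro mult_right_mono) auto
    hence "(7 * exp 1) \<le> exp (7::real)" by (simp flip: exp_add)
    hence "(7 * exp 1) ^ (2 * n) \<le> exp (7::real) ^ (2 * n)" by (intro power_mono) auto
    also have "\<dots> = exp (real (2 * n) * 7)" by (rule exp_of_nat_mult[symmetric])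
    also have "real (2 * n) * 7 = 14 * real n" by simp
    finally have P: "(7 * exp 1) ^ (2 * n) \<le> exp (14 * real n)" .
    show ?thesis by (intro mult_right_mono mult_mono P) auto
  qed
  also have "\<dots> = exp (- (32 * real n))" by (simp flip: exp_add)
  also have "\<dots> \<le> exp (- real n / 2)" by simp
  finally have pA: "prob A \<le> exp (- real n / 2)" .
  have op: "cnm {..<n} (smulv {..<n} (wigner rc n \<sigma> \<omega>) x) \<le> 200 * \<sigma> * sqrt (real n) * cnm {..<n} x"
    if \<omega>: "\<omega> \<in> space (wig_space n) - A" for \<omega> x
  proof -
    have "cnm {..<n} (smulv {..<n} (wigner rc n \<sigma> \<omega>) x) \<le> 4 * u * cnm {..<n} x"
    proof (rule opnorm_le_net[where F = F])
      show "Re (cip {..<n} y (smulv {..<n} (wigner rc n \<sigma> \<omega>) x)) \<le> u" if "x \<in> F" "y \<in> F" for x y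
      proof -
        have "\<omega> \<notin> E (y, x)" using \<omega> that unfolding A_def by blast
        thus ?thesis using \<omega> by (simp add: E_def not_less)
      qed
      show "0 \<le> u" using \<sigma> by (simp add: u_def)
      show "\<exists>x'\<in>F. cnm {..<n} (\<lambda>i. x i - x' i) \<le> 1 / 2" if "cnm {..<n} x \<le> 1" for x
        using that by (rule net)
    qed simp
    thus ?thesis by (simp add: u_def)
  qed
  show ?thesis
  proof (rule bexI[OF _ mA], intro conjI ballI allI)
    show "prob A \<le> exp (- real n / 2)" by (rule pA)
  qed (rule op)
qed

section \<open>Second order points\<close>

abbreviation mbox :: "nat \<Rightarrow> nat \<Rightarrow> (nat \<times> nat) set" where
  "mbox p q \<equiv> {..<p} \<times> {..<q}"

lemma minner_eq_cip: "minner p q A B = rip (mbox p q) (case_prod A) (case_prod B)"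
  by (simp add: minner_def cip_def sum.cartesian_product case_prod_beta)

lemma fnorm_eq_cnm: "fnorm p q A = cnm (mbox p q) (case_prod A)"
  by (simp add: fnorm_def minner_eq_cip rip_self)

lemma fnorm_nonneg [simp]: "0 \<le> fnorm p q A"
  by (simp add: fnorm_eq_cnm)

lemma minner_self: "minner p q A A = (fnorm p q A)\<^sup>2"
  by (simp add: minner_eq_cip fnorm_eq_cnm rip_self)

lemma minner_commute: "minner p q A B = minner p q B A"
  unfolding minner_eq_cip by (rule rip_commute)

lemma fnorm_sq: "(fnorm p q A)\<^sup>2 = (\<Sum>i<p. \<Sum>j<q. (cmod (A i j))\<^sup>2)"
  by (simp add: fnorm_eq_cnm cnm_sq sum.cartesian_product case_prod_beta)

lemma fnorm_sq_columns: "(fnorm p q A)\<^sup>2 = (\<Sum>j<q. (cnm {..<p} (\<lambda>i. A i j))\<^sup>2)"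
  unfolding fnorm_sq cnm_sq by (rule sum.swap)

lemma fnorm_sq_rows: "(fnorm p q A)\<^sup>2 = (\<Sum>i<p. (cnm {..<q} (A i))\<^sup>2)"
  unfolding fnorm_sq cnm_sq ..

lemma minner_add: "minner p q Z (\<lambda>i j. A i j + B i j) = minner p q Z A + minner p q Z B"
  and minner_diff: "minner p q Z (\<lambda>i j. A i j - B i j) = minner p q Z A - minner p q Z B"
  and minner_scale: "minner p q Z (\<lambda>i j. complex_of_real c * A i j) = c * minner p q Z A"
  by (simp_all add: minner_def algebra_simps sum.distrib sum_subtractf sum_distrib_left)

lemma minner_diff_left: "minner p q (\<lambda>i j. A i j - B i j) Z = minner p q A Z - minner p q B Z"
  using minner_diff[of p q Z A B] by (simp add: minner_commute)

lemma minner_sum: "minner p q Z (\<lambda>i j. \<Sum>l\<in>L. complex_of_real (c l) * A l i j) = (\<Sum>l\<in>L. c l * minner p q Z (A l))"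
proof -
  have "case_prod (\<lambda>i j. \<Sum>l\<in>L. complex_of_real (c l) * A l i j) = (\<lambda>p. \<Sum>l\<in>L. complex_of_real (c l) * case_prod (A l) p)"
    by (auto simp: fun_eq_iff)
  thus ?thesis unfolding minner_eq_cip by (simp only: rip_sum_right)
qed

lemma minner_Cauchy_Schwarz: "\<bar>minner p q A B\<bar> \<le> fnorm p q A * fnorm p q B"
  unfolding minner_eq_cip fnorm_eq_cnm
  by (rule order_trans[OF abs_Re_le_cmod cip_Cauchy_Schwarz])

lemma fnorm_scale: "fnorm p q (\<lambda>i j. c * A i j) = cmod c * fnorm p q A"
proof -
  have "case_prod (\<lambda>i j. c * A i j) = (\<lambda>p. c * case_prod A p)" by auto
  thus ?thesis unfolding fnorm_eq_cnm by (simp only: cnm_scale)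
qed

lemma fnorm_sum_le: "fnorm p q (\<lambda>i j. \<Sum>l\<in>L. c l * A l i j) \<le> (\<Sum>l\<in>L. cmod (c l) * fnorm p q (A l))"
proof -
  have "case_prod (\<lambda>i j. \<Sum>l\<in>L. c l * A l i j) = (\<lambda>p. \<Sum>l\<in>L. c l * case_prod (A l) p)"
    by (auto simp: fun_eq_iff)
  thus ?thesis unfolding fnorm_eq_cnm by (simp only: cnm_sum_le)
qed

lemma fnorm_eq_0: "fnorm p q A = 0 \<longleftrightarrow> (\<forall>i<p. \<forall>j<q. A i j = 0)"
  by (auto simp: fnorm_eq_cnm cnm_eq_0_iff)

lemma kmat_fnorm_pos:
  assumes A: "kmat rc p q A" and ne: "A \<noteq> (\<lambda>_ _. 0)"
  shows "0 < fnorm p q A"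
proof (rule ccontr)
  assume "\<not> 0 < fnorm p q A"
  hence "fnorm p q A = 0" using fnorm_nonneg[of p q A] by linarith
  hence "A i j = 0" if "i < p" "j < q" for i j using that by (simp add: fnorm_eq_0)
  hence "A i j = 0" for i j using A unfolding kmat_def by blast
  thus False using ne by blast
qed

lemma minner_mmult_left: "minner n k (mmult n A Y) D = minner n n A (mmult k D (madj Y))"
proof -
  have "minner n k (mmult n A Y) D = (\<Sum>a<n. \<Sum>c<k. \<Sum>r<n. Re (cnj (A a r) * (D a c * cnj (Y r c))))"
    by (simp add: minner_def mmult_def sum_distrib_right sum_distrib_left mult_ac del: Re_sum add: Re_sum)
  also have "\<dots> = (\<Sum>a<n. \<Sum>r<n. \<Sum>c<k. Re (cnj (A a r) * (D a c * cnj (Y r c))))"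
    by (rule sum.cong[OF refl], rule sum.swap)
  also have "\<dots> = minner n n A (mmult k D (madj Y))"
    by (simp add: minner_def mmult_def madj_def sum_distrib_left)
  finally show ?thesis .
qed

lemma minner_columns: "minner n k A B = (\<Sum>c<k. rip {..<n} (\<lambda>a. A a c) (\<lambda>a. B a c))"
  unfolding minner_def cip_def Re_sum by (rule sum.swap)

lemma mmult_column: "(\<lambda>a. mmult n A Y a c) = mvec n A (\<lambda>a. Y a c)"
  by (simp add: mmult_def mvec_def)

lemma mvec_eq_smulv: "mvec n M x = smulv {..<n} M x"
  by (simp add: mvec_def smulv_def)

lemma mvec_scale: "mvec n M (\<lambda>i. c * x i) = (\<lambda>i. c * mvec n M x i)"
  by (simp add: mvec_def sum_distrib_left mult_ac)

lemma mvec_add: "mvec n M (\<lambda>i. x i + y i) = (\<lambda>i. mvec n M x i + mvec n M y i)"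
  by (simp add: mvec_def distrib_left sum.distrib)

lemma mvec_diff_left: "mvec n (\<lambda>i j. A i j - B i j) x = (\<lambda>i. mvec n A x i - mvec n B x i)"
  by (simp add: mvec_def left_diff_distrib sum_subtractf)

lemma mvec_cip_sym:
  assumes "\<And>i j. i < n \<Longrightarrow> j < n \<Longrightarrow> S j i = cnj (S i j)"
  shows "cip {..<n} x (mvec n S y) = cip {..<n} (mvec n S x) y"
  unfolding mvec_eq_smulv by (rule smulv_cip_sym) (rule assms, simp_all)

lemma minner_mmult_sym:
  assumes "\<And>i j. i < n \<Longrightarrow> j < n \<Longrightarrow> S j i = cnj (S i j)"
  shows "minner n k D (mmult n S E) = minner n k (mmult n S D) E"
  unfolding minner_columns mmult_column using mvec_cip_sym[OF assms] by simp

lemma fnorm_mmult_opnorm: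
  assumes \<beta>: "\<And>x. kvec rc n x \<Longrightarrow> cnm {..<n} (mvec n A x) \<le> \<beta> * cnm {..<n} x" and Y: "kmat rc n k Y" and "0 \<le> \<beta>"
  shows "fnorm n k (mmult n A Y) \<le> \<beta> * fnorm n k Y"
proof (rule power2_le_imp_le)
  have "(fnorm n k (mmult n A Y))\<^sup>2 \<le> (\<Sum>c<k. (\<beta> * cnm {..<n} (\<lambda>a. Y a c))\<^sup>2)"
    unfolding fnorm_sq_columns mmult_column
    by (intro sum_mono power_mono \<beta>) (use Y in \<open>auto simp: kmat_def kvec_def\<close>)
  also have "\<dots> = (\<beta> * fnorm n k Y)\<^sup>2"
    by (simp add: power_mult_distrib fnorm_sq_columns sum_distrib_left)
  finally show "(fnorm n k (mmult n A Y))\<^sup>2 \<le> (\<beta> * fnorm n k Y)\<^sup>2" .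
qed (use assms in simp)

lemma mvec_le_fnorm: "cnm {..<p} (mvec q A x) \<le> fnorm p q A * cnm {..<q} x"
proof (rule power2_le_imp_le)
  have "(cnm {..<p} (mvec q A x))\<^sup>2 \<le> (\<Sum>i<p. (cnm {..<q} (A i) * cnm {..<q} x)\<^sup>2)"
    unfolding cnm_sq[of "{..<p}"]
  proof (intro sum_mono power_mono)
    fix i
    have "mvec q A x i = cip {..<q} (\<lambda>j. cnj (A i j)) x" by (simp add: mvec_def cip_def)
    thus "cmod (mvec q A x i) \<le> cnm {..<q} (A i) * cnm {..<q} x"
      using cip_Cauchy_Schwarz[of "{..<q}" "\<lambda>j. cnj (A i j)" x] by (simp add: cnm_def)
  qed simp
  also have "\<dots> = (fnorm p q A * cnm {..<q} x)\<^sup>2"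
    by (simp add: power_mult_distrib fnorm_sq_rows sum_distrib_right)
  finally show "(cnm {..<p} (mvec q A x))\<^sup>2 \<le> (fnorm p q A * cnm {..<q} x)\<^sup>2" .
qed simp

lemma fnorm_mmult_le: "fnorm p q (mmult l A B) \<le> fnorm p l A * fnorm l q B"
proof (rule power2_le_imp_le)
  have "(fnorm p q (mmult l A B))\<^sup>2 \<le> (\<Sum>c<q. (fnorm p l A * cnm {..<l} (\<lambda>a. B a c))\<^sup>2)"
    unfolding fnorm_sq_columns mmult_column by (intro sum_mono power_mono mvec_le_fnorm) simp
  also have "\<dots> = (fnorm p l A * fnorm l q B)\<^sup>2"
    by (simp add: power_mult_distrib fnorm_sq_columns sum_distrib_left)
  finally show "(fnorm p q (mmult l A B))\<^sup>2 \<le> (fnorm p l A * fnorm l q B)\<^sup>2" .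
qed simp

lemma fnorm_madj: "fnorm q p (madj A) = fnorm p q A"
proof -
  have "(fnorm q p (madj A))\<^sup>2 = (fnorm p q A)\<^sup>2"
    unfolding fnorm_sq by (subst sum.swap) (simp add: madj_def)
  thus ?thesis by (metis fnorm_nonneg power2_eq_iff_nonneg)
qed

lemma kmat_mmult: "kmat rc p l A \<Longrightarrow> kmat rc l q B \<Longrightarrow> kmat rc p q (mmult l A B)"
  unfolding kmat_def mmult_def by (auto intro!: Kset_sum Kset_closed sum.neutral)

lemma kmat_madj: "kmat rc p q A \<Longrightarrow> kmat rc q p (madj A)"
  unfolding kmat_def madj_def by (auto intro: Kset_closed)

lemma kmat_Aadj: "\<forall>i<m. kmat rc n n (As i) \<Longrightarrow> kmat rc n n (Aadj m As \<nu>)"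
  unfolding kmat_def Aadj_def by (auto intro!: Kset_sum Kset_closed)

lemma kmat_diff: "kmat rc p q A \<Longrightarrow> kmat rc p q B \<Longrightarrow> kmat rc p q (\<lambda>i j. A i j - B i j)"
  unfolding kmat_def by (auto intro: Kset_closed)

lemma mmult_Aadj: "mmult n (Aadj m As \<nu>) Y = (\<lambda>a c. \<Sum>j<m. complex_of_real (\<nu> j) * mmult n (As j) Y a c)"
proof (intro ext)
  fix a c
  have "mmult n (Aadj m As \<nu>) Y a c = (\<Sum>r<n. \<Sum>j<m. complex_of_real (\<nu> j) * (As j a r * Y r c))"
    by (simp add: mmult_def Aadj_def sum_distrib_right mult.assoc)
  also have "\<dots> = (\<Sum>j<m. \<Sum>r<n. complex_of_real (\<nu> j) * (As j a r * Y r c))" by (rule sum.swap)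
  also have "\<dots> = (\<Sum>j<m. complex_of_real (\<nu> j) * mmult n (As j) Y a c)"
    by (simp add: mmult_def sum_distrib_left)
  finally show "mmult n (Aadj m As \<nu>) Y a c = (\<Sum>j<m. complex_of_real (\<nu> j) * mmult n (As j) Y a c)" .
qed

lemma minner_Aadj: "minner n n (Aadj m As \<nu>) X = (\<Sum>i<m. \<nu> i * Aop n As X i)"
proof -
  have "minner n n (Aadj m As \<nu>) X = minner n n X (Aadj m As \<nu>)" by (rule minner_commute)
  also have "\<dots> = (\<Sum>i<m. \<nu> i * minner n n X (As i))" unfolding Aadj_def by (rule minner_sum)
  finally show ?thesis by (simp only: Aop_def minner_commute[of n n X])
qed

definition AGA :: "nat \<Rightarrow> nat \<Rightarrow> nat \<Rightarrow> (nat \<Rightarrow> cmat) \<Rightarrow> cmat \<Rightarrow> cmat \<Rightarrow> cmat" where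
  "AGA n k m As Y Z = Aadj m As (\<lambda>i. \<Sum>j<m. pinv m (Gram n k m As Y) i j * Aop n As Z j)"

lemma fnorm_AGA_le:
  assumes K: "AGA_opnorm rc n k m As Y \<le> K" and Z: "kmat rc n n Z"
  shows "fnorm n n (AGA n k m As Y Z) \<le> K * fnorm n n Z"
proof (cases "Z = (\<lambda>_ _. 0)")
  case True
  have "fnorm n n Z = 0" using True by (simp add: fnorm_eq_0)
  moreover have "Aop n As Z j = 0" for j using True by (simp add: Aop_def minner_def)
  hence "AGA n k m As Y Z = (\<lambda>_ _. 0)" by (simp add: AGA_def Aadj_def)
  hence "fnorm n n (AGA n k m As Y Z) = 0" by (simp add: fnorm_eq_0)
  ultimately show ?thesis by simp
next
  case False
  let ?H = "pinv m (Gram n k m As Y)"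
  \<comment> \<open>Any finite bound for the quotients will do: \<open>AGA_opnorm\<close> is a
    supremum of reals and dominates its members only once their set is known to be bounded.\<close>
  define c where "c = (\<Sum>i<m. (\<Sum>j<m. \<bar>?H i j\<bar> * fnorm n n (As j)) * fnorm n n (As i))"
  have bound: "fnorm n n (AGA n k m As Y Z) \<le> c * fnorm n n Z" for Z
  proof -
    have \<nu>: "\<bar>\<Sum>j<m. ?H i j * Aop n As Z j\<bar> \<le> (\<Sum>j<m. \<bar>?H i j\<bar> * fnorm n n (As j)) * fnorm n n Z" for i
    proof -
      have "\<bar>\<Sum>j<m. ?H i j * Aop n As Z j\<bar> \<le> (\<Sum>j<m. \<bar>?H i j\<bar> * (fnorm n n (As j) * fnorm n n Z))"
        unfolding Aop_def
        by (rule order_trans[OF sum_abs], rule sum_mono)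
           (simp add: abs_mult mult_left_mono minner_Cauchy_Schwarz)
      thus ?thesis by (simp add: sum_distrib_right mult.assoc)
    qed
    have "fnorm n n (AGA n k m As Y Z) \<le> (\<Sum>i<m. \<bar>\<Sum>j<m. ?H i j * Aop n As Z j\<bar> * fnorm n n (As i))"
      unfolding AGA_def Aadj_def by (rule order_trans[OF fnorm_sum_le]) (simp only: norm_of_real order_refl)
    also have "\<dots> \<le> (\<Sum>i<m. ((\<Sum>j<m. \<bar>?H i j\<bar> * fnorm n n (As j)) * fnorm n n Z) * fnorm n n (As i))"
      by (intro sum_mono mult_right_mono \<nu>) simp
    also have "\<dots> = c * fnorm n n Z" by (simp add: c_def sum_distrib_left sum_distrib_right mult_ac)
    finally show ?thesis .
  qed
  have pos: "0 < fnorm n n Z" using kmat_fnorm_pos[OF Z False] .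
  have "fnorm n n (AGA n k m As Y Z) / fnorm n n Z \<le> AGA_opnorm rc n k m As Y"
    unfolding AGA_opnorm_def AGA_def[symmetric]
  proof (rule cSup_upper)
    show "bdd_above {fnorm n n (AGA n k m As Y Z) / fnorm n n Z |Z. kmat rc n n Z \<and> Z \<noteq> (\<lambda>_ _. 0)}"
    proof (rule bdd_aboveI)
      fix x assume "x \<in> {fnorm n n (AGA n k m As Y Z) / fnorm n n Z |Z. kmat rc n n Z \<and> Z \<noteq> (\<lambda>_ _. 0)}"
      then obtain Z where Z: "x = fnorm n n (AGA n k m As Y Z) / fnorm n n Z" "kmat rc n n Z" "Z \<noteq> (\<lambda>_ _. 0)" by blast
      thus "x \<le> c" using bound[of Z] kmat_fnorm_pos[OF Z(2,3)] by (simp add: divide_le_eq)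
    qed
  qed (use Z False in blast)
  hence "fnorm n n (AGA n k m As Y Z) / fnorm n n Z \<le> K" using K by simp
  thus ?thesis using pos by (simp add: divide_le_eq)
qed

text \<open>\<open>D \<mapsto> AGA (D Y\<^sup>*) Y\<close> is the orthogonal projection onto the normal space at \<open>Y\<close>.\<close>
lemma AGA_normal_projection:
  assumes "i < m"
  shows "minner n k (mmult n (As i) Y) (mmult n (AGA n k m As Y (mmult k D (madj Y))) Y)
    = minner n k (mmult n (As i) Y) D"
proof -
  let ?a = "\<lambda>j. case_prod (mmult n (As j) Y)"
  have G: "Gram n k m As Y = (\<lambda>i j. if i < m \<and> j < m then rip (mbox n k) (?a i) (?a j) else 0)"
    unfolding Gram_def minner_eq_cip ..
  have A: "Aop n As (mmult k D (madj Y)) l = rip (mbox n k) (?a l) (case_prod D)" for l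
    unfolding Aop_def minner_mmult_left[symmetric] by (rule minner_eq_cip)
  show ?thesis
    unfolding AGA_def mmult_Aadj minner_sum A G
    unfolding minner_eq_cip
    using gram_pinv_range[OF assms, of "mbox n k" ?a "case_prod D"]
    by (simp only: mult.commute)
qed

section \<open>Quadratic forms and weak duality\<close>

definition qform :: "nat \<Rightarrow> cmat \<Rightarrow> (nat \<Rightarrow> complex) \<Rightarrow> real" where
  "qform n M x = rip {..<n} x (mvec n M x)"

lemma qform_eq: "qform n M x = Re (\<Sum>i<n. \<Sum>j<n. cnj (x i) * M i j * x j)"
  by (simp add: qform_def cip_def mvec_def sum_distrib_left mult.assoc)

lemma psd_qform: "psd rc n M \<longleftrightarrow> (\<forall>x. kvec rc n x \<longrightarrow> 0 \<le> qform n M x)"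
  by (simp add: psd_def qform_eq)

lemma minner_rank_one: "minner n n T (\<lambda>i j. v i * cnj (v j)) = qform n T v"
proof -
  have "minner n n T (\<lambda>i j. v i * cnj (v j)) = Re (cnj (\<Sum>i<n. \<Sum>j<n. cnj (v i) * T i j * v j))"
    by (simp add: minner_def mult_ac)
  thus ?thesis unfolding qform_eq by (simp only: cnj.sel(1))
qed

definition unitv :: "nat \<Rightarrow> nat \<Rightarrow> complex" where
  "unitv p = (\<lambda>i. if i = p then 1 else 0)"

lemma cip_unitv: "p < n \<Longrightarrow> cip {..<n} (unitv p) x = x p"
  by (simp add: cip_def unitv_def if_distrib[of cnj] if_distrib[of "\<lambda>z. z * _"] cong: if_cong)

lemma mvec_unitv: "p < n \<Longrightarrow> mvec n M (unitv p) i = M i p"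
  by (simp add: mvec_def unitv_def if_distrib[of "\<lambda>z. _ * z"] cong: if_cong)

lemma kvec_unitv: "p < n \<Longrightarrow> kvec rc n (unitv p)"
  by (auto simp: kvec_def unitv_def Kset_closed)

lemma kvec_add_unitv: "kvec rc n x \<Longrightarrow> p < n \<Longrightarrow> c \<in> Kset rc \<Longrightarrow> kvec rc n (\<lambda>i. x i + c * unitv p i)"
  by (auto simp: kvec_def unitv_def intro!: Kset_closed)

text \<open>A quadratic polynomial in the single coordinate \<open>c\<close>;
  \<open>psd_duality\<close> minimises it to pass to the Schur complement.\<close>

lemma qform_add_unitv:
  assumes "\<And>i j. i < n \<Longrightarrow> j < n \<Longrightarrow> M j i = cnj (M i j)" and p: "p < n"
  shows "qform n M (\<lambda>i. x i + c * unitv p i) = qform n M x + 2 * Re (cnj c * mvec n M x p) + (cmod c)\<^sup>2 * Re (M p p)"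
proof -
  let ?I = "{..<n}"
  have e: "mvec n M (\<lambda>i. x i + c * unitv p i) = (\<lambda>i. mvec n M x i + c * mvec n M (unitv p) i)"
    by (simp only: mvec_add mvec_scale)
  have x1: "rip ?I x (\<lambda>i. c * mvec n M (unitv p) i) = Re (cnj c * mvec n M x p)"
  proof -
    have "cip ?I x (mvec n M (unitv p)) = cip ?I (mvec n M x) (unitv p)"
      by (rule mvec_cip_sym) (rule assms(1))
    also have "\<dots> = cnj (mvec n M x p)" using cip_cnj[of ?I "unitv p" "mvec n M x"] p by (simp add: cip_unitv)
    finally show ?thesis by (simp add: cip_scale_right)
  qed
  have x2: "rip ?I (\<lambda>i. c * unitv p i) (mvec n M x) = Re (cnj c * mvec n M x p)"
    unfolding cip_scale_left using p by (simp add: cip_unitv)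
  have x3: "rip ?I (\<lambda>i. c * unitv p i) (\<lambda>i. c * mvec n M (unitv p) i) = (cmod c)\<^sup>2 * Re (M p p)"
  proof -
    have "cip ?I (\<lambda>i. c * unitv p i) (\<lambda>i. c * mvec n M (unitv p) i) = cnj c * c * M p p"
      unfolding cip_scale_left cip_scale_right using p by (simp add: cip_unitv mvec_unitv)
    also have "cnj c * c = complex_of_real ((cmod c)\<^sup>2)" by (metis complex_norm_square mult.commute of_real_power)
    finally show ?thesis by simp
  qed
  show ?thesis unfolding qform_def e cip_add_left cip_add_right using x1 x2 x3 by simp
qed

text \<open>Eliminating one row and column of \<open>X\<close> at a time writes \<open>X\<close> as a sum of rank one
  terms \<open>v v\<^sup>*\<close>; no spectral theorem is needed.\<close>
lemma psd_duality:
  assumes T: "\<And>x. kvec rc n x \<Longrightarrow> 0 \<le> qform n T x"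
    and X: "sadj rc n X" "psd rc n X"
  shows "0 \<le> minner n n T X"
proof -
  have "0 \<le> minner n n T X" if "p \<le> n" "sadj rc n X" "psd rc n X" "\<forall>i<p. \<forall>j. X i j = 0" for p X
    using that
  proof (induction "n - p" arbitrary: p X)
    case 0
    hence "p = n" by simp
    hence "X i j = 0" if "i < n" for i j using 0 that by simp
    thus ?case by (simp add: minner_def)
  next
    case (Suc l)
    have p: "p < n" using Suc.hyps(2) by simp
    have l: "l = n - Suc p" using Suc.hyps(2) by simp
    have herm: "X j i = cnj (X i j)" if "i < n" "j < n" for i j
      using Suc.prems(2) that unfolding sadj_def by blast
    have XK: "X i j \<in> Kset rc" for i j
      using Suc.prems(2) Kset_closed(1) unfolding sadj_def kmat_def by metis
    have out: "X i j = 0" if "\<not> (i < n \<and> j < n)" for i j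
      using Suc.prems(2) that unfolding sadj_def kmat_def by metis
    have q: "0 \<le> qform n X x" if "kvec rc n x" for x using Suc.prems(3) that by (simp add: psd_qform)
    have qe: "qform n X (unitv j) = Re (X j j)" if "j < n" for j
      unfolding qform_def using that by (simp add: cip_unitv mvec_unitv)
    have Xpp: "0 \<le> Re (X p p)" using q[OF kvec_unitv[OF p]] qe[OF p] by simp
    have Xpp_real: "X p p = complex_of_real (Re (X p p))"
      using herm[OF p p] by (simp add: complex_eq_iff)
    show ?case
    proof (cases "Re (X p p) = 0")
      case True
      have row: "X p j = 0" if j: "j < n" for j
      proof (rule ccontr)
        assume ne: "X p j \<noteq> 0"
        \<comment> \<open>With a zero diagonal entry the form is affine in \<open>t\<close>; this
          value makes it \<open>- 1\<close>, contradicting positivity.\<close>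
        define t where "t = (Re (X j j) + 1) / (2 * (cmod (X p j))\<^sup>2)"
        define s where "s = - complex_of_real t * X p j"
        have "s \<in> Kset rc" unfolding s_def using XK by (intro Kset_closed)
        hence "0 \<le> qform n X (\<lambda>i. unitv j i + s * unitv p i)"
          by (intro q kvec_add_unitv kvec_unitv j p)
        also have "\<dots> = Re (X j j) + 2 * Re (cnj s * X p j)"
          by (subst qform_add_unitv[OF herm p]) (simp_all add: qe[OF j] mvec_unitv[OF j] True)
        also have "Re (cnj s * X p j) = - t * (cmod (X p j))\<^sup>2"
          unfolding s_def cmod_power2 by (simp add: power2_eq_square algebra_simps)
        also have "Re (X j j) + 2 * (- t * (cmod (X p j))\<^sup>2) = - 1"
          using ne by (simp add: t_def field_simps)
        finally show False by simp
      qed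
      have "\<forall>i<Suc p. \<forall>j. X i j = 0"
        using Suc.prems(4) row out by (metis less_Suc_eq)
      thus ?thesis using Suc.hyps(1)[OF l _ Suc.prems(2,3)] p by simp
    next
      case False
      define a where "a = Re (X p p)"
      have a: "0 < a" using Xpp False by (simp add: a_def)
      \<comment> \<open>The scaled column \<open>p\<close>: subtracting the rank one matrix built
        from \<open>v\<close> clears row \<open>p\<close> and leaves the Schur complement.\<close>
      define v where "v i = X i p / complex_of_real (sqrt a)" for i
      define X' where "X' i j = X i j - v i * cnj (v j)" for i j
      have vv: "v i * cnj (v j) = X i p * cnj (X j p) / complex_of_real a" for i j
        unfolding v_def using a by (simp flip: of_real_mult)
      have vK: "v i \<in> Kset rc" for i unfolding v_def using XK by (intro Kset_closed)
      have v0: "v i = 0" if "\<not> i < n" for i unfolding v_def using out that by simp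
      have kv: "kvec rc n v" using vK v0 by (simp add: kvec_def)
      have sadj': "sadj rc n X'"
        unfolding sadj_def kmat_def
      proof (intro conjI allI impI)
        show "X' i j \<in> Kset rc" for i j unfolding X'_def using XK vK by (intro Kset_closed)
        show "X' i j = 0" if "\<not> (i < n \<and> j < n)" for i j
          using out[OF that] v0 that by (auto simp: X'_def)
        show "X' j i = cnj (X' i j)" if "i < n" "j < n" for i j
          using herm[OF that] by (simp add: X'_def)
      qed
      have psd': "psd rc n X'"
        unfolding psd_qform
      proof (intro allI impI)
        fix x assume x: "kvec rc n x"
        \<comment> \<open>The minimiser over the coordinate \<open>p\<close>; the minimum of the
          form of \<open>X\<close> along this coordinate is the form of \<open>X'\<close> at
          \<open>x\<close>.\<close>
        define c where "c = - mvec n X x p / complex_of_real a"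
        have cK: "c \<in> Kset rc" unfolding c_def mvec_def
          using XK x Kset_closed(1) by (intro Kset_closed Kset_sum) (auto simp: kvec_def)
        have E: "2 * Re (cnj c * mvec n X x p) + (cmod c)\<^sup>2 * a = - (cmod (mvec n X x p))\<^sup>2 / a"
        proof -
          have "Re (cnj c * mvec n X x p) = - (cmod (mvec n X x p))\<^sup>2 / a"
            unfolding c_def cmod_power2 using a by (simp add: power2_eq_square field_simps)
          moreover have "(cmod c)\<^sup>2 * a = (cmod (mvec n X x p))\<^sup>2 / a"
            unfolding c_def using a by (simp add: norm_divide power_divide power2_eq_square)
          ultimately show ?thesis by simp
        qed
        have "0 \<le> qform n X (\<lambda>i. x i + c * unitv p i)" by (intro q kvec_add_unitv x p cK)
        also have "\<dots> = qform n X x + 2 * Re (cnj c * mvec n X x p) + (cmod c)\<^sup>2 * a"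
          unfolding a_def by (rule qform_add_unitv[OF herm p])
        finally have pos: "0 \<le> qform n X x - (cmod (mvec n X x p))\<^sup>2 / a" using E by linarith
        have "mvec n (\<lambda>i j. v i * cnj (v j)) x = (\<lambda>i. cip {..<n} v x * v i)"
          by (simp add: mvec_def cip_def sum_distrib_left sum_distrib_right mult_ac)
        hence "qform n (\<lambda>i j. v i * cnj (v j)) x = Re (cip {..<n} v x * cip {..<n} x v)"
          unfolding qform_def by (simp add: cip_scale_right)
        also have "cip {..<n} x v = cnj (cip {..<n} v x)" by (rule cip_cnj[symmetric])
        also have "Re (cip {..<n} v x * cnj (cip {..<n} v x)) = (cmod (cip {..<n} v x))\<^sup>2"
          by (simp add: complex_mult_cnj cmod_power2)
        also have "cip {..<n} v x = mvec n X x p / complex_of_real (sqrt a)"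
        proof -
          have "cnj (X i p) = X p i" if "i < n" for i using herm[of i p] that p by simp
          thus ?thesis by (simp add: cip_def mvec_def v_def sum_divide_distrib)
        qed
        also have "(cmod (mvec n X x p / complex_of_real (sqrt a)))\<^sup>2 = (cmod (mvec n X x p))\<^sup>2 / a"
          using a by (simp add: norm_divide power_divide)
        finally have qv: "qform n (\<lambda>i j. v i * cnj (v j)) x = (cmod (mvec n X x p))\<^sup>2 / a" .
        have "qform n X' x = qform n X x - qform n (\<lambda>i j. v i * cnj (v j)) x"
          unfolding qform_def X'_def[abs_def] mvec_diff_left cip_diff_right by simp
        thus "0 \<le> qform n X' x" using qv pos by simp
      qed
      have zero': "\<forall>i<Suc p. \<forall>j. X' i j = 0"
      proof (intro allI impI)
        fix i j assume i: "i < Suc p"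
        show "X' i j = 0"
        proof (cases "i = p")
          case False
          hence "i < p" using i by simp
          thus ?thesis using Suc.prems(4) by (simp add: X'_def v_def)
        next
          case True
          show ?thesis
          proof (cases "j < n")
            case j: True
            have "cnj (X j p) = X p j" using herm[OF j p] by simp
            thus ?thesis unfolding X'_def vv True using a Xpp_real by (simp add: a_def[symmetric])
          qed (use out v0 in \<open>simp add: X'_def\<close>)
        qed
      qed
      have "0 \<le> minner n n T X'"
        using Suc.hyps(1)[OF l _ sadj' psd' zero'] p by simp
      moreover have "minner n n T X = minner n n T X' + minner n n T (\<lambda>i j. v i * cnj (v j))"
        unfolding minner_add[symmetric] X'_def by simp
      moreover have "0 \<le> minner n n T (\<lambda>i j. v i * cnj (v j))"
        unfolding minner_rank_one by (rule T[OF kv])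
      ultimately show ?thesis by simp
    qed
  qed
  from this[of 0 X] X show ?thesis by simp
qed

section \<open>Rank one test matrices and Gram factors\<close>

lemma minner_outer:
  "minner p q (\<lambda>i j. x i * cnj (u j)) (\<lambda>i j. y i * cnj (v j)) = Re (cip {..<p} x y * cip {..<q} v u)"
  by (simp only: minner_def cip_def sum_product Re_sum) (simp add: mult_ac)

lemma fnorm_outer: "fnorm p q (\<lambda>i j. x i * cnj (u j)) = cnm {..<p} x * cnm {..<q} u"
proof -
  have "(fnorm p q (\<lambda>i j. x i * cnj (u j)))\<^sup>2 = (cnm {..<p} x * cnm {..<q} u)\<^sup>2"
    by (simp add: fnorm_sq cnm_sq power_mult_distrib sum_product norm_mult)
  thus ?thesis by (metis cnm_nonneg fnorm_nonneg mult_nonneg_nonneg power2_eq_iff_nonneg)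
qed

lemma mmult_diff_right: "mmult n S (\<lambda>a c. D a c - N a c) = (\<lambda>a c. mmult n S D a c - mmult n S N a c)"
  by (simp add: mmult_def right_diff_distrib sum_subtractf)

lemma mmult_outer: "mmult n S (\<lambda>i j. x i * cnj (u j)) = (\<lambda>i j. mvec n S x i * cnj (u j))"
  by (simp add: mmult_def mvec_def sum_distrib_right mult.assoc)

lemma outer_mmult_madj: "mmult k (\<lambda>i j. x i * cnj (u j)) (madj Y) = (\<lambda>i j. x i * cnj (mvec k Y u j))"
  by (simp add: mmult_def madj_def mvec_def sum_distrib_left mult_ac)

lemma qform_gram: "qform n (mmult k Y (madj Y)) x = (cnm {..<k} (\<lambda>c. \<Sum>i<n. cnj (Y i c) * x i))\<^sup>2"
proof -
  have "mvec n (mmult k Y (madj Y)) x i = (\<Sum>j<n. \<Sum>c<k. Y i c * (cnj (Y j c) * x j))" for i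
    by (simp add: mvec_def mmult_def madj_def sum_distrib_right mult.assoc)
  also have "\<And>i. (\<Sum>j<n. \<Sum>c<k. Y i c * (cnj (Y j c) * x j)) = (\<Sum>c<k. (\<Sum>j<n. cnj (Y j c) * x j) * Y i c)"
    by (subst sum.swap) (simp add: sum_distrib_left sum_distrib_right mult_ac)
  finally have "mvec n (mmult k Y (madj Y)) x = (\<lambda>i. \<Sum>c<k. (\<Sum>j<n. cnj (Y j c) * x j) * (\<lambda>c i. Y i c) c i)"
    by auto
  hence "qform n (mmult k Y (madj Y)) x = Re (\<Sum>c<k. (\<Sum>j<n. cnj (Y j c) * x j) * cip {..<n} x (\<lambda>i. Y i c))"
    unfolding qform_def by (simp only: cip_sum_right)
  also have "(\<Sum>c<k. (\<Sum>j<n. cnj (Y j c) * x j) * cip {..<n} x (\<lambda>i. Y i c))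
      = cip {..<k} (\<lambda>c. \<Sum>i<n. cnj (Y i c) * x i) (\<lambda>c. \<Sum>i<n. cnj (Y i c) * x i)"
    by (simp add: cip_def mult.commute)
  finally show ?thesis by (simp add: rip_self)
qed

text \<open>Fixes one point of \<open>Mk\<close>. The locale is interpreted at several points, among
  them rescaled copies at which the trace bound is tested.\<close>

locale sdp_point =
  fixes rc :: bool and n m k :: nat and As :: "nat \<Rightarrow> cmat" and b :: "nat \<Rightarrow> real" and R K :: real and Y :: cmat
  assumes n: "1 \<le> n"
    and sadj_As: "\<forall>i<m. sadj rc n (As i)"
    and trace_le: "\<forall>X \<in> feas rc n m As b. Re (mtrace n X) \<le> R"
    and Y: "Y \<in> Mk rc n k m As b"
    and AGA_opnorm_le: "AGA_opnorm rc n k m As Y \<le> K"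
begin

lemma kmat_Y: "kmat rc n k Y"
  using Y by (simp add: Mk_def)

lemma gram_feasible: "mmult k Y (madj Y) \<in> feas rc n m As b"
  unfolding feas_def
proof (intro CollectI conjI)
  show "sadj rc n (mmult k Y (madj Y))"
    unfolding sadj_def using kmat_mmult[OF kmat_Y kmat_madj[OF kmat_Y]]
    by (auto simp: mmult_def madj_def mult.commute)
  show "psd rc n (mmult k Y (madj Y))" unfolding psd_qform qform_gram by simp
qed (use Y in \<open>simp add: Mk_def\<close>)

lemma fnorm_Y_sq: "(fnorm n k Y)\<^sup>2 \<le> R"
proof -
  have "Re (mtrace n (mmult k Y (madj Y))) = (fnorm n k Y)\<^sup>2"
    unfolding fnorm_sq mtrace_def mmult_def madj_def cmod_power2 by (simp add: power2_eq_square)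
  thus ?thesis using trace_le gram_feasible by force
qed

lemma R_nonneg: "0 \<le> R"
  by (rule order_trans[OF zero_le_power2 fnorm_Y_sq])

lemma fnorm_Y: "fnorm n k Y \<le> sqrt R"
  using fnorm_Y_sq by (intro real_le_rsqrt)

lemma fnorm_AGA: "kmat rc n n Z \<Longrightarrow> fnorm n n (AGA n k m As Y Z) \<le> K * fnorm n n Z"
  by (rule fnorm_AGA_le[OF AGA_opnorm_le])

lemma K_nonneg: "0 \<le> K"
proof -
  \<comment> \<open>A nonzero test matrix, available because \<open>1 \<le> n\<close>.\<close>
  define Z :: cmat where "Z = (\<lambda>i j. if i = 0 \<and> j = 0 then 1 else 0)"
  have Z: "kmat rc n n Z" using n by (auto simp: Z_def kmat_def Kset_closed)
  moreover have "Z \<noteq> (\<lambda>_ _. 0)" by (auto simp: Z_def fun_eq_iff)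
  ultimately have "0 < fnorm n n Z" by (rule kmat_fnorm_pos)
  moreover have "0 \<le> K * fnorm n n Z" by (rule order_trans[OF fnorm_nonneg fnorm_AGA[OF Z]])
  ultimately show ?thesis by (simp add: zero_le_mult_iff)
qed

lemma kmat_AGA: "kmat rc n n (AGA n k m As Y Z)"
  unfolding AGA_def by (rule kmat_Aadj) (use sadj_As in \<open>simp add: sadj_def\<close>)

lemma residual_tangent:
  assumes "kmat rc n k D"
  shows "(\<lambda>a c. D a c - mmult n (AGA n k m As Y (mmult k D (madj Y))) Y a c) \<in> tangent rc n k m As Y"
  unfolding tangent_def
  using AGA_normal_projection[where m = m and n = n and As = As and Y = Y and k = k and D = D] kmat_diff[OF assms kmat_mmult[OF kmat_AGA kmat_Y]]
  by (simp add: minner_diff)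

lemma tangent_normal:
  assumes "P \<in> tangent rc n k m As Y"
  shows "minner n k P (mmult n (Aadj m As \<nu>) Y) = 0"
  using assms unfolding mmult_Aadj minner_sum
  by (simp add: tangent_def minner_commute[of n k P])

text \<open>A normal vector is fixed by the projection onto the normal space, so \<open>As i\<close>
  times \<open>Y\<close> equals \<open>H\<close> times \<open>Y\<close>. Then \<open>H\<close>,
  being the image under \<open>AGA\<close> of \<open>H Y\<close> times the adjoint of
  \<open>Y\<close>, has norm at most \<open>K * R\<close> times its own. This keeps the logarithm
  \<open>L\<close> away from 0 in the main case.\<close>

lemma one_le_K_times_R:
  assumes i: "i < m" and ne: "mmult n (As i) Y \<noteq> (\<lambda>_ _. 0)"
  shows "1 \<le> K * R"
proof -
  let ?D = "mmult n (As i) Y"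
  define H where "H = AGA n k m As Y (mmult k ?D (madj Y))"
  have kD: "kmat rc n k ?D" using sadj_As i by (intro kmat_mmult[OF _ kmat_Y]) (simp add: sadj_def)
  define P where "P = (\<lambda>a c. ?D a c - mmult n H Y a c)"
  have P: "P \<in> tangent rc n k m As Y" unfolding P_def H_def by (rule residual_tangent[OF kD])
  have "minner n k P ?D = 0" using P i by (simp add: tangent_def minner_commute[of n k P])
  moreover have "minner n k P (mmult n H Y) = 0" unfolding H_def AGA_def by (rule tangent_normal[OF P])
  moreover have "minner n k P P = minner n k P ?D - minner n k P (mmult n H Y)"
    by (subst (2) P_def) (rule minner_diff)
  ultimately have "minner n k P P = 0" by simp
  hence "fnorm n k P = 0" by (simp add: minner_self)
  moreover have "kmat rc n k P" using P by (simp add: tangent_def)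
  ultimately have "P = (\<lambda>_ _. 0)" using kmat_fnorm_pos by fastforce
  hence HY: "mmult n H Y = ?D" by (simp add: P_def fun_eq_iff)
  have "H \<noteq> (\<lambda>_ _. 0)"
  proof
    assume "H = (\<lambda>_ _. 0)"
    hence "mmult n H Y = (\<lambda>_ _. 0)" by (simp add: mmult_def)
    thus False using HY ne by simp
  qed
  hence Hpos: "0 < fnorm n n H" using kmat_AGA by (intro kmat_fnorm_pos) (auto simp: H_def)
  have "fnorm n n H \<le> K * fnorm n n (mmult k ?D (madj Y))"
    unfolding H_def by (intro fnorm_AGA kmat_mmult[OF kD] kmat_madj kmat_Y)
  also have "fnorm n n (mmult k ?D (madj Y)) \<le> fnorm n k (mmult n H Y) * fnorm n k Y"
    using fnorm_mmult_le[of n n k ?D "madj Y"] by (simp add: HY fnorm_madj)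
  also have "fnorm n k (mmult n H Y) \<le> fnorm n n H * fnorm n k Y" by (rule fnorm_mmult_le)
  finally have "fnorm n n H \<le> K * (fnorm n n H * fnorm n k Y * fnorm n k Y)"
    using K_nonneg by (simp add: mult_left_mono mult_right_mono)
  also have "\<dots> = fnorm n n H * (K * (fnorm n k Y)\<^sup>2)" by (simp add: power2_eq_square mult_ac)
  also have "\<dots> \<le> fnorm n n H * (K * R)"
    using K_nonneg fnorm_Y_sq by (intro mult_left_mono) auto
  finally show ?thesis using Hpos by simp
qed

end

text \<open>\<open>C'\<close> will be the perturbed cost and \<open>\<beta>\<close> a bound for its
  spectral norm on the good event.\<close>

locale sdp_cost_point = sdp_point +
  fixes C' :: cmat and \<beta> :: real
  assumes kmat_C': "kmat rc n n C'"
    and herm_C': "\<And>i j. i < n \<Longrightarrow> j < n \<Longrightarrow> C' j i = cnj (C' i j)"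
    and \<beta>: "0 \<le> \<beta>" "\<And>x. kvec rc n x \<Longrightarrow> cnm {..<n} (mvec n C' x) \<le> \<beta> * cnm {..<n} x"
begin

definition "S = Smat n k m As C' Y"
definition "multiplier = Aadj m As (mu n k m As C' Y)"

lemma S_eq: "S = (\<lambda>a c. C' a c - multiplier a c)"
  by (simp add: S_def Smat_def multiplier_def)

lemma multiplier_eq: "multiplier = AGA n k m As Y (mmult k (mmult n C' Y) (madj Y))"
  by (simp add: multiplier_def AGA_def mu_def)

text \<open>Confines the random multiplier matrix to a ball whose radius does not depend on
  \<open>Y\<close>, so that one net serves all second order points.\<close>

lemma fnorm_multiplier: "fnorm n n multiplier \<le> K * R * \<beta>"
proof -
  have "fnorm n n multiplier \<le> K * fnorm n n (mmult k (mmult n C' Y) (madj Y))"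
    unfolding multiplier_eq by (intro fnorm_AGA kmat_mmult kmat_C' kmat_Y kmat_madj)
  also have "fnorm n n (mmult k (mmult n C' Y) (madj Y)) \<le> fnorm n k (mmult n C' Y) * fnorm n k Y"
    using fnorm_mmult_le[of n n k "mmult n C' Y" "madj Y"] by (simp add: fnorm_madj)
  also have "fnorm n k (mmult n C' Y) \<le> \<beta> * fnorm n k Y"
    by (rule fnorm_mmult_opnorm[OF \<beta>(2) kmat_Y \<beta>(1)])
  finally have "fnorm n n multiplier \<le> K * (\<beta> * fnorm n k Y * fnorm n k Y)"
    using K_nonneg by (simp add: mult_left_mono mult_right_mono)
  also have "\<dots> = K * (\<beta> * (fnorm n k Y)\<^sup>2)" by (simp add: power2_eq_square mult_ac)
  also have "\<dots> \<le> K * (\<beta> * R)" using K_nonneg \<beta>(1) fnorm_Y_sq by (intro mult_left_mono) auto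
  finally show ?thesis by (simp add: mult_ac)
qed

lemma herm_S: "i < n \<Longrightarrow> j < n \<Longrightarrow> S j i = cnj (S i j)"
proof -
  assume ij: "i < n" "j < n"
  have "As l j i = cnj (As l i j)" if "l < m" for l using sadj_As that ij unfolding sadj_def by blast
  thus ?thesis using herm_C'[OF ij] by (simp add: S_eq multiplier_def Aadj_def)
qed

lemma S_opnorm:
  assumes "kvec rc n x"
  shows "cnm {..<n} (mvec n S x) \<le> \<beta> * (1 + K * R) * cnm {..<n} x"
proof -
  have "cnm {..<n} (mvec n S x) \<le> cnm {..<n} (mvec n C' x) + cnm {..<n} (mvec n multiplier x)"
    unfolding S_eq mvec_diff_left by (rule cnm_triangle_diff)
  also have "\<dots> \<le> \<beta> * cnm {..<n} x + K * R * \<beta> * cnm {..<n} x"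
    by (intro add_mono \<beta>(2) assms order_trans[OF mvec_le_fnorm] mult_right_mono fnorm_multiplier) simp
  finally show ?thesis by (simp add: algebra_simps)
qed

text \<open>Test the second order condition with the tangent part of \<open>x u\<^sup>*\<close>, where \<open>u\<close> is an
  almost singular direction of \<open>Y\<close>; the normal part is of size \<open>O(\<parallel>Y u\<parallel>)\<close>.\<close>
lemma curvature_lower_bound:
  assumes sosp: "\<forall>D \<in> tangent rc n k m As Y. minner n k D (mmult n S D) \<ge> - eH * (fnorm n k D)\<^sup>2"
    and eH: "0 \<le> eH"
    and u: "kvec rc k u" "cnm {..<k} u = 1" "cnm {..<n} (mvec k Y u) \<le> s0"
    and x: "kvec rc n x"
  shows "- (eH + \<beta> * K * (2 + K * R)\<^sup>2 * s0\<^sup>2) * (cnm {..<n} x)\<^sup>2 \<le> qform n S x"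
proof -
  define D where "D = (\<lambda>i j. x i * cnj (u j))"
  define H where "H = AGA n k m As Y (mmult k D (madj Y))"
  define N where "N = mmult n H Y"
  define P where "P = (\<lambda>a c. D a c - N a c)"
  define \<xi> where "\<xi> = cnm {..<n} x"
  define \<gamma> where "\<gamma> = \<beta> * (1 + K * R)"
  have s0: "0 \<le> s0" by (rule order_trans[OF cnm_nonneg u(3)])
  have \<xi>: "0 \<le> \<xi>" by (simp add: \<xi>_def)
  have \<gamma>: "0 \<le> \<gamma>" using \<beta>(1) K_nonneg R_nonneg by (simp add: \<gamma>_def)
  have kD: "kmat rc n k D" using x u(1) by (auto simp: D_def kmat_def kvec_def intro!: Kset_closed)
  have kN: "kmat rc n k N" unfolding N_def H_def by (intro kmat_mmult kmat_AGA kmat_Y)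
  have P: "P \<in> tangent rc n k m As Y" unfolding P_def N_def H_def by (rule residual_tangent[OF kD])
  have PN: "minner n k P N = 0" unfolding N_def H_def AGA_def by (rule tangent_normal[OF P])
  have DY: "mmult k D (madj Y) = (\<lambda>i j. x i * cnj (mvec k Y u j))" unfolding D_def by (rule outer_mmult_madj)
  have H: "fnorm n n H \<le> K * \<xi> * s0"
  proof -
    have "fnorm n n H \<le> K * fnorm n n (mmult k D (madj Y))"
      unfolding H_def by (intro fnorm_AGA kmat_mmult kD kmat_madj kmat_Y)
    also have "\<dots> = K * (\<xi> * cnm {..<n} (mvec k Y u))" unfolding DY fnorm_outer \<xi>_def ..
    also have "\<dots> \<le> K * (\<xi> * s0)" by (intro mult_left_mono u(3) \<xi> K_nonneg)
    finally show ?thesis by (simp add: mult.assoc)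
  qed
  have fD: "fnorm n k D = \<xi>" unfolding D_def fnorm_outer \<xi>_def u(2) by simp
  have fN: "(fnorm n k N)\<^sup>2 \<le> (K * \<xi> * s0)\<^sup>2 * R"
  proof -
    have "fnorm n k N \<le> fnorm n n H * fnorm n k Y" unfolding N_def by (rule fnorm_mmult_le)
    hence "(fnorm n k N)\<^sup>2 \<le> (fnorm n n H * fnorm n k Y)\<^sup>2" by (intro power_mono) simp_all
    also have "\<dots> = (fnorm n n H)\<^sup>2 * (fnorm n k Y)\<^sup>2" by (rule power_mult_distrib)
    also have "\<dots> \<le> (K * \<xi> * s0)\<^sup>2 * R"
      by (intro mult_mono power_mono H fnorm_Y_sq) simp_all
    finally show ?thesis .
  qed
  have fP: "(fnorm n k P)\<^sup>2 \<le> \<xi>\<^sup>2"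
  proof -
    have "minner n k P P = minner n k P D - minner n k P N" by (subst (2) P_def) (rule minner_diff)
    also have "minner n k P D = minner n k D D - minner n k N D" unfolding P_def by (rule minner_diff_left)
    also have "minner n k N D = minner n k N N"
    proof -
      have "0 = minner n k D N - minner n k N N" using PN unfolding P_def minner_diff_left by simp
      thus ?thesis by (simp add: minner_commute[of n k N D])
    qed
    finally show ?thesis using PN by (simp add: minner_self fD)
  qed
  have DSD: "minner n k D (mmult n S D) = qform n S x"
    unfolding D_def mmult_outer minner_outer cip_self u(2) by (simp add: qform_def)
  \<comment> \<open>Moving \<open>Y\<close> to the other side pairs \<open>H\<close> with the rank
    one matrix of \<open>S x\<close> and \<open>Y u\<close>. Both \<open>H\<close> and
    \<open>Y u\<close> are of order \<open>s0\<close>, so the cross term is quadratic in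
    \<open>s0\<close>.\<close>
  have NSD: "\<bar>minner n k N (mmult n S D)\<bar> \<le> K * \<gamma> * (s0\<^sup>2 * \<xi>\<^sup>2)"
  proof -
    have "minner n k N (mmult n S D) = minner n n H (\<lambda>i j. mvec n S x i * cnj (mvec k Y u j))"
      unfolding N_def minner_mmult_left D_def mmult_outer outer_mmult_madj ..
    hence "\<bar>minner n k N (mmult n S D)\<bar> \<le> fnorm n n H * (cnm {..<n} (mvec n S x) * cnm {..<n} (mvec k Y u))"
      using minner_Cauchy_Schwarz[of n n H "\<lambda>i j. mvec n S x i * cnj (mvec k Y u j)"] by (simp add: fnorm_outer)
    also have "\<dots> \<le> (K * \<xi> * s0) * ((\<gamma> * \<xi>) * s0)"
      using S_opnorm[OF x] \<gamma> \<xi> s0 K_nonneg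
      by (intro mult_mono H u(3)) (simp_all add: \<gamma>_def \<xi>_def)
    finally show ?thesis by (simp add: power2_eq_square mult_ac)
  qed
  have NSN: "minner n k N (mmult n S N) \<le> \<gamma> * ((K * \<xi> * s0)\<^sup>2 * R)"
  proof -
    have "minner n k N (mmult n S N) \<le> fnorm n k N * fnorm n k (mmult n S N)"
      using minner_Cauchy_Schwarz[of n k N "mmult n S N"] by simp
    also have "\<dots> \<le> fnorm n k N * (\<gamma> * fnorm n k N)"
      using S_opnorm \<gamma> kN by (intro mult_left_mono fnorm_mmult_opnorm[where rc = rc]) (simp_all add: \<gamma>_def)
    also have "\<dots> = \<gamma> * (fnorm n k N)\<^sup>2" by (simp add: power2_eq_square)
    also have "\<dots> \<le> \<gamma> * ((K * \<xi> * s0)\<^sup>2 * R)" by (intro mult_left_mono fN \<gamma>)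
    finally show ?thesis .
  qed
  have DSN: "minner n k D (mmult n S N) = minner n k N (mmult n S D)"
    by (subst minner_mmult_sym[OF herm_S]) (simp_all add: minner_commute)
  have "- eH * \<xi>\<^sup>2 \<le> - eH * (fnorm n k P)\<^sup>2"
    using mult_left_mono[OF fP eH] by simp
  also have "\<dots> \<le> minner n k P (mmult n S P)" using sosp P by blast
  also have "\<dots> = minner n k D (mmult n S D) - minner n k D (mmult n S N)
      - (minner n k N (mmult n S D) - minner n k N (mmult n S N))"
    unfolding P_def mmult_diff_right minner_diff minner_diff_left by simp
  also have "\<dots> \<le> qform n S x + 2 * (K * \<gamma> * (s0\<^sup>2 * \<xi>\<^sup>2)) + \<gamma> * ((K * \<xi> * s0)\<^sup>2 * R)"
    using NSD NSN DSN DSD by linarith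
  \<comment> \<open>Two cross terms and the normal term combine to
    \<open>\<gamma> * K * (2 + K * R)\<close>; the bound
    \<open>\<gamma> \<le> \<beta> * (2 + K * R)\<close> then yields the square that appears in
    \<open>\<eta>\<close>.\<close>
  also have "\<dots> = qform n S x + \<gamma> * K * (2 + K * R) * s0\<^sup>2 * \<xi>\<^sup>2"
    by (simp add: power2_eq_square algebra_simps)
  also have "\<dots> \<le> qform n S x + \<beta> * K * (2 + K * R)\<^sup>2 * s0\<^sup>2 * \<xi>\<^sup>2"
  proof -
    have "\<gamma> * K * (2 + K * R) \<le> (\<beta> * (2 + K * R)) * K * (2 + K * R)"
      unfolding \<gamma>_def using \<beta>(1) K_nonneg R_nonneg by (intro mult_right_mono mult_left_mono) simp_all
    also have "\<dots> = \<beta> * K * (2 + K * R)\<^sup>2" by (simp add: power2_eq_square mult_ac)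
    finally show ?thesis by (intro add_left_mono mult_right_mono) simp_all
  qed
  finally show ?thesis by (simp add: \<xi>_def algebra_simps)
qed

text \<open>Weak duality for the shifted matrix \<open>S + l I\<close>: the shift contributes at
  most \<open>l * R\<close> on a feasible \<open>X\<close>, the multiplier term is the same for
  \<open>X\<close> and for the Gram matrix of \<open>Y\<close>, and the first order condition makes
  the pairing of \<open>S\<close> with that Gram matrix small. The slack between \<open>l\<close>
  and \<open>l'\<close> lets the caller round up the curvature defect.\<close>

lemma gap_bounds:
  assumes eg: "fnorm n k (\<lambda>a c. 2 * mmult n S Y a c) \<le> eg"
    and low: "\<And>x. kvec rc n x \<Longrightarrow> - l * (cnm {..<n} x)\<^sup>2 \<le> qform n S x" and l: "0 \<le> l" "l \<le> l'"
  shows "0 \<le> gcost n k C' Y - sdp_opt rc n m C' As b"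
    "gcost n k C' Y - sdp_opt rc n m C' As b \<le> l' * R + eg / 2 * sqrt R"
proof -
  let ?F = "(\<lambda>X. minner n n C' X) ` feas rc n m As b"
  let ?YY = "mmult k Y (madj Y)"
  have C'_S: "minner n n C' X = minner n n S X + minner n n multiplier X" for X
    unfolding S_eq minner_diff_left by simp
  have g: "gcost n k C' Y = minner n n C' ?YY" unfolding gcost_def by (rule minner_mmult_left)
  have SYY: "minner n n S ?YY \<le> eg / 2 * sqrt R"
  proof -
    have "2 * fnorm n k (mmult n S Y) \<le> eg" using eg by (simp add: fnorm_scale)
    hence e: "fnorm n k (mmult n S Y) \<le> eg / 2" by simp
    have "minner n n S ?YY = minner n k (mmult n S Y) Y" by (rule minner_mmult_left[symmetric])
    also have "\<dots> \<le> fnorm n k (mmult n S Y) * fnorm n k Y"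
      using minner_Cauchy_Schwarz[of n k "mmult n S Y" Y] by simp
    also have "\<dots> \<le> eg / 2 * sqrt R"
      using e fnorm_Y order_trans[OF fnorm_nonneg e] by (intro mult_mono) simp_all
    finally show ?thesis .
  qed
  have lower: "gcost n k C' Y - (l' * R + eg / 2 * sqrt R) \<le> minner n n C' X" if X: "X \<in> feas rc n m As b" for X
  proof -
    have mult: "minner n n multiplier X = minner n n multiplier ?YY"
      using X gram_feasible unfolding multiplier_def minner_Aadj by (simp add: feas_def)
    define T where "T = (\<lambda>i j. S i j + complex_of_real l * (if i = j then 1 else 0))"
    have Tx: "mvec n T x i = mvec n S x i + complex_of_real l * x i" if "i < n" for x i
      using that by (simp add: T_def mvec_def distrib_right sum.distrib if_distrib[of "\<lambda>z. z * _"] if_distrib[of "\<lambda>z. _ * z"] cong: if_cong)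
    have "qform n T x = qform n S x + l * (cnm {..<n} x)\<^sup>2" for x
    proof -
      have "cip {..<n} x (mvec n T x) = cip {..<n} x (\<lambda>i. mvec n S x i + complex_of_real l * x i)"
        by (rule cip_cong) (simp_all add: Tx)
      thus ?thesis unfolding qform_def cip_add_right cip_scale_right cip_self by simp
    qed
    hence "0 \<le> qform n T x" if "kvec rc n x" for x using low[OF that] by simp
    hence "0 \<le> minner n n T X" using X by (intro psd_duality[where rc = rc]) (auto simp: feas_def)
    also have "minner n n T X = minner n n S X + l * Re (mtrace n X)"
    proof -
      have "minner n n T X = minner n n S X + minner n n (\<lambda>i j. complex_of_real l * (if i = j then 1 else 0)) X"
        unfolding T_def by (simp only: minner_commute[of _ _ _ X] minner_add)
      also have "minner n n (\<lambda>i j. complex_of_real l * (if i = j then 1 else 0)) X = l * Re (mtrace n X)"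
        unfolding minner_commute[of _ _ _ X] minner_scale
        by (simp add: minner_def mtrace_def if_distrib[of "\<lambda>z. _ * z"] if_distrib[of Re] cong: if_cong)
      finally show ?thesis .
    qed
    also have "\<dots> \<le> minner n n S X + l' * R"
    proof -
      have "l * Re (mtrace n X) \<le> l * R" using trace_le X l by (intro mult_left_mono) auto
      also have "\<dots> \<le> l' * R" using l R_nonneg by (intro mult_right_mono) auto
      finally show ?thesis by simp
    qed
    finally show ?thesis using SYY mult unfolding g C'_S by linarith
  qed
  \<comment> \<open>The \<open>Inf\<close> in \<open>sdp_opt\<close> is meaningful only for a set
    bounded below; the estimate \<open>lower\<close> supplies the bound.\<close>
  have bdd: "bdd_below ?F" using lower by (intro bdd_belowI2)
  have "sdp_opt rc n m C' As b \<le> minner n n C' ?YY"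
    unfolding sdp_opt_def by (intro cINF_lower bdd gram_feasible)
  thus "0 \<le> gcost n k C' Y - sdp_opt rc n m C' As b" by (simp add: g)
  have "gcost n k C' Y - (l' * R + eg / 2 * sqrt R) \<le> sdp_opt rc n m C' As b"
    unfolding sdp_opt_def using gram_feasible lower by (intro cINF_greatest) auto
  thus "gcost n k C' Y - sdp_opt rc n m C' As b \<le> l' * R + eg / 2 * sqrt R" by simp
qed

end

section \<open>Smoothed analysis\<close>

lemma vnorm_eq_cnm: "vnorm n x = cnm {..<n} x"
  by (simp add: vnorm_def cnm_def L2_set_def)

lemma cnm_kvec_pos:
  assumes x: "kvec rc n x" and ne: "x \<noteq> (\<lambda>_. 0)"
  shows "0 < cnm {..<n} x"
proof (rule ccontr)
  assume "\<not> 0 < cnm {..<n} x"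
  hence "cnm {..<n} x = 0" using cnm_nonneg[of "{..<n}" x] by linarith
  hence "x i = 0" if "i < n" for i using that by (simp add: cnm_eq_0_iff)
  hence "x i = 0" for i using x unfolding kvec_def by blast
  thus False using ne by blast
qed

lemma specnorm_bdd:
  "bdd_above {vnorm n (mvec n A x) / vnorm n x | x. kvec rc n x \<and> x \<noteq> (\<lambda>_. 0)}"
proof (rule bdd_aboveI)
  fix y assume "y \<in> {vnorm n (mvec n A x) / vnorm n x | x. kvec rc n x \<and> x \<noteq> (\<lambda>_. 0)}"
  then obtain x where x: "y = vnorm n (mvec n A x) / vnorm n x" "kvec rc n x" "x \<noteq> (\<lambda>_. 0)" by blast
  thus "y \<le> fnorm n n A"
    using cnm_kvec_pos[OF x(2,3)] mvec_le_fnorm[of n n A x] by (simp add: vnorm_eq_cnm divide_le_eq)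
qed

lemma specnorm_bound:
  assumes x: "kvec rc n x"
  shows "cnm {..<n} (mvec n A x) \<le> specnorm rc n A * cnm {..<n} x"
proof (cases "x = (\<lambda>_. 0)")
  case True
  thus ?thesis by (simp add: mvec_def)
next
  case False
  have "cnm {..<n} (mvec n A x) / cnm {..<n} x \<le> specnorm rc n A"
    unfolding specnorm_def using specnorm_bdd[of n A rc] x False
    by (intro cSup_upper) (auto simp: vnorm_eq_cnm)
  thus ?thesis using cnm_kvec_pos[OF x False] by (simp add: divide_le_eq)
qed

lemma cnm_unitv:
  assumes "p < n"
  shows "cnm {..<n} (unitv p) = 1"
proof -
  have "(cnm {..<n} (unitv p))\<^sup>2 = (\<Sum>i<n. if i = p then 1 else 0)"
    unfolding cnm_sq unitv_def by (intro sum.cong) auto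
  hence "(cnm {..<n} (unitv p))\<^sup>2 = 1\<^sup>2" using assms by simp
  thus ?thesis by (simp only: power2_eq_iff_nonneg cnm_nonneg zero_le_one)
qed

lemma specnorm_nonneg:
  assumes "1 \<le> n"
  shows "0 \<le> specnorm rc n A"
proof -
  have "0 \<le> cnm {..<n} (mvec n A (unitv 0))" by simp
  also have "\<dots> \<le> specnorm rc n A * cnm {..<n} (unitv 0)"
    using assms by (intro specnorm_bound kvec_unitv) simp
  finally show ?thesis using assms by (simp add: cnm_unitv)
qed

lemma kmat_wigner: "kmat rc n n (wigner rc n \<sigma> \<omega>)"
  by (auto simp: kmat_def wigner_def wig_entry_def Kset_def)

text \<open>Gram-Schmidt over the reals, dropping vanishing residuals. Both changes of basis are
  recorded: writing \<open>B\<close> in terms of \<open>a\<close> transfers Hermitian symmetry to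
  the basis, writing \<open>a\<close> in terms of \<open>B\<close> gives coordinates to multiplier
  matrices.\<close>

lemma real_orthonormal_basis:
  fixes a :: "nat \<Rightarrow> 'a \<Rightarrow> complex"
  assumes fin: "finite I"
  shows "\<exists>r\<le>m. \<exists>B. (\<forall>i<r. \<forall>j<r. rip I (B i) (B j) = (if i = j then 1 else 0))
    \<and> (\<forall>j<r. \<exists>d. B j = (\<lambda>p. \<Sum>l<m. complex_of_real (d l) * a l p))
    \<and> (\<forall>l<m. \<exists>c. \<forall>p\<in>I. a l p = (\<Sum>j<r. complex_of_real (c j) * B j p))"
proof (induction m)
  case (Suc m)
  then obtain r B where r: "r \<le> m"
    and orth: "\<And>i j. i < r \<Longrightarrow> j < r \<Longrightarrow> rip I (B i) (B j) = (if i = j then 1 else 0)"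
    and d: "\<forall>j<r. \<exists>d. B j = (\<lambda>p. \<Sum>l<m. complex_of_real (d l) * a l p)"
    and c: "\<And>l. l < m \<Longrightarrow> \<exists>c. \<forall>p\<in>I. a l p = (\<Sum>j<r. complex_of_real (c j) * B j p)"
    by blast
  obtain d where d: "\<And>j. j < r \<Longrightarrow> B j = (\<lambda>p. \<Sum>l<m. complex_of_real (d j l) * a l p)"
    using d by metis
  define e where "e j = rip I (B j) (a m)" for j
  define res where "res p = a m p - (\<Sum>j<r. complex_of_real (e j) * B j p)" for p
  define N where "N = cnm I res"
  have ext: "\<exists>d'. (\<lambda>p. \<Sum>l<m. complex_of_real (d j l) * a l p) = (\<lambda>p. \<Sum>l<Suc m. complex_of_real (d' l) * a l p)" for j
    by (rule exI[of _ "(d j)(m := 0)"]) simp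
  show ?case
  proof (cases "N = 0")
    case True
    hence "\<forall>p\<in>I. a m p = (\<Sum>j<r. complex_of_real (e j) * B j p)"
      using cnm_eq_0_iff[OF fin, of res] by (simp add: N_def res_def)
    hence "\<forall>l<Suc m. \<exists>c. \<forall>p\<in>I. a l p = (\<Sum>j<r. complex_of_real (c j) * B j p)"
      using c by (auto simp: less_Suc_eq)
    moreover have "\<forall>j<r. \<exists>d. B j = (\<lambda>p. \<Sum>l<Suc m. complex_of_real (d l) * a l p)"
      using d ext by auto
    ultimately show ?thesis using r orth by (intro exI[of _ r] conjI exI[of _ B]) auto
  next
    case False
    hence N: "0 < N" by (simp add: N_def less_le)
    define B' where "B' j = (if j = r then (\<lambda>p. complex_of_real (1 / N) * res p) else B j)" for j
    have Bres: "rip I (B i) res = 0" if "i < r" for i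
    proof -
      have "rip I (B i) res = e i - (\<Sum>j<r. e j * rip I (B i) (B j))"
        unfolding res_def[abs_def] rip_diff_right rip_sum_right by (simp add: e_def)
      also have "(\<Sum>j<r. e j * rip I (B i) (B j)) = (\<Sum>j<r. if i = j then e j else 0)"
        using orth[OF that] by (intro sum.cong) auto
      finally show ?thesis using that by simp
    qed
    have orth': "rip I (B' i) (B' j) = (if i = j then 1 else 0)" if "i < Suc r" "j < Suc r" for i j
    proof -
      have 1: "rip I (\<lambda>p. complex_of_real (1 / N) * res p) (\<lambda>p. complex_of_real (1 / N) * res p) = 1"
        unfolding cip_scale_left cip_scale_right cip_self N_def[symmetric] using N
        by (simp add: power2_eq_square flip: of_real_mult of_real_divide)
      have 2: "rip I (B i) (\<lambda>p. complex_of_real (1 / N) * res p) = 0" if "i < r" for i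
        unfolding cip_scale_right using Bres[OF that] by simp
      have 3: "rip I (\<lambda>p. complex_of_real (1 / N) * res p) (B i) = 0" if "i < r" for i
        using 2[OF that] rip_commute by metis
      show ?thesis using that 1 2 3 orth unfolding B'_def less_Suc_eq by auto
    qed
    have dres: "\<exists>d'. B' j = (\<lambda>p. \<Sum>l<Suc m. complex_of_real (d' l) * a l p)" if "j < Suc r" for j
    proof (cases "j = r")
      case False
      thus ?thesis using d[of j] ext[of j] that by (simp add: B'_def)
    next
      case True
      define d' where "d' l = (if l = m then 1 / N else - (1 / N) * (\<Sum>j<r. e j * d j l))" for l
      have "(\<Sum>j<r. complex_of_real (e j) * B j p) = (\<Sum>l<m. complex_of_real (\<Sum>j<r. e j * d j l) * a l p)" for p
      proof -
        have "(\<Sum>j<r. complex_of_real (e j) * B j p) = (\<Sum>j<r. \<Sum>l<m. complex_of_real (e j * d j l) * a l p)"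
          using d by (intro sum.cong refl) (simp add: sum_distrib_left mult.assoc)
        also have "\<dots> = (\<Sum>l<m. complex_of_real (\<Sum>j<r. e j * d j l) * a l p)"
          by (subst sum.swap) (simp add: sum_distrib_right)
        finally show ?thesis .
      qed
      hence res: "res p = a m p - (\<Sum>l<m. complex_of_real (\<Sum>j<r. e j * d j l) * a l p)" for p
        by (simp only: res_def)
      have "complex_of_real (1 / N) * res p = (\<Sum>l<Suc m. complex_of_real (d' l) * a l p)" for p
      proof -
        have "(\<Sum>l<m. complex_of_real (d' l) * a l p)
            = (\<Sum>l<m. - complex_of_real (1 / N) * (complex_of_real (\<Sum>j<r. e j * d j l) * a l p))"
          by (intro sum.cong refl) (simp add: d'_def del: of_real_sum)
        also have "\<dots> = - complex_of_real (1 / N) * (\<Sum>l<m. complex_of_real (\<Sum>j<r. e j * d j l) * a l p)"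
          by (rule sum_distrib_left[symmetric])
        finally show ?thesis unfolding res by (simp add: d'_def right_diff_distrib del: of_real_sum)
      qed
      hence "B' j = (\<lambda>p. \<Sum>l<Suc m. complex_of_real (d' l) * a l p)"
        unfolding B'_def True by simp
      thus ?thesis by blast
    qed
    have cres: "\<exists>c. \<forall>p\<in>I. a l p = (\<Sum>j<Suc r. complex_of_real (c j) * B' j p)" if "l < Suc m" for l
    proof (cases "l = m")
      case True
      have "a m p = (\<Sum>j<Suc r. complex_of_real ((e(r := N)) j) * B' j p)" for p
        using N by (simp add: B'_def res_def)
      thus ?thesis using True by blast
    next
      case False
      hence "l < m" using that by simp
      then obtain c' where "\<forall>p\<in>I. a l p = (\<Sum>j<r. complex_of_real (c' j) * B j p)"
        using c by blast
      hence "\<forall>p\<in>I. a l p = (\<Sum>j<Suc r. complex_of_real ((c'(r := 0)) j) * B' j p)"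
        by (simp add: B'_def)
      thus ?thesis by blast
    qed
    have "(\<forall>i<Suc r. \<forall>j<Suc r. rip I (B' i) (B' j) = (if i = j then 1 else 0))
      \<and> (\<forall>j<Suc r. \<exists>d. B' j = (\<lambda>p. \<Sum>l<Suc m. complex_of_real (d l) * a l p))
      \<and> (\<forall>l<Suc m. \<exists>c. \<forall>p\<in>I. a l p = (\<Sum>j<Suc r. complex_of_real (c j) * B' j p))"
      using orth' dres cres by blast
    moreover have "Suc r \<le> Suc m" using r by simp
    ultimately show ?thesis by blast
  qed
qed (auto intro!: exI[of _ "0 :: nat"])

lemma cnm_sq_real_orthonormal:
  fixes B :: "nat \<Rightarrow> 'a \<Rightarrow> complex"
  assumes "\<And>i j. i < r \<Longrightarrow> j < r \<Longrightarrow> rip I (B i) (B j) = (if i = j then 1 else 0)"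
  shows "(cnm I (\<lambda>p. \<Sum>j<r. complex_of_real (c j) * B j p))\<^sup>2 = (\<Sum>j<r. (c j)\<^sup>2)"
proof -
  have "rip I (B i) (\<lambda>p. \<Sum>j<r. complex_of_real (c j) * B j p) = c i" if "i < r" for i
  proof -
    have "rip I (B i) (\<lambda>p. \<Sum>j<r. complex_of_real (c j) * B j p) = (\<Sum>j<r. if i = j then c j else 0)"
      unfolding rip_sum_right using assms[OF that] by (intro sum.cong) auto
    thus ?thesis using that by simp
  qed
  thus ?thesis unfolding rip_self[symmetric] rip_sum_left
    by (intro sum.cong) (auto simp: power2_eq_square)
qed

text \<open>The net consists of matrices rather than of multipliers: for dependent \<open>As\<close>
  a bound on the matrix does not bound \<open>\<nu>\<close>. An orthonormal basis of the real span
  gives the exponent \<open>m\<close>, and its Hermitian elements make every net point an admissible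
  shift in \<open>overcrowding\<close>.\<close>

lemma multiplier_net:
  assumes As: "\<forall>i<m. sadj rc n (As i)" and s: "0 < s" and \<rho>: "0 \<le> \<rho>"
  shows "\<exists>F :: cmat set. finite F \<and> real (card F) \<le> (exp 1 * (3 + 2 * \<rho> / s)) ^ m
    \<and> (\<forall>G\<in>F. \<forall>i<n. \<forall>j<n. G j i = cnj (G i j))
    \<and> (\<forall>\<nu>. fnorm n n (Aadj m As \<nu>) \<le> \<rho> \<longrightarrow> (\<exists>G\<in>F. fnorm n n (\<lambda>i j. Aadj m As \<nu> i j - G i j) \<le> s))"
proof -
  let ?a = "\<lambda>l. case_prod (As l)"
  obtain r B where r: "r \<le> m"
    and orth: "\<And>i j. i < r \<Longrightarrow> j < r \<Longrightarrow> rip (mbox n n) (B i) (B j) = (if i = j then 1 else 0)"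
    and d: "\<forall>j<r. \<exists>d. B j = (\<lambda>p. \<Sum>l<m. complex_of_real (d l) * ?a l p)"
    and c: "\<forall>l<m. \<exists>c. \<forall>p\<in>mbox n n. ?a l p = (\<Sum>j<r. complex_of_real (c j) * B j p)"
    using real_orthonormal_basis[of "mbox n n" m ?a] by auto
  obtain d where d: "\<And>j. j < r \<Longrightarrow> B j = (\<lambda>p. \<Sum>l<m. complex_of_real (d j l) * ?a l p)"
    using d by metis
  obtain c where c: "\<And>l p. l < m \<Longrightarrow> p \<in> mbox n n \<Longrightarrow> ?a l p = (\<Sum>j<r. complex_of_real (c l j) * B j p)"
    using c by metis
  have Bh: "B q (j, i) = cnj (B q (i, j))" if "i < n" "j < n" "q < r" for i j q
  proof -
    have "As l j i = cnj (As l i j)" if "l < m" for l using As that \<open>i < n\<close> \<open>j < n\<close> unfolding sadj_def by blast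
    thus ?thesis unfolding d[OF that(3)] by simp
  qed
  have "finite {..<r}" by simp
  from ball_net[OF this s \<rho>] obtain F0 where F0: "finite F0"
    "real (card F0) \<le> (exp 1 * (3 + 2 * \<rho> / s)) ^ card {..<r}"
    "\<And>c :: nat \<Rightarrow> real. (\<Sum>i<r. (c i)\<^sup>2) \<le> \<rho>\<^sup>2 \<Longrightarrow> \<exists>f\<in>F0. (\<Sum>i<r. (c i - f i)\<^sup>2) \<le> s\<^sup>2"
    by blast
  define g where "g f i j = (\<Sum>q<r. complex_of_real (f q) * B q (i, j))" for f :: "nat \<Rightarrow> real" and i j
  have "real (card (g ` F0)) \<le> real (card F0)" using card_image_le[OF F0(1)] by simp
  also have "\<dots> \<le> (exp 1 * (3 + 2 * \<rho> / s)) ^ r" using F0(2) by simp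
  also have "\<dots> \<le> (exp 1 * (3 + 2 * \<rho> / s)) ^ m"
  proof (rule power_increasing[OF r])
    have "1 * 1 \<le> exp 1 * (3 + 2 * \<rho> / s)" using s \<rho> by (intro mult_mono) auto
    thus "1 \<le> exp 1 * (3 + 2 * \<rho> / s)" by simp
  qed
  finally have card: "real (card (g ` F0)) \<le> (exp 1 * (3 + 2 * \<rho> / s)) ^ m" .
  have net: "\<exists>G\<in>g ` F0. fnorm n n (\<lambda>i j. Aadj m As \<nu> i j - G i j) \<le> s" if \<nu>: "fnorm n n (Aadj m As \<nu>) \<le> \<rho>" for \<nu>
  proof -
    define x where "x j = (\<Sum>l<m. \<nu> l * c l j)" for j
    have eq: "case_prod (Aadj m As \<nu>) p = (\<Sum>j<r. complex_of_real (x j) * B j p)" if p: "p \<in> mbox n n" for p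
    proof -
      have "case_prod (Aadj m As \<nu>) p = (\<Sum>l<m. complex_of_real (\<nu> l) * ?a l p)"
        by (simp add: Aadj_def case_prod_beta)
      also have "\<dots> = (\<Sum>l<m. \<Sum>j<r. complex_of_real (\<nu> l * c l j) * B j p)"
        using p by (intro sum.cong refl) (simp add: c sum_distrib_left mult.assoc)
      also have "\<dots> = (\<Sum>j<r. complex_of_real (x j) * B j p)"
        by (subst sum.swap) (simp add: x_def sum_distrib_right)
      finally show ?thesis .
    qed
    have "(\<Sum>j<r. (x j)\<^sup>2) = (cnm (mbox n n) (\<lambda>p. \<Sum>j<r. complex_of_real (x j) * B j p))\<^sup>2"
      by (rule cnm_sq_real_orthonormal[symmetric]) (rule orth)
    also have "\<dots> = (fnorm n n (Aadj m As \<nu>))\<^sup>2"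
      unfolding fnorm_eq_cnm by (rule arg_cong[where f = "\<lambda>x. x\<^sup>2"], rule cnm_cong, rule eq[symmetric])
    also have "\<dots> \<le> \<rho>\<^sup>2" using \<nu> by (intro power_mono) simp_all
    finally obtain f where f: "f \<in> F0" "(\<Sum>i<r. (x i - f i)\<^sup>2) \<le> s\<^sup>2" using F0(3) by blast
    have "(fnorm n n (\<lambda>i j. Aadj m As \<nu> i j - g f i j))\<^sup>2
        = (cnm (mbox n n) (\<lambda>p. \<Sum>j<r. complex_of_real (x j - f j) * B j p))\<^sup>2"
      unfolding fnorm_eq_cnm
    proof (rule arg_cong[where f = "\<lambda>x. x\<^sup>2"], rule cnm_cong)
      fix p assume p: "p \<in> mbox n n"
      have "(\<lambda>(i, j). Aadj m As \<nu> i j - g f i j) p = case_prod (Aadj m As \<nu>) p - case_prod (g f) p"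
        by (simp add: case_prod_beta)
      also have "\<dots> = (\<Sum>j<r. complex_of_real (x j - f j) * B j p)"
        unfolding eq[OF p] by (simp add: g_def case_prod_beta left_diff_distrib sum_subtractf)
      finally show "(\<lambda>(i, j). Aadj m As \<nu> i j - g f i j) p = (\<Sum>j<r. complex_of_real (x j - f j) * B j p)" .
    qed
    also have "\<dots> = (\<Sum>j<r. (x j - f j)\<^sup>2)"
      by (rule cnm_sq_real_orthonormal) (rule orth)
    finally have "(fnorm n n (\<lambda>i j. Aadj m As \<nu> i j - g f i j))\<^sup>2 \<le> s\<^sup>2" using f(2) by simp
    hence "fnorm n n (\<lambda>i j. Aadj m As \<nu> i j - g f i j) \<le> s"
      using s power2_le_imp_le[of "fnorm n n (\<lambda>i j. Aadj m As \<nu> i j - g f i j)" s] by simp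
    thus ?thesis using f(1) by blast
  qed
  have herm: "g f j i = cnj (g f i j)" if "i < n" "j < n" for f i j
  proof -
    have "g f j i = (\<Sum>q<r. complex_of_real (f q) * cnj (B q (i, j)))"
      unfolding g_def using Bh[OF that] by (intro sum.cong refl) simp
    thus ?thesis by (simp add: g_def)
  qed
  show ?thesis
  proof (rule exI[of _ "g ` F0"], intro conjI)
    show "\<forall>G\<in>g ` F0. \<forall>i<n. \<forall>j<n. G j i = cnj (G i j)"
      by (intro ballI allI impI, elim imageE, hypsubst, rule herm)
    show "\<forall>\<nu>. fnorm n n (Aadj m As \<nu>) \<le> \<rho> \<longrightarrow> (\<exists>G\<in>g ` F0. fnorm n n (\<lambda>i j. Aadj m As \<nu> i j - G i j) \<le> s)"
      using net by blast
  qed (use F0(1) card in simp_all)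
qed

text \<open>The factor \<open>exp (- 45)\<close> beats the factors \<open>n \<le> exp k\<close> and \<open>exp (12 k)\<close> of the recursion,
  which is run for half of the dimensions only.\<close>
lemma overcrowding:
  assumes \<sigma>: "0 < \<sigma>" and k: "3 \<le> k" "k \<le> n" "3 * ln (real n) \<le> real k"
    and B: "\<And>a b. a < n \<Longrightarrow> b < n \<Longrightarrow> B b a = cnj (B a b)"
  shows "measure (wig_space n) (shifted_degenerate rc n \<sigma> B {..<n} k (exp (- 45) * real k * \<sigma> / sqrt (real n)) (frames rc {..<n} k))
    \<le> exp (- (real k)\<^sup>2)"
proof -
  interpret prob_space "wig_space n" unfolding wig_space_gauss by (rule prob_space_gauss)
  define t :: real where "t = exp (- 45)"
  define \<epsilon> where "\<epsilon> = t * real k * \<sigma> / sqrt (real n)"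
  \<comment> \<open>Makes \<open>l * \<sigma>\<^sup>2 / 2\<close> equal to
    \<open>1 / t\<^sup>2\<close>: each dimension then contributes a factor at most \<open>t\<close>,
    while the loss in Markov's inequality has exponent \<open>4 * k\<^sup>2 / e\<close>.\<close>
  define l where "l = 2 / (t\<^sup>2 * \<sigma>\<^sup>2)"
  define e where "e = k div 2"
  define j where "j = k - e"
  have t: "0 < t" by (simp add: t_def)
  have n: "0 < real n" using k by simp
  have l: "0 \<le> l" by (simp add: l_def)
  have e: "1 \<le> e" "k = e + j" using k by (auto simp: e_def j_def)
  \<comment> \<open>The rounding in \<open>k div 2\<close> is worst at \<open>k = 3\<close>, where
    \<open>e = 1\<close>. This factor 3 turns \<open>4 * k\<^sup>2 / e\<close> into
    \<open>12 * k\<close> and \<open>45 * e\<close> into \<open>15 * k\<close>.\<close>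
  have "k \<le> 3 * e" using k unfolding e_def by presburger
  hence e3: "real k \<le> 3 * real e" by linarith
  have "k \<le> 2 * j" unfolding j_def e_def by presburger
  hence j2: "real k \<le> 2 * real j" by linarith
  define q where "q = exp (l * (2 * \<epsilon>\<^sup>2 * real n / real e)) * (1 / sqrt (1 + l * (\<sigma>\<^sup>2 / 2))) ^ e"
  have "l * (2 * \<epsilon>\<^sup>2 * real n / real e) = 4 * (real k)\<^sup>2 / real e"
  proof -
    have "\<epsilon>\<^sup>2 * real n = (t\<^sup>2 * \<sigma>\<^sup>2) * (real k)\<^sup>2"
      using n by (simp add: \<epsilon>_def power_mult_distrib power_divide)
    moreover have "t\<^sup>2 * \<sigma>\<^sup>2 \<noteq> 0" using t \<sigma> by simp
    ultimately show ?thesis by (simp add: l_def mult.assoc)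
  qed
  also have "\<dots> \<le> 12 * real k"
    using e3 e(1) mult_left_mono[OF e3, of "4 * real k"] by (simp add: divide_le_eq power2_eq_square mult_ac)
  finally have q1: "exp (l * (2 * \<epsilon>\<^sup>2 * real n / real e)) \<le> exp (12 * real k)" by simp
  have q2: "(1 / sqrt (1 + l * (\<sigma>\<^sup>2 / 2))) ^ e \<le> exp (- (15 * real k))"
  proof -
    have "1 / t = sqrt (1 / t\<^sup>2)" using t by (simp add: real_sqrt_divide)
    also have "\<dots> \<le> sqrt (1 + l * (\<sigma>\<^sup>2 / 2))"
      using \<sigma> by (intro real_sqrt_le_mono) (simp add: l_def)
    finally have "inverse (sqrt (1 + l * (\<sigma>\<^sup>2 / 2))) \<le> inverse (1 / t)"
      using t by (intro le_imp_inverse_le) simp_all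
    hence "1 / sqrt (1 + l * (\<sigma>\<^sup>2 / 2)) \<le> t" by (simp add: inverse_eq_divide)
    hence "(1 / sqrt (1 + l * (\<sigma>\<^sup>2 / 2))) ^ e \<le> t ^ e" using l by (intro power_mono) auto
    also have "t ^ e = exp (real e * (- 45))" unfolding t_def by (rule exp_of_nat_mult[symmetric])
    also have "\<dots> \<le> exp (- (15 * real k))" using e3 by simp
    finally show ?thesis .
  qed
  have q0: "0 \<le> q" unfolding q_def using l by simp
  have "ln (real n) \<le> real k" using k by linarith
  hence "real n \<le> exp (real k)" using n by (metis exp_le_cancel_iff exp_ln)
  moreover have "q \<le> exp (12 * real k) * exp (- (15 * real k))"
    unfolding q_def by (intro mult_mono q1 q2) (use l in auto)
  ultimately have "real n * q \<le> exp (real k) * (exp (12 * real k) * exp (- (15 * real k)))"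
    using q0 by (intro mult_mono) auto
  also have "\<dots> = exp (- (2 * real k))" by (simp flip: exp_add)
  finally have "(real n * q) ^ j \<le> exp (- (2 * real k)) ^ j" using q0 by (intro power_mono) auto
  also have "\<dots> = exp (real j * (- (2 * real k)))" by (rule exp_of_nat_mult[symmetric])
  also have "\<dots> \<le> exp (- (real k)\<^sup>2)"
    using mult_right_mono[OF j2, of "real k"] by (simp add: power2_eq_square mult_ac)
  finally have le: "(real n * q) ^ j \<le> exp (- (real k)\<^sup>2)" .
  have "emeasure (wig_space n) (shifted_degenerate rc n \<sigma> B {..<n} (e + j) \<epsilon> (frames rc {..<n} (e + j))) \<le> ennreal ((real n * q) ^ j)"
    unfolding q_def
  proof (rule shifted_degenerate_bound[OF subset_refl l e(1)])
    show "B b a = cnj (B a b)" if "a < n" "b < n" for a b using that by (rule B)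
  qed
  also have "\<dots> \<le> ennreal (exp (- (real k)\<^sup>2))" by (rule ennreal_leI[OF le])
  finally show ?thesis unfolding e(2)[symmetric] unfolding \<epsilon>_def t_def by (simp add: emeasure_eq_measure)
qed

section \<open>The two alternatives for a second order point\<close>

lemma cnm_normalized:
  assumes "kvec rc k h" "h \<noteq> (\<lambda>_. 0)"
  shows "kvec rc k (\<lambda>j. complex_of_real (1 / cnm {..<k} h) * h j)"
    "cnm {..<k} (\<lambda>j. complex_of_real (1 / cnm {..<k} h) * h j) = 1"
  using cnm_kvec_pos[OF assms] assms(1) unfolding cnm_scale kvec_def
  by (auto intro!: Kset_closed simp del: of_real_divide)

lemma comb_columns: "comb k (\<lambda>c i. Y i c) h = mvec k Y h"
  by (simp add: comb_def mvec_def mult.commute)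

text \<open>The alternative in which \<open>Y\<close> nearly annihilates a unit vector;
  \<open>e\<close> is the room into which the curvature defect has to fit.\<close>

lemma (in sdp_cost_point) sosp_gap:
  assumes sosp: "is_sosp rc n k m As b C' eg eH Y" and eH: "0 \<le> eH"
    and u: "kvec rc k u" "cnm {..<k} u = 1" "cnm {..<n} (mvec k Y u) \<le> s0"
    and e: "\<beta> * K * (2 + K * R)\<^sup>2 * s0\<^sup>2 \<le> e"
  shows "0 \<le> gcost n k C' Y - sdp_opt rc n m C' As b"
    "gcost n k C' Y - sdp_opt rc n m C' As b \<le> (eH + e) * R + eg / 2 * sqrt R"
proof -
  have so: "fnorm n k (\<lambda>a c. 2 * mmult n S Y a c) \<le> eg"
    "\<forall>D \<in> tangent rc n k m As Y. minner n k D (mmult n S D) \<ge> - eH * (fnorm n k D)\<^sup>2"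
    using sosp unfolding is_sosp_def S_def by blast+
  have l: "0 \<le> eH + \<beta> * K * (2 + K * R)\<^sup>2 * s0\<^sup>2"
    using eH \<beta>(1) K_nonneg by (intro add_nonneg_nonneg mult_nonneg_nonneg) simp_all
  show "0 \<le> gcost n k C' Y - sdp_opt rc n m C' As b"
    "gcost n k C' Y - sdp_opt rc n m C' As b \<le> (eH + e) * R + eg / 2 * sqrt R"
    using gap_bounds[OF so(1) curvature_lower_bound[OF so(2) eH u] l, of "eH + e"] e by simp_all
qed

text \<open>The other alternative. If \<open>w = Y f\<close>, then \<open>S w\<close> is at most
  \<open>\<theta> * s0\<close> times the norm of \<open>f\<close>, hence at most
  \<open>\<theta>\<close> times the norm of \<open>w\<close>. Replacing the multiplier by a net
  point costs a second \<open>\<theta>\<close>, and the third is the slack demanded by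
  \<open>degenerate\<close>.\<close>

lemma (in sdp_cost_point) full_rank_degenerate:
  assumes eg: "fnorm n k (\<lambda>a c. 2 * mmult n S Y a c) \<le> 2 * \<theta> * s0" and \<theta>: "0 < \<theta>" and s0: "0 \<le> s0"
    and full: "\<And>u. kvec rc k u \<Longrightarrow> cnm {..<k} u = 1 \<Longrightarrow> s0 < cnm {..<n} (mvec k Y u)"
    and G: "fnorm n n (\<lambda>i j. multiplier i j - G i j) \<le> \<theta>"
  shows "(\<lambda>i j. C' i j - G i j) \<in> degenerate rc {..<n} k (3 * \<theta>) (frames rc {..<n} k)"
proof -
  let ?v = "\<lambda>c i. Y i c"
  have trunc: "\<exists>f. kvec rc k f \<and> (\<forall>a<k. f a = h a)" if "\<forall>a<k. h a \<in> Kset rc" for h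
    by (rule exI[of _ "\<lambda>a. if a < k then h a else 0"]) (use that in \<open>simp add: kvec_def\<close>)
  have full': "s0 * cnm {..<k} f \<le> cnm {..<n} (mvec k Y f) \<and> (f \<noteq> (\<lambda>_. 0) \<longrightarrow> 0 < cnm {..<n} (mvec k Y f))"
    if f: "kvec rc k f" for f
  proof (cases "f = (\<lambda>_. 0)")
    case False
    define N where "N = cnm {..<k} f"
    have N: "0 < N" unfolding N_def by (rule cnm_kvec_pos[OF f False])
    have "s0 < cnm {..<n} (mvec k Y (\<lambda>j. complex_of_real (1 / N) * f j))"
      unfolding N_def by (rule full[OF cnm_normalized[OF f False]])
    also have "\<dots> = 1 / N * cnm {..<n} (mvec k Y f)"
      unfolding mvec_scale cnm_scale using N by (simp add: norm_divide)
    finally have "s0 * N < cnm {..<n} (mvec k Y f)" using N by (simp add: field_simps)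
    moreover have "0 \<le> s0 * N" using s0 N by simp
    ultimately show ?thesis unfolding N_def by simp
  qed simp
  have YK: "Y i c \<in> Kset rc" for i c
    using kmat_Y Kset_closed(1)[of rc] unfolding kmat_def by (cases "i < n \<and> c < k") auto
  have Y0: "Y i c = 0" if "i \<notin> {..<n}" for i c
    using kmat_Y that unfolding kmat_def by simp
  \<comment> \<open>No prescribed equations here: this only orthonormalises the range of
    \<open>Y\<close>.\<close>
  have "\<exists>g. (\<forall>b<k. \<forall>a. g b a \<in> Kset rc) \<and> (\<forall>b<k. \<forall>e<0::nat. (\<Sum>a<k. (\<lambda>_ _. 0) e a * g b a) = 0)
     \<and> (\<lambda>b. comb k ?v (g b)) \<in> frames rc {..<n} k"
  proof (rule orthonormal_frame_in_span)
    fix h :: "nat \<Rightarrow> complex" assume h: "\<forall>a. h a \<in> Kset rc" "\<exists>a<k. h a \<noteq> 0"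
    obtain f where f: "kvec rc k f" "\<forall>a<k. f a = h a" using trunc h(1) by blast
    have "f \<noteq> (\<lambda>_. 0)" using f(2) h(2) by auto
    hence "0 < cnm {..<n} (mvec k Y f)" using full'[OF f(1)] by simp
    hence "cnm {..<n} (comb k ?v h) \<noteq> 0" using f(2) by (simp add: comb_columns mvec_def)
    thus "\<exists>i\<in>{..<n}. comb k ?v h i \<noteq> 0" by (simp add: cnm_eq_0_iff)
  qed (use YK Y0 Kset_closed(1) in simp_all)
  then obtain g where g: "\<forall>b<k. \<forall>a. g b a \<in> Kset rc" "(\<lambda>b. comb k ?v (g b)) \<in> frames rc {..<n} k"
    by blast
  define u where "u b = comb k ?v (g b)" for b
  have u: "u \<in> frames rc {..<n} k" using g(2) by (simp add: u_def[abs_def])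
  have "almost_kernel rc {..<n} k (2 * \<theta>) (\<lambda>i j. C' i j - G i j) u"
    unfolding almost_kernel_def
  proof (intro allI impI)
    fix h assume h: "\<forall>a<k. h a \<in> Kset rc"
    define w where "w = comb k u h"
    have hg: "\<forall>a<k. (\<Sum>b<k. h b * g b a) \<in> Kset rc" using g(1) h by (auto intro!: Kset_sum Kset_closed)
    obtain f where f: "kvec rc k f" "\<forall>a<k. f a = (\<Sum>b<k. h b * g b a)" using trunc[OF hg] by blast
    have w: "w = mvec k Y f"
    proof
      fix i
      have "w i = (\<Sum>b<k. \<Sum>a<k. h b * g b a * Y i a)"
        unfolding w_def u_def comb_def sum_distrib_left by (simp only: mult.assoc)
      also have "\<dots> = (\<Sum>a<k. \<Sum>b<k. h b * g b a * Y i a)" by (rule sum.swap)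
      also have "\<dots> = mvec k Y f i" using f(2) by (simp add: mvec_def sum_distrib_left mult_ac)
      finally show "w i = mvec k Y f i" .
    qed
    have nw: "cnm {..<n} w = cnm {..<k} h" unfolding w_def by (rule cnm_comb[OF u])
    have "mvec n S w = mvec k (mmult n S Y) f"
    proof
      fix i
      have "mvec n S w i = (\<Sum>j<n. \<Sum>c<k. S i j * Y j c * f c)"
        unfolding w by (simp add: mvec_def sum_distrib_left mult.assoc)
      also have "\<dots> = (\<Sum>c<k. \<Sum>j<n. S i j * Y j c * f c)" by (rule sum.swap)
      also have "\<dots> = mvec k (mmult n S Y) f i" by (simp add: mvec_def mmult_def sum_distrib_right)
      finally show "mvec n S w i = mvec k (mmult n S Y) f i" .
    qed
    hence "cnm {..<n} (mvec n S w) \<le> fnorm n k (mmult n S Y) * cnm {..<k} f" by (simp add: mvec_le_fnorm)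
    also have "\<dots> \<le> (\<theta> * s0) * cnm {..<k} f"
      using eg by (intro mult_right_mono) (simp_all add: fnorm_scale)
    also have "\<dots> \<le> \<theta> * cnm {..<n} w"
      using full'[OF f(1)] \<theta> by (simp add: w mult.assoc)
    finally have Sw: "cnm {..<n} (mvec n S w) \<le> \<theta> * cnm {..<n} w" .
    have "cnm {..<n} (mvec n (\<lambda>i j. multiplier i j - G i j) w) \<le> \<theta> * cnm {..<n} w"
      by (rule order_trans[OF mvec_le_fnorm]) (intro mult_right_mono G cnm_nonneg)
    moreover have "mvec n (\<lambda>i j. C' i j - G i j) w = (\<lambda>i. mvec n S w i + mvec n (\<lambda>i j. multiplier i j - G i j) w i)"
      by (simp add: S_eq mvec_def left_diff_distrib sum_subtractf)
    ultimately have "cnm {..<n} (mvec n (\<lambda>i j. C' i j - G i j) w) \<le> 2 * \<theta> * cnm {..<n} w"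
      using Sw cnm_triangle[of "{..<n}" "mvec n S w" "mvec n (\<lambda>i j. multiplier i j - G i j) w"] by simp
    thus "cnm {..<n} (smulv {..<n} (\<lambda>i j. C' i j - G i j) (comb k u h)) \<le> 2 * \<theta> * cnm {..<k} h"
      unfolding w_def[symmetric] nw[symmetric] mvec_eq_smulv .
  qed
  moreover have "2 * \<theta> < 3 * \<theta>" using \<theta> by simp
  ultimately show ?thesis using u unfolding degenerate_def by blast
qed

lemma wide_matrix_kernel:
  assumes Y: "kmat rc n k Y" and k: "n < k"
  shows "\<exists>u. kvec rc k u \<and> cnm {..<k} u = 1 \<and> cnm {..<n} (mvec k Y u) = 0"
proof -
  have "\<exists>h. (\<forall>j. h j \<in> Kset rc) \<and> (\<forall>j. j \<notin> {..<k} \<longrightarrow> h j = 0) \<and> (\<exists>j\<in>{..<k}. h j \<noteq> 0)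
    \<and> (\<forall>e<n. (\<Sum>j\<in>{..<k}. Y e j * h j) = 0)"
    using Y k by (intro underdetermined) (auto simp: kmat_def)
  then obtain h where h: "\<forall>j. h j \<in> Kset rc" "\<forall>j. j \<notin> {..<k} \<longrightarrow> h j = 0" "\<exists>j\<in>{..<k}. h j \<noteq> 0"
    "\<forall>e<n. (\<Sum>j<k. Y e j * h j) = 0" by blast
  have kv: "kvec rc k h" "h \<noteq> (\<lambda>_. 0)" using h(1,2,3) by (auto simp: kvec_def)
  have "cnm {..<n} (mvec k Y h) = 0" using h(4) by (simp add: cnm_eq_0_iff mvec_def)
  hence "cnm {..<n} (mvec k Y (\<lambda>j. complex_of_real (1 / cnm {..<k} h) * h j)) = 0"
    unfolding mvec_scale cnm_scale by simp
  thus ?thesis using cnm_normalized[OF kv] by blast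
qed

text \<open>If all normals \<open>A\<^sub>i Y\<close> vanish then \<open>b = 0\<close>, so the feasible set is a cone; being of bounded
  trace it is trivial.\<close>
lemma degenerate_constraints_zero:
  assumes n: "1 \<le> n" and As: "\<forall>i<m. sadj rc n (As i)"
    and R: "\<forall>X \<in> feas rc n m As b. Re (mtrace n X) \<le> R"
    and K: "\<forall>Y \<in> Mk rc n k m As b. AGA_opnorm rc n k m As Y \<le> K"
    and Y: "Y \<in> Mk rc n k m As b" and zero: "\<forall>i<m. mmult n (As i) Y = (\<lambda>_ _. 0)"
  shows "fnorm n k Y = 0"
proof (rule ccontr)
  assume "fnorm n k Y \<noteq> 0"
  hence pos: "0 < fnorm n k Y" by (simp add: less_le)
  have AY: "Aop n As (mmult k Y (madj Y)) i = 0" if "i < m" for i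
    unfolding Aop_def minner_mmult_left[symmetric] using zero that by (simp add: minner_def)
  have scaled: "t\<^sup>2 * (fnorm n k Y)\<^sup>2 \<le> R" for t :: real
  proof -
    define Z where "Z = (\<lambda>i j. complex_of_real t * Y i j)"
    have ZZ: "mmult k Z (madj Z) = (\<lambda>i j. complex_of_real (t\<^sup>2) * mmult k Y (madj Y) i j)"
      by (simp add: Z_def mmult_def madj_def sum_distrib_left power2_eq_square mult_ac)
    have kZ: "kmat rc n k Z" using Y by (auto simp: Z_def Mk_def kmat_def intro!: Kset_closed)
    have "Aop n As (mmult k Z (madj Z)) i = b i" if "i < m" for i
      using AY[OF that] Y that unfolding ZZ Aop_def minner_scale by (simp add: Mk_def Aop_def)
    hence "Z \<in> Mk rc n k m As b" using kZ by (simp add: Mk_def)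
    then interpret sdp_point rc n m k As b R K Z
      using n As R K by unfold_locales simp_all
    have "(fnorm n k Z)\<^sup>2 = t\<^sup>2 * (fnorm n k Y)\<^sup>2" unfolding Z_def fnorm_scale by (simp add: power_mult_distrib)
    thus ?thesis using fnorm_Y_sq by simp
  qed
  have "0 \<le> R" using scaled[of 0] by simp
  hence "R < (sqrt (R + 1) / fnorm n k Y)\<^sup>2 * (fnorm n k Y)\<^sup>2" using pos by (simp add: power_divide)
  thus False using scaled[of "sqrt (R + 1) / fnorm n k Y"] by simp
qed

text \<open>The constant is \<open>c0 = (200 exp 45)\<^sup>2\<close>, where \<open>200\<close> comes from the operator norm of \<open>W\<close> and
  \<open>exp 45\<close> from the overcrowding estimate.\<close>
lemma smoothed_gap_bound:
  fixes C :: cmat and As :: "nat \<Rightarrow> cmat"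
  defines "c0 \<equiv> 40000 * exp 90 :: real"
  assumes n: "1 \<le> n" and m: "1 \<le> m" and C: "sadj rc n C" and As: "\<forall>i<m. sadj rc n (As i)"
    and R: "\<forall>X \<in> feas rc n m As b. Re (mtrace n X) \<le> R"
    and K: "\<forall>Y \<in> Mk rc n k m As b. AGA_opnorm rc n k m As Y \<le> K"
    and \<sigma>: "0 < \<sigma>" and \<delta>: "0 < \<delta>" "\<delta> < 1"
  defines "\<beta>3 \<equiv> specnorm rc n C + 3 * \<sigma> * sqrt (real n)"
  defines "\<kappa> \<equiv> R * K * \<beta>3"
  defines "L \<equiv> ln (1 + 6 * \<kappa> * sqrt (c0 * real n) / \<sigma>)"
  defines "\<eta> \<equiv> c0 * real n * K * (2 + K * R)\<^sup>2 * \<beta>3 / (9 * real m * \<sigma>\<^sup>2 * L)"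
  assumes k: "real k \<ge> 3 * (ln (real n) + sqrt (ln (1 / \<delta>)) + sqrt (real m * L))"
  shows "\<exists>E \<in> sets (wig_space n).
            measure (wig_space n) E \<ge> 1 - \<delta> - exp (- real n / 2) \<and>
            (\<forall>\<omega> \<in> E. \<forall>eg eH Y. 0 \<le> eg \<longrightarrow> 0 \<le> eH \<longrightarrow>
               is_sosp rc n k m As b (madd C (wigner rc n \<sigma> \<omega>)) eg eH Y \<longrightarrow>
               (let gap = gcost n k (madd C (wigner rc n \<sigma> \<omega>)) Y
                          - sdp_opt rc n m (madd C (wigner rc n \<sigma> \<omega>)) As b
                in 0 \<le> gap \<and> gap \<le> (eH + eg\<^sup>2 * \<eta>) * R + eg / 2 * sqrt R))"
proof (cases "Mk rc n k m As b = {}")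
  case True
  interpret prob_space "wig_space n" unfolding wig_space_gauss by (rule prob_space_gauss)
  have "1 - \<delta> - exp (- real n / 2) \<le> prob (space (wig_space n))"
    using \<delta>(1) exp_gt_zero[of "- real n / 2"] unfolding prob_space by linarith
  thus ?thesis using True by (intro bexI[of _ "space (wig_space n)"]) (simp_all add: is_sosp_def)
next
  case False
  \<comment> \<open>A point of \<open>Mk\<close> is what makes \<open>R\<close> and \<open>K\<close>
    nonnegative.\<close>
  then obtain Y0 where Y0: "Y0 \<in> Mk rc n k m As b" by blast
  interpret prob_space "wig_space n" unfolding wig_space_gauss by (rule prob_space_gauss)
  interpret p0: sdp_point rc n m k As b R K Y0
    using n As R K Y0 by unfold_locales simp_all
  note R0 = p0.R_nonneg and K0 = p0.K_nonneg
  have rn: "1 \<le> real n" using n by simp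
  have c0: "0 < c0" by (simp add: c0_def)
  have sC: "0 \<le> specnorm rc n C" by (rule specnorm_nonneg[OF n])
  have \<sigma>n: "\<sigma> \<le> \<sigma> * sqrt (real n)" using \<sigma> rn by simp
  have \<beta>3: "0 < \<beta>3" using sC \<sigma> n unfolding \<beta>3_def by (intro add_nonneg_pos) simp_all
  define x where "x = \<kappa> * sqrt (c0 * real n) / \<sigma>"
  have \<kappa>0: "0 \<le> \<kappa>" unfolding \<kappa>_def using R0 K0 \<beta>3 by simp
  have x0: "0 \<le> x" unfolding x_def using \<kappa>0 c0 \<sigma> by simp
  have L_x: "L = ln (1 + 6 * x)" unfolding L_def x_def by (simp add: mult.assoc)
  have L0: "0 \<le> L" unfolding L_x using x0 by simp
  have \<eta>0: "0 \<le> \<eta>" unfolding \<eta>_def using c0 K0 L0 \<beta>3 by (intro divide_nonneg_nonneg mult_nonneg_nonneg) simp_all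
  have ln_n: "0 \<le> ln (real n)" using rn by simp
  have ln_\<delta>: "0 < ln (1 / \<delta>)" using \<delta> by simp
  have mL: "0 \<le> real m * L" using L0 by simp
  have k_ln: "3 * ln (real n) \<le> real k" and k_\<delta>: "3 * sqrt (ln (1 / \<delta>)) \<le> real k" and k_L: "3 * sqrt (real m * L) \<le> real k"
  proof -
    have "3 * a \<le> d \<and> 3 * b \<le> d \<and> 3 * c \<le> d" if "3 * (a + b + c) \<le> d" "0 \<le> a" "0 \<le> b" "0 \<le> c" for a b c d :: real
      using that by auto
    from this[OF k ln_n real_sqrt_ge_zero[OF less_imp_le[OF ln_\<delta>]] real_sqrt_ge_zero[OF mL]]
    show "3 * ln (real n) \<le> real k" "3 * sqrt (ln (1 / \<delta>)) \<le> real k" "3 * sqrt (real m * L) \<le> real k"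
      by blast+
  qed
  have "0 < sqrt (ln (1 / \<delta>))" using ln_\<delta> by simp
  hence k_pos: "0 < k" using k_\<delta> by linarith
  have sq: "9 * a \<le> (real k)\<^sup>2" if "3 * sqrt a \<le> real k" "0 \<le> a" for a
  proof -
    have "(3 * sqrt a)\<^sup>2 \<le> (real k)\<^sup>2" using that by (intro power_mono) simp_all
    thus ?thesis using that(2) by (simp add: power_mult_distrib)
  qed
  have kL: "9 * (real m * L) \<le> (real k)\<^sup>2" by (rule sq[OF k_L mL])
  have k\<delta>: "9 * ln (1 / \<delta>) \<le> (real k)\<^sup>2" using ln_\<delta> by (intro sq[OF k_\<delta>]) simp
  obtain A where A: "A \<in> sets (wig_space n)" "prob A \<le> exp (- real n / 2)"
    "\<And>\<omega> x. \<omega> \<in> space (wig_space n) - A \<Longrightarrow>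
       cnm {..<n} (smulv {..<n} (wigner rc n \<sigma> \<omega>) x) \<le> 200 * \<sigma> * sqrt (real n) * cnm {..<n} x"
    using prob_wigner_opnorm[OF n \<sigma>, of rc] by blast
  define \<beta> where "\<beta> = specnorm rc n C + 200 * \<sigma> * sqrt (real n)"
  have \<beta>0: "0 \<le> \<beta>" using sC \<sigma> by (simp add: \<beta>_def)
  \<comment> \<open>The operator norm bound has 200 where \<open>\<beta>3\<close> has 3; the
    quotient \<open>200 / 3\<close> is later absorbed by \<open>c0\<close>.\<close>
  have \<beta>\<beta>3: "\<beta> \<le> 200 / 3 * \<beta>3" using sC by (simp add: \<beta>_def \<beta>3_def)
  have cost: "sdp_cost_point rc n m k As b R K Y (madd C (wigner rc n \<sigma> \<omega>)) \<beta>"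
    if Y: "Y \<in> Mk rc n k m As b" and \<omega>: "\<omega> \<in> space (wig_space n) - A" for Y \<omega>
  proof -
    interpret sdp_point rc n m k As b R K Y using n As R K Y by unfold_locales simp_all
    let ?C = "madd C (wigner rc n \<sigma> \<omega>)"
    show ?thesis
    proof unfold_locales
      show "kmat rc n n ?C"
      proof -
        have "kmat rc n n C" using C unfolding sadj_def by blast
        thus ?thesis using kmat_wigner[of rc n \<sigma> \<omega>] by (auto simp: madd_def kmat_def intro!: Kset_closed)
      qed
      show "?C j i = cnj (?C i j)" if "i < n" "j < n" for i j
      proof -
        have "C j i = cnj (C i j)" using C that unfolding sadj_def by blast
        thus ?thesis using wigner_hermitian[of rc n \<sigma> \<omega> j i] by (simp add: madd_def)
      qed
      show "cnm {..<n} (mvec n ?C x) \<le> \<beta> * cnm {..<n} x" if x: "kvec rc n x" for x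
      proof -
        have "mvec n ?C x = (\<lambda>i. mvec n C x i + smulv {..<n} (wigner rc n \<sigma> \<omega>) x i)"
          by (simp add: mvec_def smulv_def madd_def distrib_right sum.distrib)
        hence "cnm {..<n} (mvec n ?C x) \<le> cnm {..<n} (mvec n C x) + cnm {..<n} (smulv {..<n} (wigner rc n \<sigma> \<omega>) x)"
          by (simp only: cnm_triangle)
        also have "\<dots> \<le> specnorm rc n C * cnm {..<n} x + 200 * \<sigma> * sqrt (real n) * cnm {..<n} x"
          by (intro add_mono specnorm_bound x A(3) \<omega>)
        finally show ?thesis by (simp add: \<beta>_def distrib_right)
      qed
    qed (rule \<beta>0)
  qed
  let ?gap = "\<lambda>\<omega> Y. gcost n k (madd C (wigner rc n \<sigma> \<omega>)) Y - sdp_opt rc n m (madd C (wigner rc n \<sigma> \<omega>)) As b"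
  show ?thesis
  \<comment> \<open>In the first case every second order point has an exact unit null vector, so the
    curvature estimate applies with \<open>s0 = 0\<close> and any nonnegative \<open>\<eta>\<close>
    will do. This covers \<open>\<kappa> = 0\<close>, where \<open>L = 0\<close> and
    \<open>\<eta>\<close> is a quotient by zero. In the second case some normal is nonzero, which
    gives \<open>K * R \<ge> 1\<close>, hence \<open>L \<ge> 1\<close> and
    \<open>k \<ge> 3\<close>.\<close>
  proof (cases "n < k \<or> (\<forall>Y\<in>Mk rc n k m As b. \<forall>i<m. mmult n (As i) Y = (\<lambda>_ _. 0))")
    case True
    have "0 \<le> ?gap \<omega> Y \<and> ?gap \<omega> Y \<le> (eH + eg\<^sup>2 * \<eta>) * R + eg / 2 * sqrt R"
      if \<omega>: "\<omega> \<in> space (wig_space n) - A" and eH: "0 \<le> eH" and so: "is_sosp rc n k m As b (madd C (wigner rc n \<sigma> \<omega>)) eg eH Y" for \<omega> eg eH Y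
    proof -
      have Y: "Y \<in> Mk rc n k m As b" using so by (simp add: is_sosp_def)
      interpret sdp_cost_point rc n m k As b R K Y "madd C (wigner rc n \<sigma> \<omega>)" \<beta> by (rule cost[OF Y \<omega>])
      have "\<exists>u. kvec rc k u \<and> cnm {..<k} u = 1 \<and> cnm {..<n} (mvec k Y u) = 0"
      proof (cases "n < k")
        case True
        thus ?thesis by (rule wide_matrix_kernel[OF kmat_Y])
      next
        case False
        hence "fnorm n k Y = 0" using True Y by (intro degenerate_constraints_zero[OF n As R K Y]) blast
        hence "cnm {..<n} (mvec k Y (unitv 0)) \<le> 0" using mvec_le_fnorm[of n k Y "unitv 0"] by simp
        hence "cnm {..<n} (mvec k Y (unitv 0)) = 0" using cnm_nonneg[of "{..<n}" "mvec k Y (unitv 0)"] by linarith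
        thus ?thesis using kvec_unitv[OF k_pos] cnm_unitv[OF k_pos] by blast
      qed
      then obtain u where u: "kvec rc k u" "cnm {..<k} u = 1" "cnm {..<n} (mvec k Y u) \<le> 0" by auto
      have "\<beta> * K * (2 + K * R)\<^sup>2 * 0\<^sup>2 \<le> eg\<^sup>2 * \<eta>" using \<eta>0 by simp
      from sosp_gap[OF so eH u this] show ?thesis by blast
    qed
    moreover have "1 - \<delta> - exp (- real n / 2) \<le> prob (space (wig_space n) - A)"
      using A(1,2) \<delta> by (simp add: prob_compl)
    moreover have "space (wig_space n) - A \<in> sets (wig_space n)" using A(1) by simp
    ultimately show ?thesis unfolding Let_def by blast
  next
    case False
    hence kn: "k \<le> n" by simp
    from False obtain Y1 i where Y1: "Y1 \<in> Mk rc n k m As b" "i < m" "mmult n (As i) Y1 \<noteq> (\<lambda>_ _. 0)" by blast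
    interpret p1: sdp_point rc n m k As b R K Y1 using n As R K Y1 by unfold_locales simp_all
    have KR: "1 \<le> K * R" by (rule p1.one_le_K_times_R[OF Y1(2,3)])
    have sc0: "sqrt (c0 * real n) = 200 * exp 45 * sqrt (real n)"
    proof -
      have "c0 = (200 * exp 45)\<^sup>2" by (simp add: c0_def power_mult_distrib flip: exp_double)
      thus ?thesis by (simp add: real_sqrt_mult)
    qed
    have x1: "1 \<le> x"
    proof -
      have "1 * \<sigma> \<le> (K * R) * \<beta>3"
        using KR sC \<sigma> \<sigma>n unfolding \<beta>3_def by (intro mult_mono) linarith+
      hence "\<sigma> * 1 \<le> \<kappa> * sqrt (c0 * real n)"
      proof (intro mult_mono)
        have "1 * (1 * 1) \<le> 200 * (exp 45 * sqrt (real n))" using rn by (intro mult_mono) auto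
        thus "1 \<le> sqrt (c0 * real n)" unfolding sc0 by simp
      qed (use \<kappa>0 in \<open>simp_all add: \<kappa>_def mult.commute\<close>)
      thus ?thesis using \<sigma> by (simp add: x_def)
    qed
    have L1: "1 \<le> L"
    proof -
      have "exp 1 \<le> 1 + 6 * x" using exp_le x1 by linarith
      thus ?thesis unfolding L_x using x1 by (subst ln_ge_iff) auto
    qed
    have k3: "3 \<le> k"
    proof -
      have "1 * 1 \<le> real m * L" using m L1 by (intro mult_mono) auto
      hence "1 \<le> sqrt (real m * L)" by simp
      thus ?thesis using k_L by linarith
    qed
    \<comment> \<open>A third of the threshold in \<open>overcrowding\<close>, because
      \<open>full_rank_degenerate\<close> multiplies by 3.\<close>
    define \<theta> where "\<theta> = exp (- 45) * real k * \<sigma> / sqrt (real n) / 3"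
    have \<theta>: "0 < \<theta>" using k_pos \<sigma> n by (simp add: \<theta>_def)
    define \<rho> where "\<rho> = K * R * \<beta>"
    have \<rho>: "0 \<le> \<rho>" using K0 R0 \<beta>0 by (simp add: \<rho>_def)
    obtain F :: "cmat set" where F: "finite F" "real (card F) \<le> (exp 1 * (3 + 2 * \<rho> / \<theta>)) ^ m"
      "\<And>G i j. G \<in> F \<Longrightarrow> i < n \<Longrightarrow> j < n \<Longrightarrow> G j i = cnj (G i j)"
      "\<And>\<nu>. fnorm n n (Aadj m As \<nu>) \<le> \<rho> \<Longrightarrow> \<exists>G\<in>F. fnorm n n (\<lambda>i j. Aadj m As \<nu> i j - G i j) \<le> \<theta>"
      using multiplier_net[OF As \<theta> \<rho>] by blast
    \<comment> \<open>Bounds the ratio of radius to mesh by the quantity inside the logarithm: the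
      factor \<open>200 * exp 45\<close> in \<open>sqrt c0\<close> compensates
      \<open>exp (- 45)\<close> in \<open>\<theta>\<close> and the 200 in
      \<open>\<beta>\<close>.\<close>
    have \<rho>\<theta>: "\<rho> / \<theta> \<le> x"
    proof -
      have e45: "exp (- 45) * exp 45 = (1 :: real)" by (simp flip: exp_add)
      have "x * \<theta> = \<kappa> * (200 * real k / 3) * (exp (- 45) * exp 45)"
        unfolding x_def sc0 \<theta>_def using \<sigma> n by (simp add: field_simps)
      hence "x * \<theta> = \<kappa> * (200 * real k / 3)" by (simp add: e45)
      also have "\<dots> = (K * R) * (200 / 3 * \<beta>3) * real k" by (simp add: \<kappa>_def)
      finally have xt: "x * \<theta> = (K * R) * (200 / 3 * \<beta>3) * real k" .
      have "\<rho> = K * R * \<beta> * 1" by (simp add: \<rho>_def)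
      also have "\<dots> \<le> (K * R) * (200 / 3 * \<beta>3) * real k"
        using \<beta>\<beta>3 K0 R0 \<beta>0 \<beta>3 k_pos by (intro mult_mono) auto
      finally show ?thesis using \<theta> xt by (simp add: divide_le_eq)
    qed
    \<comment> \<open>The comparison \<open>3 * (3 + 2 * x) \<le> (1 + 6 * x)\<^sup>2\<close> relies
      on \<open>x \<ge> 1\<close>; the square absorbs the constants of the net and becomes the 2 in
      \<open>2 * m * L\<close>.\<close>
    have cardF: "real (card F) \<le> exp (2 * (real m * L))"
    proof -
      have "exp 1 * (3 + 2 * (\<rho> / \<theta>)) \<le> 3 * (3 + 2 * x)"
        using \<rho>\<theta> exp_le \<rho> \<theta> by (intro mult_mono) auto
      also have "\<dots> \<le> (1 + 6 * x)\<^sup>2"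
      proof -
        have "1 * 1 \<le> x * x" using x1 by (intro mult_mono) auto
        thus ?thesis using x1 by (simp add: power2_eq_square algebra_simps)
      qed
      also have "\<dots> = exp (2 * L)" unfolding L_x using x0 by (subst exp_double) (simp add: add_nonneg_pos)
      finally have "(exp 1 * (3 + 2 * \<rho> / \<theta>)) ^ m \<le> exp (2 * L) ^ m"
        using \<rho> \<theta> by (intro power_mono) simp_all
      also have "\<dots> = exp (real m * (2 * L))" by (rule exp_of_nat_mult[symmetric])
      finally show ?thesis using F(2) by (simp add: mult_ac)
    qed
    have \<theta>3: "3 * \<theta> = exp (- 45) * real k * \<sigma> / sqrt (real n)" by (simp add: \<theta>_def)
    define Z where "Z G = shifted_degenerate rc n \<sigma> (\<lambda>i j. C i j - G i j) {..<n} k (3 * \<theta>) (frames rc {..<n} k)" for G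
    have Zs: "Z G \<in> sets (wig_space n)" for G unfolding Z_def by (rule sets_shifted_degenerate) simp_all
    have pZ: "prob (Z G) \<le> exp (- (real k)\<^sup>2)" if "G \<in> F" for G
      unfolding Z_def \<theta>3
    proof (rule overcrowding[OF \<sigma> k3 kn k_ln])
      fix a c assume ac: "a < n" "c < n"
      have "C c a = cnj (C a c)" using C ac unfolding sadj_def by blast
      moreover have "G c a = cnj (G a c)" by (rule F(3)[OF that ac])
      ultimately show "C c a - G c a = cnj (C a c - G a c)" by simp
    qed
    define Bad where "Bad = (\<Union>G\<in>F. Z G)"
    have Bs: "Bad \<in> sets (wig_space n)" unfolding Bad_def using F(1) Zs by (intro sets.finite_UN) auto
    have pB: "prob Bad \<le> \<delta>"
    proof -
      have "prob Bad \<le> (\<Sum>G\<in>F. prob (Z G))"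
        unfolding Bad_def using F(1) Zs by (intro finite_measure_subadditive_finite) auto
      also have "\<dots> \<le> (\<Sum>G\<in>F. exp (- (real k)\<^sup>2))" by (rule sum_mono[OF pZ])
      also have "\<dots> = real (card F) * exp (- (real k)\<^sup>2)" by simp
      also have "\<dots> \<le> exp (2 * (real m * L)) * exp (- (real k)\<^sup>2)" using cardF by (intro mult_right_mono) simp_all
      also have "\<dots> = exp (2 * (real m * L) - (real k)\<^sup>2)" by (simp flip: exp_add)
      \<comment> \<open>The terms \<open>2 * m * L\<close> and \<open>ln (1 / \<delta>)\<close> take
        at most \<open>2 / 9\<close> and \<open>1 / 9\<close> of \<open>k\<^sup>2\<close>.\<close>
      also have "\<dots> \<le> exp (- ln (1 / \<delta>))" 
      proof -
        have "2 * a - c \<le> - d" if "9 * a \<le> c" "9 * d \<le> c" "0 \<le> c" for a c d :: real using that by linarith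
        from this[OF kL k\<delta> zero_le_power2] show ?thesis by simp
      qed
      also have "\<dots> = \<delta>" using \<delta> by (simp add: ln_div)
      finally show ?thesis .
    qed
    define E where "E = space (wig_space n) - (A \<union> Bad)"
    have Es: "E \<in> sets (wig_space n)" unfolding E_def using A(1) Bs by simp
    have pE: "1 - \<delta> - exp (- real n / 2) \<le> prob E"
    proof -
      have "prob (A \<union> Bad) \<le> prob A + prob Bad" using A(1) Bs by (rule measure_Un_le)
      moreover have "prob E = 1 - prob (A \<union> Bad)" unfolding E_def using A(1) Bs by (intro prob_compl) simp
      ultimately show ?thesis using A(2) pB by linarith
    qed
    have "0 \<le> ?gap \<omega> Y \<and> ?gap \<omega> Y \<le> (eH + eg\<^sup>2 * \<eta>) * R + eg / 2 * sqrt R"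
      if \<omega>: "\<omega> \<in> E" and eg: "0 \<le> eg" and eH: "0 \<le> eH" and so: "is_sosp rc n k m As b (madd C (wigner rc n \<sigma> \<omega>)) eg eH Y" for \<omega> eg eH Y
    proof -
      have Y: "Y \<in> Mk rc n k m As b" using so by (simp add: is_sosp_def)
      have \<omega>': "\<omega> \<in> space (wig_space n) - A" using \<omega> by (simp add: E_def)
      interpret sdp_cost_point rc n m k As b R K Y "madd C (wigner rc n \<sigma> \<omega>)" \<beta> by (rule cost[OF Y \<omega>'])
      \<comment> \<open>The value with \<open>eg = 2 * \<theta> * s0\<close>: at this level the
        first order condition is exactly the hypothesis of
        \<open>full_rank_degenerate\<close>.\<close>
      define s0 where "s0 = eg / (2 * \<theta>)"
      have s0: "0 \<le> s0" using eg \<theta> by (simp add: s0_def)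
      have "\<exists>u. kvec rc k u \<and> cnm {..<k} u = 1 \<and> cnm {..<n} (mvec k Y u) \<le> s0"
      proof (rule ccontr)
        assume "\<not> ?thesis"
        hence full: "s0 < cnm {..<n} (mvec k Y u)" if "kvec rc k u" "cnm {..<k} u = 1" for u
          using that not_le by blast
        have "fnorm n n multiplier \<le> \<rho>" unfolding \<rho>_def by (rule fnorm_multiplier)
        then obtain G where G: "G \<in> F" "fnorm n n (\<lambda>i j. multiplier i j - G i j) \<le> \<theta>"
          using F(4) unfolding multiplier_def by blast
        have "fnorm n k (\<lambda>a c. 2 * mmult n S Y a c) \<le> eg" using so unfolding is_sosp_def S_def by blast
        also have "eg = 2 * \<theta> * s0" using \<theta> by (simp add: s0_def)
        finally have "(\<lambda>i j. madd C (wigner rc n \<sigma> \<omega>) i j - G i j) \<in> degenerate rc {..<n} k (3 * \<theta>) (frames rc {..<n} k)"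
          by (rule full_rank_degenerate[OF _ \<theta> s0 full G(2)])
        hence "\<omega> \<in> Z G" using \<omega>' by (simp add: Z_def shifted_degenerate_def madd_def diff_add_eq)
        thus False using \<omega> G(1) by (auto simp: E_def Bad_def)
      qed
      then obtain u where u: "kvec rc k u" "cnm {..<k} u = 1" "cnm {..<n} (mvec k Y u) \<le> s0" by blast
      \<comment> \<open>Here \<open>s0\<^sup>2\<close> is
        \<open>eg\<^sup>2 / (4 * \<theta>\<^sup>2)\<close> and \<open>\<theta>\<^sup>2\<close> is
        proportional to \<open>k\<^sup>2 * \<sigma>\<^sup>2 / n\<close>; replacing
        \<open>k\<^sup>2\<close> by its lower bound \<open>9 * m * L\<close> produces the
        denominator of \<open>\<eta>\<close>.\<close>
      have "\<beta> * K * (2 + K * R)\<^sup>2 * s0\<^sup>2 \<le> eg\<^sup>2 * \<eta>"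
      proof -
        have "exp (- 45) * exp (- 45) * exp (90::real) = 1" by (simp flip: exp_add)
        hence t2: "(exp (- 45 :: real))\<^sup>2 * exp 90 = 1" by (simp only: power2_eq_square)
        have \<theta>2: "\<theta>\<^sup>2 * (9 * real n) = (exp (- 45))\<^sup>2 * ((real k)\<^sup>2 * \<sigma>\<^sup>2)"
          using n by (simp add: \<theta>_def power_mult_distrib power_divide)
        have "4 * \<theta>\<^sup>2 * (c0 * real n) = 160000 / 9 * ((real k)\<^sup>2 * \<sigma>\<^sup>2) * ((exp (- 45))\<^sup>2 * exp 90)"
          using \<theta>2 by (simp add: c0_def field_simps)
        hence c\<theta>: "4 * \<theta>\<^sup>2 * (c0 * real n) = 160000 / 9 * ((real k)\<^sup>2 * \<sigma>\<^sup>2)" by (simp only: t2 mult_1_right)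
        have "200 / 3 * (9 * (real m * L) * \<sigma>\<^sup>2) \<le> 160000 / 9 * ((real k)\<^sup>2 * \<sigma>\<^sup>2)"
        proof -
          have "9 * (real m * L) * \<sigma>\<^sup>2 \<le> (real k)\<^sup>2 * \<sigma>\<^sup>2" using kL by (intro mult_right_mono) simp_all
          moreover have "200 / 3 * a \<le> 160000 / 9 * c" if "a \<le> c" "0 \<le> c" for a c :: real using that by linarith
          ultimately show ?thesis by (meson mult_nonneg_nonneg zero_le_power2)
        qed
        hence key: "200 / 3 * (9 * real m * \<sigma>\<^sup>2 * L) \<le> 4 * \<theta>\<^sup>2 * (c0 * real n)" unfolding c\<theta> by (simp add: mult_ac)
        have den: "0 < 9 * real m * \<sigma>\<^sup>2 * L" using m \<sigma> L1 by simp
        have fr: "200 / 3 / (4 * \<theta>\<^sup>2) \<le> c0 * real n / (9 * real m * \<sigma>\<^sup>2 * L)"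
          using key den \<theta> by (simp add: divide_le_eq le_divide_eq mult_ac)
        have "\<beta> * K * (2 + K * R)\<^sup>2 * s0\<^sup>2 = \<beta> * (K * (2 + K * R)\<^sup>2 * s0\<^sup>2)" by (simp add: mult.assoc)
        also have "\<dots> \<le> 200 / 3 * \<beta>3 * (K * (2 + K * R)\<^sup>2 * s0\<^sup>2)"
          using K0 by (intro mult_right_mono \<beta>\<beta>3) simp_all
        also have "\<dots> = (200 / 3 / (4 * \<theta>\<^sup>2)) * (\<beta>3 * K * (2 + K * R)\<^sup>2 * eg\<^sup>2)"
          using \<theta> by (simp add: s0_def power_divide power_mult_distrib)
        also have "\<dots> \<le> (c0 * real n / (9 * real m * \<sigma>\<^sup>2 * L)) * (\<beta>3 * K * (2 + K * R)\<^sup>2 * eg\<^sup>2)"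
          using fr \<beta>3 K0 by (intro mult_right_mono) simp_all
        also have "\<dots> = eg\<^sup>2 * \<eta>" by (simp add: \<eta>_def)
        finally show ?thesis .
      qed
      from sosp_gap[OF so eH u this] show ?thesis by blast
    qed
    thus ?thesis using Es pE unfolding Let_def by blast
  qed
qed

theorem theorem1:
  shows "\<exists>c0::real. c0 > 0 \<and>
   (\<forall>(rc::bool) (n::nat) (m::nat) (k::nat) (C::cmat) (As::nat \<Rightarrow> cmat) (b::nat \<Rightarrow> real)
      (R::real) (K::real) (\<sigma>::real) (\<delta>::real).
     1 \<le> n \<longrightarrow> 1 \<le> m \<longrightarrow>
     sadj rc n C \<longrightarrow> (\<forall>i<m. sadj rc n (As i)) \<longrightarrow>
     SMA rc n m As b \<longrightarrow>
     compact (feas rc n m As b) \<longrightarrow>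
     (\<forall>X \<in> feas rc n m As b. Re (mtrace n X) \<le> R) \<longrightarrow>
     (\<forall>Y \<in> Mk rc n k m As b. AGA_opnorm rc n k m As Y \<le> K) \<longrightarrow>
     0 < \<sigma> \<longrightarrow> 0 < \<delta> \<longrightarrow> \<delta> < 1 \<longrightarrow>
     (let \<kappa> = R * K * (specnorm rc n C + 3 * \<sigma> * sqrt (real n));
          L = ln (1 + 6 * \<kappa> * sqrt (c0 * real n) / \<sigma>);
          \<eta> = c0 * real n * K * (2 + K * R)\<^sup>2 * (specnorm rc n C + 3 * \<sigma> * sqrt (real n))
               / (9 * real m * \<sigma>\<^sup>2 * L)
      in real k \<ge> 3 * (ln (real n) + sqrt (ln (1 / \<delta>)) + sqrt (real m * L)) \<longrightarrow>
         (\<exists>E \<in> sets (wig_space n).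
            measure (wig_space n) E \<ge> 1 - \<delta> - exp (- real n / 2) \<and>
            (\<forall>\<omega> \<in> E. \<forall>eg eH Y. 0 \<le> eg \<longrightarrow> 0 \<le> eH \<longrightarrow>
               is_sosp rc n k m As b (madd C (wigner rc n \<sigma> \<omega>)) eg eH Y \<longrightarrow>
               (let gap = gcost n k (madd C (wigner rc n \<sigma> \<omega>)) Y
                          - sdp_opt rc n m (madd C (wigner rc n \<sigma> \<omega>)) As b
                in 0 \<le> gap \<and> gap \<le> (eH + eg\<^sup>2 * \<eta>) * R + eg / 2 * sqrt R)))))"
proof (rule exI[of _ "40000 * exp 90"], intro conjI allI impI)
  show "0 < 40000 * exp (90 :: real)" by simp
qed (unfold Let_def, intro impI, rule smoothed_gap_bound[unfolded Let_def])

end
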